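(* Let $p$ be an odd prime and let $G$ be a group of order $p^5$ in $\Phi_7\cup\Phi_8$. Then the Wedderburn decomposition of $\mathbb{Q}G$ is $$\mathbb{Q}G\cong\mathbb{Q}(G/G')\oplus p\,M_p(\mathbb{Q}(\zeta_p))\oplus M_{p^2}(\mathbb{Q}(\zeta_p)).$$
   Context: $\zeta_p$ is a primitive $p$-th root of unity; $M_n(D)$ is the ring of $n\times n$ matrices over $D$; $aR$ denotes the direct sum of $a$ copies of the algebra $R$. Two groups $G,H$ are isoclinic if there are isomorphisms $G/Z(G)\to H/Z(H)$ and $G'\to H'$ compatible with the commutator maps. From R. James' classification: $\Phi_7$ is the isoclinism family of the order-$p^5$ group $\Phi_7(1^5)=\langle\alpha,\alpha_1,\alpha_2,\alpha_3,\beta:[\alpha_i,\alpha]=\alpha_{i+1},\ [\alpha_1,\beta]=\alpha_3,\ \alpha^p=\alpha_1^{(p)}=\alpha_{i+1}^p=\beta^p=1\ (i=1,2)\rangle$, where $\alpha_1^{(p)}=\alpha_1^p$ for $p\ge5$ and $\alpha_1^{(3)}=\alpha_1^3\alpha_2^3\alpha_3$ for $p=3$; $\Phi_8$ is the isoclinism family of the order-$p^5$ group $\Phi_8(32)=\langle\alpha_1,\alpha_2,\beta:[\alpha_1,\alpha_2]=\beta=\alpha_1^p,\ \beta^{p^2}=\alpha_2^{p^2}=1\rangle$. Here $[x,y]=x^{-1}y^{-1}xy$ and unlisted commutators of generators are trivial.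
   Formalization: In the presentation of Φ_8(32), the commutator [α_2,β] is not set to 1: the convention on unlisted commutators would collapse the group to order p^4, contradicting the stated order p^5; here β only abbreviates [α_1,α_2]=α_1^p. *)

theory Defs
  imports
    "HOL-Algebra.Algebra"
    "HOL-Computational_Algebra.Primes"
    "HOL-Analysis.Analysis"
    "Jordan_Normal_Form.VS_Connect"
begin

section \<open>Isoclinism\<close>

definition center :: "('a, 'b) monoid_scheme \<Rightarrow> 'a set" where
  "center G = {z \<in> carrier G. \<forall>x \<in> carrier G. z \<otimes>\<^bsub>G\<^esub> x = x \<otimes>\<^bsub>G\<^esub> z}"

text \<open>
  The convention is \<open>[x, y] = x\<^sup>-\<^sup>1 y\<^sup>-\<^sup>1 x y\<close>. The library's \<^const>\<open>derived\<close> subgroup is generated by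
  the elements \<open>x y x\<^sup>-\<^sup>1 y\<^sup>-\<^sup>1\<close>; over a group these are the same elements, with the arguments inverted.
\<close>

definition comm :: "('a, 'b) monoid_scheme \<Rightarrow> 'a \<Rightarrow> 'a \<Rightarrow> 'a" where
  "comm G x y = inv\<^bsub>G\<^esub> x \<otimes>\<^bsub>G\<^esub> inv\<^bsub>G\<^esub> y \<otimes>\<^bsub>G\<^esub> x \<otimes>\<^bsub>G\<^esub> y"

abbreviation commutator_subgroup :: "('a, 'b) monoid_scheme \<Rightarrow> 'a set" where
  "commutator_subgroup G \<equiv> derived G (carrier G)"

definition isoclinic :: "('a, 'b) monoid_scheme \<Rightarrow> ('c, 'd) monoid_scheme \<Rightarrow> bool" where
  "isoclinic G H \<longleftrightarrow>
    (\<exists>\<phi> \<psi>. \<phi> \<in> iso (G Mod center G) (H Mod center H) \<and>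
      \<psi> \<in> iso (G\<lparr>carrier := commutator_subgroup G\<rparr>) (H\<lparr>carrier := commutator_subgroup H\<rparr>) \<and>
      (\<forall>x \<in> carrier G. \<forall>y \<in> carrier G. \<forall>x' \<in> carrier H. \<forall>y' \<in> carrier H.
        \<phi> (center G #>\<^bsub>G\<^esub> x) = center H #>\<^bsub>H\<^esub> x' \<longrightarrow>
        \<phi> (center G #>\<^bsub>G\<^esub> y) = center H #>\<^bsub>H\<^esub> y' \<longrightarrow>
        \<psi> (comm G x y) = comm H x' y'))"


section \<open>Groups given by generators and relations\<close>

text \<open>
  The generators are all elements of the type \<open>'g\<close>. A letter \<open>(g, True)\<close> stands for \<open>g\<close> and
  \<open>(g, False)\<close> for its inverse.
\<close>

type_synonym 'g word = "('g \<times> bool) list"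

definition gen :: "'g \<Rightarrow> 'g word" where
  "gen g = [(g, True)]"

definition word_inv :: "'g word \<Rightarrow> 'g word" where
  "word_inv w = rev (map (\<lambda>(g, b). (g, \<not> b)) w)"

definition word_pow :: "'g word \<Rightarrow> nat \<Rightarrow> 'g word" where
  "word_pow w n = concat (replicate n w)"

definition word_comm :: "'g word \<Rightarrow> 'g word \<Rightarrow> 'g word" where
  "word_comm u v = word_inv u @ word_inv v @ u @ v"

text \<open>A pair \<open>(l, r)\<close> of words in \<open>R\<close> is the defining relation \<open>l = r\<close>.\<close>

inductive word_eq :: "('g word \<times> 'g word) set \<Rightarrow> 'g word \<Rightarrow> 'g word \<Rightarrow> bool"
  for R :: "('g word \<times> 'g word) set"
where
  refl: "word_eq R u u"
| sym: "word_eq R u v \<Longrightarrow> word_eq R v u"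
| trans: "word_eq R u v \<Longrightarrow> word_eq R v w \<Longrightarrow> word_eq R u w"
| cancel: "word_eq R (u @ [(g, b), (g, \<not> b)] @ v) (u @ v)"
| rel: "(l, r) \<in> R \<Longrightarrow> word_eq R (u @ l @ v) (u @ r @ v)"

definition word_class :: "('g word \<times> 'g word) set \<Rightarrow> 'g word \<Rightarrow> 'g word set" where
  "word_class R u = {v. word_eq R u v}"

definition presented_group :: "('g word \<times> 'g word) set \<Rightarrow> 'g word set monoid" where
  "presented_group R =
    \<lparr>carrier = range (word_class R),
     monoid.mult = (\<lambda>A B. \<Union>u \<in> A. \<Union>v \<in> B. word_class R (u @ v)),
     one = word_class R []\<rparr>"

lemma word_class_eq_iff: "word_class R u = word_class R v \<longleftrightarrow> word_eq R u v"
proof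
  assume "word_class R u = word_class R v"
  moreover have "v \<in> word_class R v"
    by (simp add: word_class_def word_eq.refl)
  ultimately show "word_eq R u v"
    by (auto simp: word_class_def)
next
  assume uv: "word_eq R u v"
  have "word_eq R u w \<longleftrightarrow> word_eq R v w" for w
    using word_eq.trans[OF uv] word_eq.trans[OF word_eq.sym[OF uv]] by iprover
  then show "word_class R u = word_class R v"
    unfolding word_class_def by (rule Collect_cong)
qed

lemma word_eq_append_right: "word_eq R u v \<Longrightarrow> word_eq R (u @ w) (v @ w)"
proof (induction rule: word_eq.induct)
  case (refl u)
  show ?case by (rule word_eq.refl)
next
  case (sym u v)
  show ?case by (rule word_eq.sym) (rule sym.IH)
next
  case (trans u v x)
  show ?case by (rule word_eq.trans) (rule trans.IH)+
next
  case (cancel u g b v)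
  then show ?case using word_eq.cancel[of R u g b "v @ w"] by simp
next
  case (rel l r u v)
  then show ?case using word_eq.rel[of l r R u "v @ w"] by simp
qed

lemma word_eq_append_left: "word_eq R u v \<Longrightarrow> word_eq R (w @ u) (w @ v)"
proof (induction rule: word_eq.induct)
  case (refl u)
  show ?case by (rule word_eq.refl)
next
  case (sym u v)
  show ?case by (rule word_eq.sym) (rule sym.IH)
next
  case (trans u v x)
  show ?case by (rule word_eq.trans) (rule trans.IH)+
next
  case (cancel u g b v)
  then show ?case using word_eq.cancel[of R "w @ u" g b v] by simp
next
  case (rel l r u v)
  then show ?case using word_eq.rel[of l r R "w @ u" v] by simp
qed

lemma word_eq_append:
  "word_eq R u u' \<Longrightarrow> word_eq R v v' \<Longrightarrow> word_eq R (u @ v) (u' @ v')"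
  by (meson word_eq.trans word_eq_append_left word_eq_append_right)

lemma word_eq_inv_left: "word_eq R (word_inv w @ w) []"
proof (induction w)
  case Nil
  then show ?case by (simp add: word_inv_def word_eq.refl)
next
  case (Cons a w)
  obtain g b where a: "a = (g, b)" by force
  have "word_eq R (word_inv w @ [(g, \<not> b), (g, \<not> \<not> b)] @ w) (word_inv w @ w)"
    by (rule word_eq.cancel)
  then have "word_eq R (word_inv w @ [(g, \<not> b), (g, \<not> \<not> b)] @ w) []"
    using Cons.IH by (rule word_eq.trans)
  then show ?case by (simp add: a word_inv_def)
qed

lemma mult_presented_group:
  "word_class R u \<otimes>\<^bsub>presented_group R\<^esub> word_class R v = word_class R (u @ v)"
proof -
  have "word_class R (a @ b) = word_class R (u @ v)"
    if "a \<in> word_class R u" "b \<in> word_class R v" for a b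
  proof -
    have "word_eq R (u @ v) (a @ b)"
      using that by (intro word_eq_append) (simp_all add: word_class_def)
    then show ?thesis
      unfolding word_class_eq_iff by (rule word_eq.sym)
  qed
  then have "(\<Union>a \<in> word_class R u. \<Union>b \<in> word_class R v. word_class R (a @ b)) =
      (\<Union>a \<in> word_class R u. \<Union>b \<in> word_class R v. word_class R (u @ v))"
    by (intro SUP_cong HOL.refl)
  also have "\<dots> = word_class R (u @ v)"
    using word_eq.refl[of R u] word_eq.refl[of R v] by (auto simp: word_class_def)
  finally show ?thesis
    by (simp add: presented_group_def)
qed

lemma carrier_presented_group: "carrier (presented_group R) = range (word_class R)"
  and one_presented_group: "\<one>\<^bsub>presented_group R\<^esub> = word_class R []"
  by (simp_all add: presented_group_def)

lemma group_presented_group: "group (presented_group R)"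
proof (rule groupI)
  fix x assume "x \<in> carrier (presented_group R)"
  then obtain u where "x = word_class R u" by (auto simp: carrier_presented_group)
  moreover have "word_class R (word_inv u @ u) = word_class R []"
    by (simp add: word_class_eq_iff word_eq_inv_left)
  ultimately show "\<exists>y \<in> carrier (presented_group R). y \<otimes>\<^bsub>presented_group R\<^esub> x = \<one>\<^bsub>presented_group R\<^esub>"
    by (auto simp: carrier_presented_group one_presented_group mult_presented_group intro!: bexI)
qed (auto simp: carrier_presented_group one_presented_group mult_presented_group)


section \<open>The groups $\Phi_7(1^5)$ and $\Phi_8(32)$\<close>

datatype gens7 = Alpha | Alpha1 | Alpha2 | Alpha3 | Beta

text \<open>
  The second set consists of the unlisted commutators of generators, which are trivial.
\<close>

definition Phi7_15 :: "nat \<Rightarrow> gens7 word set monoid" where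
  "Phi7_15 p =
    (let a = gen Alpha; a1 = gen Alpha1; a2 = gen Alpha2; a3 = gen Alpha3; b = gen Beta in
     presented_group
      ({(word_comm a1 a, a2), (word_comm a2 a, a3), (word_comm a1 b, a3),
        (word_pow a p, []),
        (if p = 3 then word_pow a1 3 @ word_pow a2 3 @ a3 else word_pow a1 p, []),
        (word_pow a2 p, []), (word_pow a3 p, []), (word_pow b p, [])} \<union>
       {(word_comm a3 a, []), (word_comm a b, []), (word_comm a2 b, []), (word_comm a3 b, []),
        (word_comm a1 a2, []), (word_comm a1 a3, []), (word_comm a2 a3, [])}))"

datatype gens8 = Alpha1' | Alpha2' | Beta'

text \<open>
  Here \<open>\<beta>\<close> only abbreviates \<open>[\<alpha>\<^sub>1, \<alpha>\<^sub>2] = \<alpha>\<^sub>1\<^sup>p\<close>, so it commutes with \<open>\<alpha>\<^sub>1\<close>, but \<open>[\<alpha>\<^sub>2, \<beta>] = 1\<close> must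
  not be added: together with \<open>\<alpha>\<^sub>2\<^sup>-\<^sup>1 \<alpha>\<^sub>1 \<alpha>\<^sub>2 = \<alpha>\<^sub>1\<^sup>1\<^sup>+\<^sup>p\<close> it would force \<open>\<alpha>\<^sub>1\<close> to have order dividing
  \<open>p\<^sup>2\<close>, and the group would have order \<open>p\<^sup>4\<close> instead of \<open>p\<^sup>5\<close>.
\<close>

definition Phi8_32 :: "nat \<Rightarrow> gens8 word set monoid" where
  "Phi8_32 p =
    (let a1 = gen Alpha1'; a2 = gen Alpha2'; b = gen Beta' in
     presented_group
      {(word_comm a1 a2, b), (b, word_pow a1 p),
       (word_pow b (p\<^sup>2), []), (word_pow a2 (p\<^sup>2), [])})"

definition in_Phi7 :: "nat \<Rightarrow> ('a, 'b) monoid_scheme \<Rightarrow> bool" where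
  "in_Phi7 p G \<longleftrightarrow> isoclinic G (Phi7_15 p)"

definition in_Phi8 :: "nat \<Rightarrow> ('a, 'b) monoid_scheme \<Rightarrow> bool" where
  "in_Phi8 p G \<longleftrightarrow> isoclinic G (Phi8_32 p)"


section \<open>Algebras over the rationals\<close>

text \<open>
  Algebras are \<^typ>\<open>(rat, 'a) module\<close> records; they need not be commutative, unlike in the
  library's locale \<^locale>\<open>algebra\<close>.
\<close>

definition rat_algebra_isomorphic :: "(rat, 'a) module \<Rightarrow> (rat, 'b) module \<Rightarrow> bool"
  (infix \<open>\<simeq>\<^sub>\<rat>\<close> 50) where
  "A \<simeq>\<^sub>\<rat> B \<longleftrightarrow>
    (\<exists>f \<in> ring_iso A B. \<forall>c. \<forall>x \<in> carrier A. f (c \<odot>\<^bsub>A\<^esub> x) = c \<odot>\<^bsub>B\<^esub> f x)"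

definition alg_sum :: "(rat, 'a) module \<Rightarrow> (rat, 'b) module \<Rightarrow> (rat, 'a \<times> 'b) module"
  (infixr \<open>\<oplus>\<^sub>\<rat>\<close> 65) where
  "A \<oplus>\<^sub>\<rat> B = ring.extend (RDirProd A B) \<lparr>module.smult = (\<lambda>c (x, y). (c \<odot>\<^bsub>A\<^esub> x, c \<odot>\<^bsub>B\<^esub> y))\<rparr>"

definition alg_copies :: "nat \<Rightarrow> (rat, 'a) module \<Rightarrow> (rat, 'a list) module" where
  "alg_copies n A =
    ring.extend (RDirProd_list (replicate n A)) \<lparr>module.smult = (\<lambda>c. map (\<lambda>x. c \<odot>\<^bsub>A\<^esub> x))\<rparr>"

text \<open>
  Elements of the group algebra are the finitely supported functions on the group; the product
  is convolution, \<open>(f g)(x) = \<Sum>\<^sub>y f(y) g(y\<^sup>-\<^sup>1 x)\<close>.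
\<close>

definition rat_group_algebra :: "('a, 'b) monoid_scheme \<Rightarrow> (rat, 'a \<Rightarrow> rat) module" where
  "rat_group_algebra G =
    \<lparr>carrier = {f. finite {x. f x \<noteq> 0} \<and> {x. f x \<noteq> 0} \<subseteq> carrier G},
     monoid.mult = (\<lambda>f g x. if x \<in> carrier G
                     then \<Sum>y | f y \<noteq> 0. f y * g (inv\<^bsub>G\<^esub> y \<otimes>\<^bsub>G\<^esub> x) else 0),
     one = (\<lambda>x. if x = \<one>\<^bsub>G\<^esub> then 1 else 0),
     ring.zero = (\<lambda>x. 0),
     ring.add = (\<lambda>f g x. f x + g x),
     module.smult = (\<lambda>c f x. c * f x)\<rparr>"

definition matrix_algebra :: "nat \<Rightarrow> complex set \<Rightarrow> (rat, complex mat) module" where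
  "matrix_algebra n K =
    \<lparr>carrier = {A \<in> carrier_mat n n. elements_mat A \<subseteq> K},
     monoid.mult = (*),
     one = 1\<^sub>m n,
     ring.zero = 0\<^sub>m n n,
     ring.add = (+),
     module.smult = (\<lambda>c A. of_rat c \<cdot>\<^sub>m A)\<rparr>"

definition primitive_root_of_unity :: "nat \<Rightarrow> complex \<Rightarrow> bool" where
  "primitive_root_of_unity n z \<longleftrightarrow> 0 < n \<and> z ^ n = 1 \<and> (\<forall>k. 0 < k \<and> k < n \<longrightarrow> z ^ k \<noteq> 1)"

definition rat_adjoin :: "complex \<Rightarrow> complex set" where
  "rat_adjoin z = generate_field (class_ring :: complex ring) (insert z \<rat>)"

end

theory Submission
  imports Defs "HOL-Library.Function_Algebras"
begin

text \<open>
  Let \<open>Z\<close> be the center of \<open>G\<close>, of order \<open>p\<close>, and \<open>Z\<^sub>2\<close> the second center. Both families are governed by the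
  same commutator relations, which are invariant under isoclinism: \<open>Z\<^sub>2/Z\<close> is elementary abelian of order
  \<open>p\<^sup>2\<close>, \<open>G'/Z\<close> is one of its \<open>p + 1\<close> subgroups of order \<open>p\<close>, and for each of the other ones, \<open>N/Z\<close>, the
  quotient \<open>G/N\<close> is extraspecial of order \<open>p\<^sup>3\<close>; moreover each \<open>g \<notin> Z\<close> has a nontrivial commutator in \<open>Z\<close>.
  Hence \<open>G\<close> itself and the \<open>p\<close> groups \<open>G/N\<close> are fully ramified over a central subgroup of order \<open>p\<close>. In each
  of them there is a subgroup \<open>B\<close> which meets that center trivially and is so large that inducing the
  linear character of \<open>center \<times> B\<close> with kernel \<open>B\<close> gives an irreducible representation; its matrices
  have entries in \<open>\<rat>(\<zeta>\<^sub>p)\<close>, so that no Schur index enters. Together with \<open>\<rat>G \<rightarrow> \<rat>(G/G')\<close> these \<open>p + 1\<close>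
  representations define an injective homomorphism, and the dimensions over \<open>\<rat>\<close> agree.
\<close>

section \<open>Roots of unity of prime order\<close>

text \<open>Injectivity is a statement about lines in a plane. The big representation makes an
  element \<open>f\<close> of the common kernel constant on the cosets of Z, so that on each coset
  of the second center \<open>f\<close> becomes a function on an affine plane over the field with
  \<open>p\<close> elements. The cosets of G' and of the groups N are its lines: the map to the
  abelianization makes the lines of one direction sum to 0, each small representation makes parallel
  lines of one direction sum to the same value, and so all line sums vanish. The dimensions agree
  because p^3 + (p * p^2 + p^4)(p - 1) = p^5; here the degree p - 1 of \<zeta> comes from
  Eisenstein's criterion. Isoclinism transports only commutators and central cosets, so the
  generators are described in these terms. Manipulating words cannot show that an element of a
  presented group is nontrivial; for this each presentation receives an explicit action. That Z has
  order p is then read off from the order p^5 of G. Oddness of p enters through p dividing p(p -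
  1)/2: in groups of order p^3 it yields noncentral elements of order p, and it fixes the powers of
  1 + p modulo p^3.\<close>

lemma eisenstein_aux:
  fixes F G :: "int poly" and p :: int
  assumes p: "Factorial_Ring.prime p"
    and lc: "\<not> p dvd Polynomial.lead_coeff (F * G)"
    and low: "\<And>i. i < Polynomial.degree (F * G) \<Longrightarrow> p dvd poly.coeff (F * G) i"
    and F0: "p dvd poly.coeff F 0" and G0: "\<not> p dvd poly.coeff G 0"
  shows "Polynomial.degree G = 0"
proof -
  have nz: "F * G \<noteq> 0"
    using lc by auto
  then have deg: "Polynomial.degree (F * G) = Polynomial.degree F + Polynomial.degree G"
    by (auto intro: degree_mult_eq)
  have "\<not> p dvd Polynomial.lead_coeff F"
    using lc by (auto simp: lead_coeff_mult)
  \<comment> \<open>In coefficient \<open>k\<close> of the product all terms except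
    \<open>coeff F k * coeff G 0\<close> are divisible by \<open>p\<close>. Hence \<open>k\<close>
    is already the degree of the product, and no degree is left for \<open>G\<close>.\<close>
  define k where "k = (LEAST k. \<not> p dvd poly.coeff F k)"
  have k: "\<not> p dvd poly.coeff F k" "k \<le> Polynomial.degree F"
    using \<open>\<not> p dvd Polynomial.lead_coeff F\<close> LeastI[of "\<lambda>k. \<not> p dvd poly.coeff F k"]
      Least_le[of "\<lambda>k. \<not> p dvd poly.coeff F k"] unfolding k_def by blast+
  have lt: "p dvd poly.coeff F i" if "i < k" for i
    using not_less_Least[of i "\<lambda>k. \<not> p dvd poly.coeff F k"] that unfolding k_def by auto
  have "poly.coeff (F * G) k = (\<Sum>i<k. poly.coeff F i * poly.coeff G (k - i)) + poly.coeff F k * poly.coeff G 0"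
    by (simp add: Polynomial.coeff_mult lessThan_Suc_atMost [symmetric])
  moreover have "p dvd (\<Sum>i<k. poly.coeff F i * poly.coeff G (k - i))"
    using lt by (intro dvd_sum) auto
  moreover have "\<not> p dvd poly.coeff F k * poly.coeff G 0"
    using k G0 p by (simp add: prime_dvd_mult_iff)
  ultimately have "\<not> p dvd poly.coeff (F * G) k"
    by (simp add: dvd_add_right_iff)
  then have "\<not> k < Polynomial.degree (F * G)"
    using low by blast
  then show ?thesis
    using k(2) deg by linarith
qed

text \<open>In positive degree the constant coefficient of the product is divisible by
  \<open>p\<close> exactly once, so it takes its factor \<open>p\<close> from only one of
  \<open>F\<close> and \<open>G\<close>; \<open>eisenstein_aux\<close> makes the other one
  constant.\<close>

lemma eisenstein:
  fixes F G :: "int poly" and p :: int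
  assumes p: "Factorial_Ring.prime p"
    and lc: "\<not> p dvd Polynomial.lead_coeff (F * G)"
    and low: "\<And>i. i < Polynomial.degree (F * G) \<Longrightarrow> p dvd poly.coeff (F * G) i"
    and c0: "\<not> p\<^sup>2 dvd poly.coeff (F * G) 0"
  shows "Polynomial.degree F = 0 \<or> Polynomial.degree G = 0"
proof (cases "Polynomial.degree (F * G) = 0")
  case True
  then show ?thesis
    using lc by (cases "F = 0 \<or> G = 0") (auto simp: degree_mult_eq)
next
  case False
  then have "p dvd poly.coeff F 0 * poly.coeff G 0"
    using low[of 0] by (simp add: coeff_mult_0)
  moreover have "\<not> (p dvd poly.coeff F 0 \<and> p dvd poly.coeff G 0)"
    using c0 by (auto simp: coeff_mult_0 power2_eq_square intro: mult_dvd_mono)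
  ultimately consider "p dvd poly.coeff F 0" "\<not> p dvd poly.coeff G 0"
    | "p dvd poly.coeff G 0" "\<not> p dvd poly.coeff F 0"
    using p by (auto simp: prime_dvd_mult_iff)
  then show ?thesis
  proof cases
    case 1
    have "Polynomial.degree G = 0"
      by (rule eisenstein_aux[of p F G]) (use p lc low 1 in auto)
    then show ?thesis ..
  next
    case 2
    have "Polynomial.degree F = 0"
      by (rule eisenstein_aux[of p G F]) (use p lc low 2 in \<open>auto simp: mult.commute[of G F]\<close>)
    then show ?thesis ..
  qed
qed

definition ratpoly :: "rat poly \<Rightarrow> complex \<Rightarrow> complex" where
  "ratpoly q z = poly (map_poly of_rat q) z"

lemma ratpoly_altdef: "n > Polynomial.degree q \<Longrightarrow> ratpoly q z = (\<Sum>i<n. of_rat (poly.coeff q i) * z ^ i)"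
proof -
  assume n: "n > Polynomial.degree q"
  have "degree (map_poly of_rat q :: complex poly) = degree q"
    by (rule Polynomial.degree_map_poly) auto
  then have "ratpoly q z = (\<Sum>i\<le>degree q. of_rat (poly.coeff q i) * z ^ i)"
    by (simp add: ratpoly_def poly_altdef coeff_map_poly)
  also have "\<dots> = (\<Sum>i<n. of_rat (poly.coeff q i) * z ^ i)"
    using n by (intro sum.mono_neutral_left) (auto simp: coeff_eq_0)
  finally show ?thesis .
qed

lemma ratpoly_add: "ratpoly (p + q) z = ratpoly p z + ratpoly q z"
proof -
  have "map_poly of_rat (p + q) = (map_poly of_rat p + map_poly of_rat q :: complex poly)"
    by (intro poly_eqI) (simp add: coeff_map_poly of_rat_add)
  then show ?thesis by (simp add: ratpoly_def)
qed

lemma ratpoly_mult: "ratpoly (p * q) z = ratpoly p z * ratpoly q z"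
proof -
  have "map_poly of_rat (p * q) = (map_poly of_rat p * map_poly of_rat q :: complex poly)"
    by (intro poly_eqI) (simp add: coeff_map_poly Polynomial.coeff_mult of_rat_sum of_rat_mult)
  then show ?thesis by (simp add: ratpoly_def)
qed

lemma ratpoly_0 [simp]: "ratpoly 0 z = 0"
  by (simp add: ratpoly_def)

lemma ratpoly_pCons: "ratpoly (pCons a q) z = of_rat a + z * ratpoly q z"
  by (simp add: ratpoly_def map_poly_pCons)

lemma ratpoly_pcompose: "ratpoly (pcompose q r) z = ratpoly q (ratpoly r z)"
  by (induction q) (simp_all add: pcompose_pCons ratpoly_add ratpoly_mult ratpoly_pCons)

lemma rat_poly_common_denominator:
  fixes r :: "rat poly"
  obtains N :: int and R :: "int poly" where "N \<noteq> 0" "Polynomial.smult (of_int N) r = map_poly of_int R"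
proof -
  have "\<exists>N R. N \<noteq> (0::int) \<and> Polynomial.smult (of_int N) r = map_poly of_int R"
  proof (induction r)
    case 0
    have "Polynomial.smult (of_int 1) 0 = map_poly of_int (0::int poly)" by simp
    then show ?case by (metis zero_neq_one)
  next
    case (pCons a r)
    then obtain N R where N: "N \<noteq> 0" "Polynomial.smult (of_int N) r = map_poly of_int R" by blast
    obtain u v where uv: "a = of_int u / of_int v" "v > 0"
      by (cases a rule: Rat_cases) (auto simp: Fract_of_int_quotient)
    have "Polynomial.smult (of_int (N * v)) (pCons a r) = 
          pCons (of_int (N * u)) (Polynomial.smult (of_int v) (Polynomial.smult (of_int N) r))"
      using uv by (simp add: mult.commute)
    also have "\<dots> = map_poly of_int (pCons (N * u) (Polynomial.smult v R))"
      unfolding N(2) by (intro poly_eqI) (simp add: coeff_map_poly coeff_pCons split: nat.splits)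
    finally show ?case using N(1) uv(2) by (intro exI[of _ "N * v"]) auto
  qed
  with that show ?thesis by blast
qed

context
  fixes p :: nat and \<zeta> :: complex
  assumes p: "Factorial_Ring.prime p" and root: "primitive_root_of_unity p \<zeta>"
begin

lemma zeta_neq_1: "\<zeta> \<noteq> 1"
  using root prime_gt_1_nat[OF p] unfolding primitive_root_of_unity_def
  by (metis One_nat_def less_one power_one_right zero_less_one)

lemma zeta_pow_p: "\<zeta> ^ p = 1"
  using root by (simp add: primitive_root_of_unity_def)

lemma sum_zeta_pow: "(\<Sum>k<p. \<zeta> ^ k) = 0"
  using zeta_neq_1 zeta_pow_p by (simp add: geometric_sum)

section \<open>The degree of a primitive \<open>p\<close>-th root of unity\<close>

text \<open>This is ((X + 1)^p - 1) / X, the \<open>p\<close>-th cyclotomic polynomial at X + 1. In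
  terms of binomial coefficients its Eisenstein conditions at \<open>p\<close> are visible.\<close>

definition shifted_cyclotomic :: "int poly" where
  "shifted_cyclotomic = (\<Sum>i<p. Polynomial.monom (int (p choose Suc i)) i)"

lemma coeff_shifted_cyclotomic: "poly.coeff shifted_cyclotomic i = (if i < p then int (p choose Suc i) else 0)"
  by (simp add: shifted_cyclotomic_def Polynomial.coeff_sum)

lemma degree_shifted_cyclotomic: "Polynomial.degree shifted_cyclotomic = p - 1"
proof (rule antisym)
  show "Polynomial.degree shifted_cyclotomic \<le> p - 1"
    by (rule degree_le) (auto simp: coeff_shifted_cyclotomic)
  show "p - 1 \<le> Polynomial.degree shifted_cyclotomic"
    using prime_gt_0_nat[OF p] by (intro Polynomial.le_degree) (simp add: coeff_shifted_cyclotomic)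
qed

text \<open>Multiplied by \<open>\<zeta> - 1\<close>, which is nonzero, the value becomes the
  binomial expansion of \<open>((\<zeta> - 1) + 1) ^ p\<close> without its constant term 1.\<close>

lemma root_shifted_cyclotomic: "poly (map_poly of_int shifted_cyclotomic) (\<zeta> - 1) = 0"
proof -
  have "poly (map_poly of_int shifted_cyclotomic) (\<zeta> - 1) = (\<Sum>i\<le>p - 1. of_nat (p choose Suc i) * (\<zeta> - 1) ^ i)"
    by (simp add: poly_altdef Polynomial.degree_map_poly degree_shifted_cyclotomic coeff_map_poly
        coeff_shifted_cyclotomic) (use prime_gt_0_nat[OF p] in \<open>intro sum.cong; auto\<close>)
  then have "(\<zeta> - 1) * poly (map_poly of_int shifted_cyclotomic) (\<zeta> - 1) =
      (\<Sum>i\<le>p - 1. of_nat (p choose Suc i) * (\<zeta> - 1) ^ Suc i)"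
    by (simp add: sum_distrib_left mult_ac)
  also have "1 + \<dots> = (\<Sum>i\<le>Suc (p - 1). of_nat (p choose i) * (\<zeta> - 1) ^ i)"
    by (subst sum.atMost_Suc_shift) simp
  also have "\<dots> = ((\<zeta> - 1) + 1) ^ p"
    using prime_gt_0_nat[OF p] by (subst binomial_ring) simp
  finally have "(\<zeta> - 1) * poly (map_poly of_int shifted_cyclotomic) (\<zeta> - 1) = 0"
    using zeta_pow_p by simp
  then show ?thesis using zeta_neq_1 by simp
qed

text \<open>A primitive integer polynomial \<open>F\<close> of minimal degree among those vanishing at \<open>\<zeta> - 1\<close> divides
  the Eisenstein polynomial up to an integer factor, hence, by Gauss's lemma, over the integers.\<close>

lemma int_poly_root_degree:
  fixes F :: "int poly"
  assumes "F \<noteq> 0" "poly (map_poly of_int F) (\<zeta> - 1) = 0"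
  shows "p - 1 \<le> Polynomial.degree F"
proof -
  define ev :: "int poly \<Rightarrow> complex" where "ev = (\<lambda>F. poly (map_poly of_int F) (\<zeta> - 1))"
  have ev_mult: "ev (A * B) = ev A * ev B" for A B
  proof -
    have "map_poly of_int (A * B) = (map_poly of_int A * map_poly of_int B :: complex poly)"
      by (intro poly_eqI) (simp add: coeff_map_poly Polynomial.coeff_mult)
    then show ?thesis by (simp add: ev_def)
  qed
  have ev_add: "ev (A + B) = ev A + ev B" for A B
  proof -
    have "map_poly of_int (A + B) = (map_poly of_int A + map_poly of_int B :: complex poly)"
      by (intro poly_eqI) (simp add: coeff_map_poly)
    then show ?thesis by (simp add: ev_def)
  qed
  have ev_smult: "ev (Polynomial.smult a B) = of_int a * ev B" for a B
  proof -
    have "map_poly of_int (Polynomial.smult a B) = (Polynomial.smult (of_int a) (map_poly of_int B) :: complex poly)"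
      by (intro poly_eqI) (simp add: coeff_map_poly)
    then show ?thesis by (simp add: ev_def)
  qed
  define E where "E = arg_min Polynomial.degree (\<lambda>F. F \<noteq> 0 \<and> ev F = 0)"
  have E: "E \<noteq> 0" "ev E = 0" and E_min: "\<And>A. A \<noteq> 0 \<Longrightarrow> ev A = 0 \<Longrightarrow> Polynomial.degree E \<le> Polynomial.degree A"
    using arg_min_natI[of "\<lambda>F. F \<noteq> 0 \<and> ev F = 0" F Polynomial.degree]
      arg_min_nat_le[of "\<lambda>F. F \<noteq> 0 \<and> ev F = 0" _ Polynomial.degree] assms
    unfolding E_def ev_def by blast+
  define D where "D = primitive_part E"
  have D: "D \<noteq> 0" "Polynomial.degree D = Polynomial.degree E" "Polynomial.content D = 1"
    using E by (auto simp: D_def)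
  have "of_int (Polynomial.content E) * ev D = 0"
    using E(2) by (simp add: ev_smult[symmetric] D_def)
  then have evD: "ev D = 0" using E(1) by simp
  obtain a q where aq: "a \<noteq> 0" "Polynomial.smult a shifted_cyclotomic = D * q + pseudo_mod shifted_cyclotomic D"
    using pseudo_mod(1)[OF D(1)] by blast
  have "of_int a * ev shifted_cyclotomic = ev D * ev q + ev (pseudo_mod shifted_cyclotomic D)"
    using aq(2) ev_smult ev_mult ev_add by metis
  then have "ev (pseudo_mod shifted_cyclotomic D) = 0"
    using evD root_shifted_cyclotomic by (simp add: ev_def)
  then have "pseudo_mod shifted_cyclotomic D = 0"
    using pseudo_mod(2)[OF D(1), of shifted_cyclotomic] E_min[of "pseudo_mod shifted_cyclotomic D"] D(2) by force
  with aq have aq': "Polynomial.smult a shifted_cyclotomic = D * q" by simp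
  then have "Polynomial.content (Polynomial.smult a shifted_cyclotomic) = Polynomial.content q"
    using D(3) by (simp add: content_mult)
  then have "a dvd Polynomial.content q"
    by (metis content_smult normalize_dvd_iff dvd_triv_left)
  then obtain q' where q': "q = Polynomial.smult a q'"
    using const_poly_dvd_iff_dvd_content[of a q] by (auto simp: dvd_def)
  have "Polynomial.smult a shifted_cyclotomic = Polynomial.smult a (D * q')"
    using aq' q' by simp
  then have fac: "shifted_cyclotomic = D * q'"
    using aq(1) by (metis smult_cancel)
  have "Polynomial.degree D = 0 \<or> Polynomial.degree q' = 0"
  proof (rule eisenstein[of "int p"])
    show "Factorial_Ring.prime (int p)" using p by simp
    show "\<not> int p dvd Polynomial.lead_coeff (D * q')"
      using prime_gt_1_nat[OF p] by (simp add: fac[symmetric] degree_shifted_cyclotomic coeff_shifted_cyclotomic)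
    show "int p dvd poly.coeff (D * q') i" if "i < Polynomial.degree (D * q')" for i
      using that p by (auto simp: fac[symmetric] degree_shifted_cyclotomic coeff_shifted_cyclotomic intro!: dvd_choose_prime)
    show "\<not> (int p)\<^sup>2 dvd poly.coeff (D * q') 0"
      using prime_gt_1_nat[OF p]
      by (auto simp: fac[symmetric] coeff_shifted_cyclotomic power2_eq_square)
  qed
  moreover have "Polynomial.degree D \<noteq> 0"
  proof
    assume "Polynomial.degree D = 0"
    then obtain d where "D = [:d:]" by (metis degree_eq_zeroE)
    then show False using evD D(1) by (simp add: ev_def map_poly_pCons)
  qed
  ultimately have "Polynomial.degree q' = 0" by blast
  moreover have "q' \<noteq> 0" using fac degree_shifted_cyclotomic coeff_shifted_cyclotomic[of 0] prime_gt_0_nat[OF p]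
    by auto
  ultimately have "Polynomial.degree D = p - 1"
    using fac degree_shifted_cyclotomic D(1) by (metis add.right_neutral degree_mult_eq)
  then show ?thesis
    using D(2) E_min[of F] assms by (simp add: ev_def)
qed

text \<open>Substituting X + 1 moves the root to \<open>\<zeta> - 1\<close>, and clearing
  denominators leads to \<open>int_poly_root_degree\<close>; neither operation changes the
  degree.\<close>

lemma ratpoly_root_degree:
  assumes "q \<noteq> 0" "ratpoly q \<zeta> = 0"
  shows "p - 1 \<le> Polynomial.degree q"
proof -
  define r where "r = pcompose q [:1, 1:]"
  have deg: "Polynomial.degree r = Polynomial.degree q"
    by (simp add: r_def Polynomial.degree_pcompose)
  have "ratpoly r (\<zeta> - 1) = 0"
    using assms(2) by (simp add: r_def ratpoly_pcompose ratpoly_pCons)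
  obtain N R where N: "N \<noteq> 0" "Polynomial.smult (of_int N) r = map_poly of_int R"
    by (rule rat_poly_common_denominator)
  have "r \<noteq> 0" using assms(1) by (auto simp: r_def pcompose_eq_0)
  have degR: "Polynomial.degree R = Polynomial.degree r"
  proof -
    have "Polynomial.degree (map_poly of_int R :: rat poly) = Polynomial.degree R"
      by (rule Polynomial.degree_map_poly) auto
    then show ?thesis using N by (metis degree_smult_eq of_int_eq_0_iff)
  qed
  have "(map_poly of_int R :: complex poly) = map_poly of_rat (map_poly of_int R)"
    by (intro poly_eqI) (simp add: coeff_map_poly)
  also have "\<dots> = Polynomial.smult (of_int N) (map_poly of_rat r)"
    unfolding N(2)[symmetric] by (intro poly_eqI) (simp add: coeff_map_poly of_rat_mult)
  finally have "poly (map_poly of_int R) (\<zeta> - 1) = 0"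
    using \<open>ratpoly r (\<zeta> - 1) = 0\<close> by (simp add: ratpoly_def)
  moreover have "R \<noteq> 0" using N \<open>r \<noteq> 0\<close> by auto
  ultimately show ?thesis using int_poly_root_degree degR deg by metis
qed

text \<open>Subtracting \<open>f (p - 1)\<close> times the relation \<open>sum_zeta_pow\<close>
  removes the top term. The remaining polynomial has degree below \<open>p - 1\<close> and a root at
  \<open>\<zeta>\<close>, so it is zero.\<close>

lemma rat_combination_zeta_zero:
  fixes f :: "nat \<Rightarrow> rat"
  assumes "(\<Sum>a<p. of_rat (f a) * \<zeta> ^ a) = 0" and "a < p" "b < p"
  shows "f a = f b"
proof -
  define g where "g = (\<lambda>a. f a - f (p - 1))"
  define q where "q = (\<Sum>i<p. Polynomial.monom (g i) i)"
  have coeff: "poly.coeff q i = (if i < p then g i else 0)" for i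
    by (simp add: q_def Polynomial.coeff_sum)
  have p1: "p > 1" by (rule prime_gt_1_nat[OF p])
  have deg: "Polynomial.degree q < p - 1"
  proof -
    have "Polynomial.degree q \<le> p - 2"
      by (rule degree_le) (use p1 in \<open>auto simp: coeff g_def intro!: arg_cong[of _ _ f]\<close>)
    then show ?thesis using p1 by linarith
  qed
  have "ratpoly q \<zeta> = (\<Sum>i<p. of_rat (poly.coeff q i) * \<zeta> ^ i)"
    using deg by (intro ratpoly_altdef) linarith
  also have "\<dots> = (\<Sum>i<p. of_rat (f i) * \<zeta> ^ i - of_rat (f (p - 1)) * \<zeta> ^ i)"
    by (intro sum.cong) (auto simp: coeff g_def of_rat_diff algebra_simps)
  also have "\<dots> = 0"
    unfolding sum_subtractf assms(1) by (simp add: sum_distrib_left[symmetric] sum_zeta_pow)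
  finally have "q = 0"
    using ratpoly_root_degree deg by (metis not_le)
  then have "g i = 0" if "i < p" for i
    using coeff[of i] that by simp
  then have "g a = 0" "g b = 0" using assms(2,3) by blast+
  then show ?thesis by (simp add: g_def)
qed

section \<open>The field generated by \<open>\<zeta>\<close>, as a vector space over the
  rationals\<close>

text \<open>The ring of polynomial expressions in \<open>\<zeta>\<close>. Once it is known to be
  closed under inverses, it contains \<open>rat_adjoin \<zeta>\<close>.\<close>

definition ratspan_zeta :: "complex set" where
  "ratspan_zeta = {z. \<exists>q. z = ratpoly q \<zeta>}"

text \<open>Descent on the degree: division of the cyclotomic polynomial by \<open>q\<close> with
  quotient \<open>s\<close> and remainder \<open>r\<close> gives s(\<zeta>) q(\<zeta>) = -
  r(\<zeta>). So the inverse of q(\<zeta>) is expressed by that of r(\<zeta>), where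
  \<open>r\<close> has smaller degree.\<close>

lemma ratspan_zeta_inverse:
  assumes "z \<in> ratspan_zeta"
  shows "inverse z \<in> ratspan_zeta"
proof -
  define \<Phi> :: "rat poly" where "\<Phi> = (\<Sum>i<p. Polynomial.monom 1 i)"
  have coeff: "poly.coeff \<Phi> i = (if i < p then 1 else 0)" for i
    by (simp add: \<Phi>_def Polynomial.coeff_sum)
  have p1: "p > 1" by (rule prime_gt_1_nat[OF p])
  have deg: "Polynomial.degree \<Phi> = p - 1"
  proof (rule antisym)
    show "Polynomial.degree \<Phi> \<le> p - 1"
      by (rule degree_le) (auto simp: coeff)
    show "p - 1 \<le> Polynomial.degree \<Phi>"
      using p1 by (intro Polynomial.le_degree) (simp add: coeff)
  qed
  then have "\<Phi> \<noteq> 0" using p1 by auto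
  have root: "ratpoly \<Phi> \<zeta> = 0"
    using ratpoly_altdef[of \<Phi> p] deg p1 sum_zeta_pow by (simp add: coeff)
  have inv: "inverse (ratpoly q \<zeta>) \<in> ratspan_zeta"
    if "Polynomial.degree q < p" "ratpoly q \<zeta> \<noteq> 0" for q
    using that
  proof (induction "Polynomial.degree q" arbitrary: q rule: less_induct)
    case less
    have "q \<noteq> 0" using less.prems by auto
    define r where "r = \<Phi> mod q"
    define s where "s = \<Phi> div q"
    have \<Phi>: "\<Phi> = s * q + r" by (simp add: r_def s_def)
    then have eq: "ratpoly s \<zeta> * ratpoly q \<zeta> + ratpoly r \<zeta> = 0"
      using root by (metis ratpoly_add ratpoly_mult)
    show ?case
    proof (cases "Polynomial.degree q = 0")
      case True
      then obtain a where a: "q = [:a:]" by (metis degree_eq_zeroE)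
      have "inverse (ratpoly q \<zeta>) = ratpoly [:inverse a:] \<zeta>"
        by (simp add: a ratpoly_pCons of_rat_inverse)
      then show ?thesis by (auto simp: ratspan_zeta_def)
    next
      case False
      then have degr: "Polynomial.degree r < Polynomial.degree q"
        using degree_mod_less'[of q \<Phi>] \<open>q \<noteq> 0\<close> unfolding r_def
        by (cases "\<Phi> mod q = 0") auto
      \<comment> \<open>If \<open>r\<close> vanished at \<zeta>, then so would \<open>s\<close>,
        whose degree is below \<open>p - 1\<close> because \<open>q\<close> is not constant. And
        \<open>s = 0\<close> would give \<open>\<Phi> = r\<close>, which has degree below
        \<open>p - 1\<close>.\<close>
      have "ratpoly r \<zeta> \<noteq> 0"
      proof
        assume r0: "ratpoly r \<zeta> = 0"
        then have s0: "ratpoly s \<zeta> = 0" using eq less.prems by simp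
        show False
        proof (cases "s = 0")
          case True
          then show False using \<Phi> deg degr less.prems(1) by simp
        next
          case False
          then have "Polynomial.degree (s * q) = Polynomial.degree s + Polynomial.degree q"
            using \<open>q \<noteq> 0\<close> by (rule degree_mult_eq)
          then have "Polynomial.degree \<Phi> = Polynomial.degree s + Polynomial.degree q"
            using degr \<Phi> by (simp add: degree_add_eq_left)
          then have "Polynomial.degree s < p - 1"
            using deg \<open>Polynomial.degree q \<noteq> 0\<close> by linarith
          then show False using ratpoly_root_degree[OF False s0] by simp
        qed
      qed
      then have "inverse (ratpoly r \<zeta>) \<in> ratspan_zeta"
        using less.hyps[of r] degr less.prems(1) by simp
      then obtain t where t: "inverse (ratpoly r \<zeta>) = ratpoly t \<zeta>" by (auto simp: ratspan_zeta_def)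
      have "ratpoly r \<zeta> = - (ratpoly s \<zeta> * ratpoly q \<zeta>)"
        using eq by (simp add: eq_neg_iff_add_eq_0 add.commute)
      then have "inverse (ratpoly q \<zeta>) = - ratpoly s \<zeta> * inverse (ratpoly r \<zeta>)"
        using \<open>ratpoly r \<zeta> \<noteq> 0\<close> by auto
      also have "\<dots> = ratpoly ([:- 1:] * s * t) \<zeta>"
        by (simp only: ratpoly_mult ratpoly_pCons t) (simp add: of_rat_minus)
      finally show ?thesis by (auto simp: ratspan_zeta_def)
    qed
  qed
  obtain q where q: "z = ratpoly q \<zeta>" using assms by (auto simp: ratspan_zeta_def)
  have "ratpoly q \<zeta> = ratpoly (q div \<Phi> * \<Phi> + q mod \<Phi>) \<zeta>" by simp
  then have q': "z = ratpoly (q mod \<Phi>) \<zeta>"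
    unfolding ratpoly_add ratpoly_mult root by (simp add: q)
  have "Polynomial.degree (q mod \<Phi>) < p"
    using degree_mod_less'[of \<Phi> q] \<open>\<Phi> \<noteq> 0\<close> deg p1 by (cases "q mod \<Phi> = 0") auto
  \<comment> \<open>For \<open>z = 0\<close> the convention \<open>inverse 0 = 0\<close>
    applies.\<close>
  then show ?thesis
    using inv[of "q mod \<Phi>"] q' assms by (cases "z = 0") auto
qed

lemma rat_adjoin_subset: "rat_adjoin \<zeta> \<subseteq> ratspan_zeta"
proof
  fix z assume "z \<in> rat_adjoin \<zeta>"
  then have "z \<in> generate_field (class_ring :: complex ring) (insert \<zeta> \<rat>)"
    by (simp add: rat_adjoin_def)
  then show "z \<in> ratspan_zeta"
  proof induction
    case one
    have "1 = ratpoly [:1:] \<zeta>" by (simp add: ratpoly_pCons)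
    then show ?case by (auto simp: ratspan_zeta_def)
  next
    case (incl h)
    have "\<zeta> = ratpoly [:0, 1:] \<zeta>" by (simp add: ratpoly_pCons)
    moreover have "of_rat a = ratpoly [:a:] \<zeta>" for a by (simp add: ratpoly_pCons)
    ultimately show ?case using incl by (auto simp: ratspan_zeta_def Rats_def)
  next
    case (a_inv h)
    then obtain q where "h = ratpoly q \<zeta>" by (auto simp: ratspan_zeta_def)
    then have "- h = ratpoly ([:-1:] * q) \<zeta>" by (simp only: ratpoly_mult ratpoly_pCons) (simp add: of_rat_minus)
    then have "- h \<in> ratspan_zeta" by (auto simp: ratspan_zeta_def)
    then show ?case by (simp add: class_ring_simps)
  next
    case (m_inv h)
    then show ?case using ratspan_zeta_inverse[of h] by (simp add: class_ring_simps)
  next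
    case (eng_add h1 h2)
    then have "h1 + h2 \<in> ratspan_zeta"
      unfolding ratspan_zeta_def using ratpoly_add[of _ _ \<zeta>] by (smt (verit) mem_Collect_eq)
    then show ?case by (simp add: class_ring_simps)
  next
    case (eng_mult h1 h2)
    then have "h1 * h2 \<in> ratspan_zeta"
      unfolding ratspan_zeta_def using ratpoly_mult[of _ _ \<zeta>] by (smt (verit) mem_Collect_eq)
    then show ?case by (simp add: class_ring_simps)
  qed
qed

text \<open>Exponents are first reduced by \<zeta>^p = 1, then the top power is eliminated by
  \<open>sum_zeta_pow\<close>. Having only \<open>p - 1\<close> generators is what makes the
  dimension count for the matrix algebras exact.\<close>

lemma rat_adjoin_combination:
  assumes "z \<in> rat_adjoin \<zeta>"
  obtains f :: "nat \<Rightarrow> rat" where "z = (\<Sum>k<p - 1. of_rat (f k) * \<zeta> ^ k)"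
proof -
  have reduce: "\<exists>f :: nat \<Rightarrow> rat. ratpoly q \<zeta> = (\<Sum>k<p. of_rat (f k) * \<zeta> ^ k)" for q
  proof (induction q)
    case 0
    show ?case by (intro exI[of _ "\<lambda>_. 0"]) simp
  next
    case (pCons a q)
    then obtain f :: "nat \<Rightarrow> rat" where f: "ratpoly q \<zeta> = (\<Sum>k<p. of_rat (f k) * \<zeta> ^ k)" by blast
    obtain m where m: "p = Suc m" using prime_gt_0_nat[OF p] by (cases p) auto
    \<comment> \<open>Multiplication by \<open>\<zeta>\<close> shifts the \<open>p\<close>
      coefficients cyclically.\<close>
    have "\<zeta> * ratpoly q \<zeta> = (\<Sum>k<m. of_rat (f k) * \<zeta> ^ Suc k) + of_rat (f m) * \<zeta> ^ p"
      by (simp add: f m sum_distrib_left algebra_simps)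
    then have "ratpoly (pCons a q) \<zeta> = (of_rat a + of_rat (f m)) + (\<Sum>k<m. of_rat (f k) * \<zeta> ^ Suc k)"
      by (simp add: ratpoly_pCons zeta_pow_p)
    also have "\<dots> = (\<Sum>k<p. of_rat (case k of 0 \<Rightarrow> a + f m | Suc k \<Rightarrow> f k) * \<zeta> ^ k)"
      unfolding m by (subst sum.lessThan_Suc_shift) (simp add: of_rat_add)
    finally show ?case by blast
  qed
  obtain q where "z = ratpoly q \<zeta>" using assms rat_adjoin_subset by (auto simp: ratspan_zeta_def)
  then obtain f :: "nat \<Rightarrow> rat" where f: "z = (\<Sum>k<p. of_rat (f k) * \<zeta> ^ k)" using reduce by blast
  obtain m where m: "p = Suc m" using prime_gt_0_nat[OF p] by (cases p) auto
  have top: "\<zeta> ^ m = - (\<Sum>k<m. \<zeta> ^ k)"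
    using sum_zeta_pow by (simp add: m eq_neg_iff_add_eq_0 add.commute)
  have "z = (\<Sum>k<m. of_rat (f k) * \<zeta> ^ k) + of_rat (f m) * \<zeta> ^ m"
    by (simp add: f m)
  also have "\<dots> = (\<Sum>k<m. of_rat (f k) * \<zeta> ^ k) - (\<Sum>k<m. of_rat (f m) * \<zeta> ^ k)"
    unfolding top by (simp add: sum_distrib_left)
  also have "\<dots> = (\<Sum>k<p - 1. of_rat (f k - f m) * \<zeta> ^ k)"
    unfolding sum_subtractf[symmetric] m by (intro sum.cong) (simp_all add: of_rat_diff left_diff_distrib)
  finally have "z = (\<Sum>k<p - 1. of_rat (f k - f m) * \<zeta> ^ k)" .
  then show ?thesis by (rule that)
qed

end

lemma rat_adjoin_of_rat: "of_rat a \<in> rat_adjoin \<zeta>"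
  unfolding rat_adjoin_def by (rule generate_field.incl) simp

lemma rat_adjoin_self: "\<zeta> \<in> rat_adjoin \<zeta>"
  unfolding rat_adjoin_def by (rule generate_field.incl) simp

lemma rat_adjoin_add: "x \<in> rat_adjoin \<zeta> \<Longrightarrow> y \<in> rat_adjoin \<zeta> \<Longrightarrow> x + y \<in> rat_adjoin \<zeta>"
  unfolding rat_adjoin_def by (drule (1) generate_field.eng_add) simp

lemma rat_adjoin_mult: "x \<in> rat_adjoin \<zeta> \<Longrightarrow> y \<in> rat_adjoin \<zeta> \<Longrightarrow> x * y \<in> rat_adjoin \<zeta>"
  unfolding rat_adjoin_def by (drule (1) generate_field.eng_mult) simp

lemma rat_adjoin_0: "0 \<in> rat_adjoin \<zeta>"
  using rat_adjoin_of_rat[of 0 \<zeta>] by simp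

lemma rat_adjoin_1: "1 \<in> rat_adjoin \<zeta>"
  using rat_adjoin_of_rat[of 1 \<zeta>] by simp

lemma rat_adjoin_power: "x \<in> rat_adjoin \<zeta> \<Longrightarrow> x ^ n \<in> rat_adjoin \<zeta>"
  by (induction n) (simp_all add: rat_adjoin_1 rat_adjoin_mult)

lemma rat_adjoin_sum: "(\<And>i. i \<in> A \<Longrightarrow> f i \<in> rat_adjoin \<zeta>) \<Longrightarrow> sum f A \<in> rat_adjoin \<zeta>"
  by (induction A rule: infinite_finite_induct) (simp_all add: rat_adjoin_0 rat_adjoin_add)

section \<open>Induced representations\<close>

text \<open>A representation is kept as its entry functions, constrained only at indices below
  \<open>n\<close>; sums over the group can then be handled entry by entry.\<close>

definition matrix_rep :: "('a, 'b) monoid_scheme \<Rightarrow> nat \<Rightarrow> complex set \<Rightarrow> ('a \<Rightarrow> nat \<Rightarrow> nat \<Rightarrow> complex) \<Rightarrow> bool" where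
  "matrix_rep G n K M \<longleftrightarrow>
    (\<forall>g \<in> carrier G. \<forall>s < n. \<forall>t < n. M g s t \<in> K) \<and>
    (\<forall>s < n. \<forall>t < n. M \<one>\<^bsub>G\<^esub> s t = (if s = t then 1 else 0)) \<and>
    (\<forall>g \<in> carrier G. \<forall>h \<in> carrier G. \<forall>s < n. \<forall>t < n.
      M (g \<otimes>\<^bsub>G\<^esub> h) s t = (\<Sum>j<n. M g s j * M h j t))"

lemma (in group) right_transversal:
  assumes A: "subgroup A G" and fin: "finite (carrier G)"
  obtains T :: "nat \<Rightarrow> 'a" where "\<And>j. j < card (rcosets A) \<Longrightarrow> T j \<in> carrier G"
    and "\<And>g. g \<in> carrier G \<Longrightarrow> \<exists>!j. j < card (rcosets A) \<and> g \<otimes> inv (T j) \<in> A"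
proof -
  have AG: "A \<subseteq> carrier G" using A by (rule subgroup.subset)
  have "finite (rcosets A)"
    using fin by (simp add: RCOSETS_def)
  then obtain e where e: "bij_betw e {0..<card (rcosets A)} (rcosets A)"
    using ex_bij_betw_nat_finite by blast
  define T where "T j = (SOME x. x \<in> carrier G \<and> e j = A #> x)" for j
  have T: "T j \<in> carrier G \<and> e j = A #> T j" if "j < card (rcosets A)" for j
  proof -
    have "e j \<in> rcosets A" using e that by (auto simp: bij_betw_def)
    then have "\<exists>x. x \<in> carrier G \<and> e j = A #> x" by (auto simp: RCOSETS_def)
    then show ?thesis unfolding T_def by (rule someI_ex)
  qed
  have mem: "g \<otimes> inv (T j) \<in> A \<longleftrightarrow> e j = A #> g" if "g \<in> carrier G" "j < card (rcosets A)" for g j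
  proof -
    have "g \<otimes> inv (T j) \<in> A \<longleftrightarrow> g \<in> A #> T j"
      using T[OF that(2)] that(1) subgroup.rcos_module[OF A is_group] by blast
    also have "\<dots> \<longleftrightarrow> A #> T j = A #> g"
      using T[OF that(2)] that(1) repr_independence[OF _ _ A] repr_independenceD[OF A] rcos_self[OF _ A] by metis
    finally show ?thesis using T[OF that(2)] by simp
  qed
  have "\<exists>!j. j < card (rcosets A) \<and> g \<otimes> inv (T j) \<in> A" if g: "g \<in> carrier G" for g
  proof -
    have "A #> g \<in> rcosets A" using g by (auto simp: RCOSETS_def)
    then obtain j where "j < card (rcosets A)" "e j = A #> g"
      using bij_betw_imp_surj_on[OF e] by (metis atLeastLessThan_iff imageE)
    moreover have "i = j" if "i < card (rcosets A)" "e i = A #> g" for i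
      using that calculation e by (intro inj_onD[of e "{0..<card (rcosets A)}" i j]) (simp_all add: bij_betw_def)
    ultimately show ?thesis using mem[OF g] by metis
  qed
  with T that show ?thesis by blast
qed

text \<open>Left multiplication by an element of \<open>A\<close> is injective on the finite set
  \<open>A\<close>, hence surjective, and solving equations in \<open>A\<close> produces the
  identity and the inverses.\<close>

lemma (in group) finite_subgroupI:
  assumes "A \<subseteq> carrier G" "finite A" "A \<noteq> {}" and closed: "\<And>x y. x \<in> A \<Longrightarrow> y \<in> A \<Longrightarrow> x \<otimes> y \<in> A"
  shows "subgroup A G"
proof -
  have surj: "(\<otimes>) x ` A = A" if "x \<in> A" for x
    using that assms by (intro endo_inj_surj) (auto simp: inj_on_def subset_iff)
  obtain x where x: "x \<in> A" using assms(3) by blast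
  then obtain e where "e \<in> A" "x = x \<otimes> e" using surj[OF x] by blast
  then have one: "\<one> \<in> A" using x assms(1) by (metis l_cancel_one subsetD)
  have "inv y \<in> A" if y: "y \<in> A" for y
  proof -
    obtain z where z: "z \<in> A" "\<one> = y \<otimes> z" using surj[OF y] one by blast
    then have "inv y = z" using y assms(1) by (metis inv_equality inv_inv subsetD)
    with z show ?thesis by simp
  qed
  with assms(1) one closed show ?thesis by (intro subgroup.intro) auto
qed

text \<open>By \<open>c_notin\<close>, \<open>c\<close> has order exactly \<open>p\<close> and its
  powers meet \<open>B\<close> trivially; by \<open>card\<close>, \<open>n\<close> is the index of
  the product of \<open>B\<close> and <c>. The condition \<open>ramified\<close> makes every trace
  vanish off <c>. The instances are the quotients of order p^3 with \<open>n = p\<close>, and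
  \<open>G\<close> itself with \<open>n = p^2\<close>.\<close>

locale induction_data = group P for P (structure) +
  fixes p n :: nat and c :: 'a and B :: "'a set" and \<zeta> :: complex
  assumes fin: "finite (carrier P)"
    and p: "Factorial_Ring.prime p"
    and root: "primitive_root_of_unity p \<zeta>"
    and c: "c \<in> carrier P" and c_pow: "c [^] p = \<one>"
    and c_central: "\<And>x. x \<in> carrier P \<Longrightarrow> x \<otimes> c = c \<otimes> x"
    and B: "subgroup B P"
    and c_notin: "\<And>i. 0 < i \<Longrightarrow> i < p \<Longrightarrow> c [^] i \<notin> B"
    and card: "card (carrier P) = p * n * card B"
    and ramified: "\<And>g. g \<in> carrier P \<Longrightarrow> (\<And>i. i < p \<Longrightarrow> g \<noteq> c [^] i) \<Longrightarrow>
      \<exists>h \<in> carrier P. \<exists>i. 0 < i \<and> i < p \<and> inv h \<otimes> (g \<otimes> h) = g \<otimes> c [^] i"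
begin

text \<open>The internal direct product of \<open>B\<close> and <c>, the subgroup from which the
  representation is induced.\<close>

definition A :: "'a set" where "A = (\<lambda>(b, i). b \<otimes> c [^] i) ` (B \<times> {..<p})"

lemma B_carrier [simp]: "b \<in> B \<Longrightarrow> b \<in> carrier P"
  using subgroup.subset[OF B] by blast

lemma c_pow_carrier [simp]: "c [^] (i::nat) \<in> carrier P"
  using c by simp

lemma c_pow_central: "x \<in> carrier P \<Longrightarrow> x \<otimes> c [^] (i::nat) = c [^] i \<otimes> x"
  using c c_central by (metis group_commutes_pow)

lemma c_pow_mod: "c [^] (i mod p) = c [^] i"
proof -
  have "c [^] i = c [^] (p * (i div p) + i mod p)" by simp
  also have "\<dots> = (c [^] p) [^] (i div p) \<otimes> c [^] (i mod p)"
    using c by (simp only: nat_pow_mult[symmetric] nat_pow_pow)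
  finally show ?thesis using c c_pow by simp
qed

lemma A_I: "b \<in> B \<Longrightarrow> b \<otimes> c [^] (i::nat) \<in> A"
  unfolding A_def by (rule image_eqI[of _ _ "(b, i mod p)"]) (simp_all add: c_pow_mod prime_gt_0_nat[OF p])

lemma A_E:
  assumes "x \<in> A" obtains b i where "b \<in> B" "i < p" "x = b \<otimes> c [^] i"
  using assms by (auto simp: A_def)

lemma exponent_unique:
  assumes "b \<otimes> c [^] i = b' \<otimes> c [^] j" "b \<in> B" "b' \<in> B" "i < p" "j < p"
  shows "i = j"
proof (rule ccontr)
  assume "i \<noteq> j"
  have *: False if "b \<otimes> c [^] i = b' \<otimes> c [^] j" "b \<in> B" "b' \<in> B" "i < j" "j < p" for b b' i j
  proof -
    have "b' \<otimes> c [^] j = (b' \<otimes> c [^] (j - i)) \<otimes> c [^] i"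
      using that by (simp add: m_assoc nat_pow_mult c)
    then have "b = b' \<otimes> c [^] (j - i)"
      using that by (metis B_carrier c_pow_carrier m_closed r_cancel)
    then have "c [^] (j - i) = inv b' \<otimes> b"
      using that by (simp add: m_assoc[symmetric])
    then have "c [^] (j - i) \<in> B"
      using that B by (simp add: subgroup.m_closed subgroup.m_inv_closed)
    then show False using c_notin[of "j - i"] that by auto
  qed
  show False
    using *[of b i b' j] *[of b' j b i] assms \<open>i \<noteq> j\<close> by (metis linorder_neqE_nat)
qed

text \<open>The linear character of \<open>A\<close> with kernel \<open>B\<close> that sends
  \<open>c\<close> to \<open>\<zeta>\<close>, extended by 0 off \<open>A\<close> as the entries of
  an induced matrix require.\<close>

definition lam :: "'a \<Rightarrow> complex" where
  "lam x = (if x \<in> A then \<zeta> ^ (THE i. i < p \<and> (\<exists>b \<in> B. x = b \<otimes> c [^] i)) else 0)"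

lemma lam_eq: 
  assumes "b \<in> B" shows "lam (b \<otimes> c [^] (i::nat)) = \<zeta> ^ i"
proof -
  have p0: "0 < p" using p by (rule prime_gt_0_nat)
  have "(THE j. j < p \<and> (\<exists>b' \<in> B. b \<otimes> c [^] i = b' \<otimes> c [^] j)) = i mod p"
  proof (rule the_equality)
    show "i mod p < p \<and> (\<exists>b' \<in> B. b \<otimes> c [^] i = b' \<otimes> c [^] (i mod p))"
      using assms p0 by (auto simp: c_pow_mod)
    show "j = i mod p" if "j < p \<and> (\<exists>b' \<in> B. b \<otimes> c [^] i = b' \<otimes> c [^] j)" for j
      using that exponent_unique[of b "i mod p" _ j] assms p0 by (auto simp: c_pow_mod)
  qed
  moreover have "\<zeta> ^ (i mod p) = \<zeta> ^ i"
  proof -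
    have "\<zeta> ^ i = \<zeta> ^ (p * (i div p) + i mod p)" by simp
    also have "\<dots> = \<zeta> ^ (i mod p)"
      using zeta_pow_p[OF p root] by (simp only: power_add power_mult) simp
    finally show ?thesis by simp
  qed
  ultimately show ?thesis using A_I[OF assms] by (simp add: lam_def)
qed

lemma A_mult: "(b \<otimes> c [^] i) \<otimes> (b' \<otimes> c [^] j) = (b \<otimes> b') \<otimes> c [^] (i + j)"
  if "b \<in> B" "b' \<in> B" for i j :: nat
proof -
  have "(b \<otimes> c [^] i) \<otimes> (b' \<otimes> c [^] j) = b \<otimes> (c [^] i \<otimes> b') \<otimes> c [^] j"
    using that by (simp add: m_assoc)
  also have "\<dots> = b \<otimes> (b' \<otimes> c [^] i) \<otimes> c [^] j"
    using that by (simp add: c_pow_central)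
  also have "\<dots> = (b \<otimes> b') \<otimes> (c [^] i \<otimes> c [^] j)"
    using that by (simp add: m_assoc)
  finally show ?thesis using c by (simp add: nat_pow_mult)
qed

lemma A_subgroup: "subgroup A P"
proof (rule finite_subgroupI)
  show AP: "A \<subseteq> carrier P" by (auto simp: A_def)
  show "A \<noteq> {}" using A_I[OF subgroup.one_closed[OF B]] by blast
  show "x \<otimes> y \<in> A" if "x \<in> A" "y \<in> A" for x y
    using that B by (elim A_E) (simp add: A_mult A_I subgroup.m_closed)
  show "finite A" using fin AP finite_subset by blast
qed

text \<open>If \<open>y\<close> lies outside \<open>A\<close>, then so does
  \<open>x \<otimes> y\<close>, and both sides are 0. This extension of multiplicativity beyond
  \<open>A\<close> is what the matrix product below uses.\<close>

lemma lam_mult_left: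
  assumes "x \<in> A" "y \<in> carrier P" shows "lam (x \<otimes> y) = lam x * lam y"
proof (cases "y \<in> A")
  case True
  with assms(1) B show ?thesis
    by (elim A_E) (simp add: A_mult lam_eq subgroup.m_closed power_add)
next
  case False
  have "x \<otimes> y \<notin> A"
  proof
    assume "x \<otimes> y \<in> A"
    then have "inv x \<otimes> (x \<otimes> y) \<in> A"
      using A_subgroup assms(1) by (simp add: subgroup.m_closed subgroup.m_inv_closed)
    then show False
      using False assms A_subgroup by (simp add: m_assoc[symmetric] subgroup.mem_carrier)
  qed
  with False show ?thesis by (simp add: lam_def)
qed

lemma card_A: "card A = p * card B"
proof -
  have "inj_on (\<lambda>(b, i). b \<otimes> c [^] i) (B \<times> {..<p})"
  proof (rule inj_onI)
    fix x y assume xy: "x \<in> B \<times> {..<p}" "y \<in> B \<times> {..<p}"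
      "(\<lambda>(b, i). b \<otimes> c [^] i) x = (\<lambda>(b, i). b \<otimes> c [^] i) y"
    obtain b i b' j where [simp]: "x = (b, i)" "y = (b', j)" by (meson surj_pair)
    have "i = j" using exponent_unique[of b i b' j] xy by simp
    with xy show "x = y" by simp
  qed
  then show ?thesis by (simp add: A_def card_image card_cartesian_product mult.commute)
qed

lemma card_rcosets_A: "card (rcosets A) = n"
proof -
  have "card (rcosets A) * card A = card (carrier P)"
    using lagrange[OF A_subgroup] by (simp add: Coset.order_def mult.commute)
  then have "card (rcosets A) * (p * card B) = n * (p * card B)"
    using card card_A by (simp add: ac_simps)
  moreover have "card B > 0"
    using B fin subgroup.one_closed[OF B] subgroup.subset[OF B] by (metis card_gt_0_iff empty_iff finite_subset)
  ultimately show ?thesis using prime_gt_0_nat[OF p] by simp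
qed

text \<open>
  The trace \<open>\<tau>\<close> of the induced representation vanishes off the powers of \<open>c\<close>, because there \<open>g\<close> is conjugate
  to some \<open>g c\<^sup>i\<close> and \<open>\<tau>(g c\<^sup>i) = \<zeta>\<^sup>i \<tau>(g)\<close>. So if \<open>f\<close> is annihilated, then \<open>\<Sum>\<^sub>i f(c\<^sup>i u) \<zeta>\<^sup>i = 0\<close> for all \<open>u\<close>, and \<open>f\<close> is
  constant on the cosets of \<open>\<langle>c\<rangle>\<close>.
\<close>

lemma induced_representation:
  obtains M where "matrix_rep P n (rat_adjoin \<zeta>) M"
    and "\<And>f. (\<And>s t. s < n \<Longrightarrow> t < n \<Longrightarrow> (\<Sum>g\<in>carrier P. of_rat (f g) * M g s t) = 0) \<Longrightarrow>
      (\<And>g. g \<in> carrier P \<Longrightarrow> f (c \<otimes> g) = f g)"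
proof -
  obtain T where T: "\<And>j. j < n \<Longrightarrow> T j \<in> carrier P"
    and T_ex1: "\<And>g. g \<in> carrier P \<Longrightarrow> \<exists>!j. j < n \<and> g \<otimes> inv (T j) \<in> A"
    using right_transversal[OF A_subgroup fin] unfolding card_rcosets_A by blast
  \<comment> \<open>Induction in coordinates. \<open>M g\<close> is monomial: in row
    \<open>s\<close> the only nonzero entry is in the column \<open>i\<close> with
    \<open>T s \<otimes> g \<otimes> inv (T i) \<in> A\<close>, so the sum in a matrix product
    collapses to one term.\<close>
  define M where "M g s t = lam (T s \<otimes> g \<otimes> inv (T t))" for g s t
  have M_mult: "M (g \<otimes> h) s t = (\<Sum>j<n. M g s j * M h j t)"
    if g: "g \<in> carrier P" and h: "h \<in> carrier P" and s: "s < n" and t: "t < n" for g h s t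
  proof -
    have "T s \<otimes> g \<in> carrier P" using T s g by simp
    from T_ex1[OF this] obtain i where i: "i < n" "T s \<otimes> g \<otimes> inv (T i) \<in> A"
      and uniq: "\<And>j. j < n \<Longrightarrow> T s \<otimes> g \<otimes> inv (T j) \<in> A \<Longrightarrow> j = i" by blast
    have "(\<Sum>j<n. M g s j * M h j t) = (\<Sum>j<n. if j = i then M g s i * M h i t else 0)"
    proof (intro sum.cong HOL.refl)
      fix j assume "j \<in> {..<n}"
      then have "M g s j = 0" if "j \<noteq> i"
        using uniq[of j] that by (auto simp: M_def lam_def)
      then show "M g s j * M h j t = (if j = i then M g s i * M h i t else 0)" by simp
    qed
    also have "\<dots> = M g s i * M h i t" using i by simp
    also have "\<dots> = lam ((T s \<otimes> g \<otimes> inv (T i)) \<otimes> (T i \<otimes> h \<otimes> inv (T t)))"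
      unfolding M_def using i T t h by (intro lam_mult_left[symmetric]) auto
    also have "(T s \<otimes> g \<otimes> inv (T i)) \<otimes> (T i \<otimes> h \<otimes> inv (T t)) = T s \<otimes> (g \<otimes> h) \<otimes> inv (T t)"
    proof -
      have "(T s \<otimes> g \<otimes> inv (T i)) \<otimes> (T i \<otimes> h \<otimes> inv (T t)) = 
          T s \<otimes> g \<otimes> (inv (T i) \<otimes> T i) \<otimes> h \<otimes> inv (T t)"
        using T[OF i(1)] T[OF s] T[OF t] g h by (simp only: m_assoc m_closed inv_closed)
      then show ?thesis using T[OF i(1)] T[OF s] T[OF t] g h by (simp add: m_assoc)
    qed
    finally show ?thesis by (simp add: M_def)
  qed
  have M_one: "M \<one> s t = (if s = t then 1 else 0)" if s: "s < n" and t: "t < n" for s t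
  proof (cases "s = t")
    case True
    have "T t \<otimes> inv (T t) = \<one> \<otimes> c [^] (0::nat)" using T[OF t] by simp
    then have "lam (T t \<otimes> inv (T t)) = 1" using lam_eq[of \<one> 0] subgroup.one_closed[OF B] by simp
    then show ?thesis using T[OF t] True by (simp add: M_def)
  next
    case False
    have "T s \<otimes> inv (T s) \<in> A" using T[OF s] subgroup.one_closed[OF A_subgroup] by simp
    then have "T s \<otimes> inv (T t) \<notin> A" using T_ex1[OF T[OF s]] s t False by blast
    then show ?thesis using False T[OF s] by (simp add: M_def lam_def)
  qed
  have M_in: "M g s t \<in> rat_adjoin \<zeta>" for g s t
    unfolding M_def lam_def using rat_adjoin_0 rat_adjoin_power[OF rat_adjoin_self] by simp
  define \<tau> where "\<tau> g = (\<Sum>s<n. M g s s)" for g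
  have \<tau>_comm: "\<tau> (g \<otimes> h) = \<tau> (h \<otimes> g)" if "g \<in> carrier P" "h \<in> carrier P" for g h
  proof -
    have "\<tau> (g \<otimes> h) = (\<Sum>s<n. \<Sum>t<n. M g s t * M h t s)" using that by (simp add: \<tau>_def M_mult)
    also have "\<dots> = (\<Sum>t<n. \<Sum>s<n. M h t s * M g s t)"
      by (subst sum.swap) (simp add: mult.commute)
    also have "\<dots> = \<tau> (h \<otimes> g)" using that by (simp add: \<tau>_def M_mult)
    finally show ?thesis .
  qed
  have M_c: "M (g \<otimes> c [^] i) s t = \<zeta> ^ i * M g s t" if g: "g \<in> carrier P" and s: "s < n" and t: "t < n"
    for g s t and i :: nat
  proof -
    have "T s \<otimes> (g \<otimes> c [^] i) \<otimes> inv (T t) = T s \<otimes> g \<otimes> (c [^] i \<otimes> inv (T t))"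
      using T[OF s] T[OF t] g by (simp add: m_assoc)
    also have "\<dots> = T s \<otimes> g \<otimes> (inv (T t) \<otimes> c [^] i)"
      using T[OF t] by (simp add: c_pow_central)
    also have "\<dots> = (T s \<otimes> g \<otimes> inv (T t)) \<otimes> c [^] i"
      using T[OF s] T[OF t] g by (simp add: m_assoc)
    also have "\<dots> = c [^] i \<otimes> (T s \<otimes> g \<otimes> inv (T t))"
      using T[OF s] T[OF t] g by (simp add: c_pow_central)
    finally have eq: "T s \<otimes> (g \<otimes> c [^] i) \<otimes> inv (T t) = (\<one> \<otimes> c [^] i) \<otimes> (T s \<otimes> g \<otimes> inv (T t))"
      by simp
    have one: "\<one> \<in> B" by (rule subgroup.one_closed[OF B])
    show ?thesis
      unfolding M_def eq using T[OF s] T[OF t] g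
      by (subst lam_mult_left[OF A_I[OF one]]) (simp_all add: lam_eq[OF one, simplified])
  qed
  have \<tau>_c: "\<tau> (g \<otimes> c [^] i) = \<zeta> ^ i * \<tau> g" if "g \<in> carrier P" for g and i :: nat
    using that by (simp add: \<tau>_def M_c sum_distrib_left)
  have \<tau>_one: "\<tau> \<one> = of_nat n" by (simp add: \<tau>_def M_one)
  have n0: "n > 0" using card fin by (metis card_gt_0_iff carrier_not_empty mult_0_right mult_eq_0_iff neq0_conv)
  have \<tau>_off: "\<tau> g = 0" if g: "g \<in> carrier P" and off: "\<And>i. i < p \<Longrightarrow> g \<noteq> c [^] i" for g
  proof -
    obtain h i where h: "h \<in> carrier P" "0 < i" "i < p" "inv h \<otimes> (g \<otimes> h) = g \<otimes> c [^] i"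
      using ramified[OF g off] by blast
    have "\<tau> g = \<tau> ((g \<otimes> h) \<otimes> inv h)" using g h by (simp add: m_assoc)
    also have "\<dots> = \<tau> (inv h \<otimes> (g \<otimes> h))" using g h by (intro \<tau>_comm) auto
    also have "\<dots> = \<zeta> ^ i * \<tau> g" using g h by (simp add: \<tau>_c)
    finally have "(\<zeta> ^ i - 1) * \<tau> g = 0" by (simp add: algebra_simps)
    moreover have "\<zeta> ^ i \<noteq> 1" using root h by (auto simp: primitive_root_of_unity_def)
    ultimately show ?thesis by simp
  qed
  have ker: "f (c \<otimes> u) = f u"
    if zero: "\<And>s t. s < n \<Longrightarrow> t < n \<Longrightarrow> (\<Sum>g\<in>carrier P. of_rat (f g) * M g s t) = 0"
      and u: "u \<in> carrier P" for f u
  proof -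
    \<comment> \<open>This is the trace of a product whose first factor, the combination of the
      matrices \<open>M g\<close> with coefficients \<open>f g\<close>, is zero by
      assumption.\<close>
    have "(\<Sum>g\<in>carrier P. of_rat (f g) * \<tau> (g \<otimes> inv u)) =
        (\<Sum>g\<in>carrier P. \<Sum>s<n. \<Sum>t<n. of_rat (f g) * (M g s t * M (inv u) t s))"
      using u by (intro sum.cong) (auto simp: \<tau>_def M_mult sum_distrib_left)
    also have "\<dots> = (\<Sum>s<n. \<Sum>t<n. \<Sum>g\<in>carrier P. of_rat (f g) * (M g s t * M (inv u) t s))"
      by (subst sum.swap) (intro sum.cong HOL.refl sum.swap)
    also have "\<dots> = (\<Sum>s<n. \<Sum>t<n. (\<Sum>g\<in>carrier P. of_rat (f g) * M g s t) * M (inv u) t s)"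
      by (intro sum.cong HOL.refl) (simp add: sum_distrib_right mult.assoc)
    also have "\<dots> = 0" by (intro sum.neutral ballI) (simp add: zero)
    finally have "(\<Sum>g\<in>carrier P. of_rat (f g) * \<tau> (g \<otimes> inv u)) = 0" .
    moreover have "(\<Sum>g\<in>carrier P. of_rat (f g) * \<tau> (g \<otimes> inv u)) =
        (\<Sum>g\<in>(\<lambda>i. c [^] i \<otimes> u) ` {..<p}. of_rat (f g) * \<tau> (g \<otimes> inv u))"
    proof (intro sum.mono_neutral_right ballI)
      fix g assume g: "g \<in> carrier P - (\<lambda>i. c [^] i \<otimes> u) ` {..<p}"
      have "g \<otimes> inv u \<noteq> c [^] i" if "i < p" for i
      proof
        assume "g \<otimes> inv u = c [^] i"
        then have "g = c [^] i \<otimes> u" using g u inv_solve_right[of g "c [^] i" u] by (metis DiffD1 c_pow_carrier inv_closed inv_inv inv_solve_right')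
        then show False using g that by auto
      qed
      then show "of_rat (f g) * \<tau> (g \<otimes> inv u) = 0" using g u \<tau>_off by simp
    qed (use fin u in auto)
    moreover have "\<dots> = (\<Sum>i<p. of_rat (f (c [^] i \<otimes> u)) * \<tau> (c [^] i \<otimes> u \<otimes> inv u))"
    proof (rule sum.reindex_cong[of "\<lambda>i. c [^] i \<otimes> u"])
      show "inj_on (\<lambda>i. c [^] i \<otimes> u) {..<p}"
      proof (rule inj_onI)
        fix i j assume ij: "i \<in> {..<p}" "j \<in> {..<p}" "c [^] i \<otimes> u = c [^] j \<otimes> u"
        then have "\<one> \<otimes> c [^] i = \<one> \<otimes> c [^] j" using u by simp
        then show "i = j" using exponent_unique[of \<one> i \<one> j] ij subgroup.one_closed[OF B] by simp
      qed
    qed auto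
    moreover have "\<dots> = of_nat n * (\<Sum>i<p. of_rat (f (c [^] i \<otimes> u)) * \<zeta> ^ i)"
    proof -
      have "\<tau> (c [^] i \<otimes> u \<otimes> inv u) = of_nat n * \<zeta> ^ i" for i :: nat
        using u \<tau>_c[of \<one> i] \<tau>_one by (simp add: m_assoc)
      then show ?thesis by (simp add: sum_distrib_left ac_simps)
    qed
    ultimately have "(\<Sum>i<p. of_rat (f (c [^] i \<otimes> u)) * \<zeta> ^ i) = 0" using n0 by simp
    \<comment> \<open>The exponents 1 and 0 compare \<open>f (c \<otimes> u)\<close> with
      \<open>f u\<close>.\<close>
    from rat_combination_zeta_zero[OF p root this, of 1 0] show ?thesis
      using prime_gt_1_nat[OF p] u c by simp
  qed
  have "matrix_rep P n (rat_adjoin \<zeta>) M"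
    unfolding matrix_rep_def using M_in M_one M_mult by blast
  then show ?thesis by (rule that) (rule ker)
qed

end

section \<open>Injective homomorphisms out of the rational group algebra\<close>

text \<open>A vector of the span of \<open>S\<close> that the family fails to reach would extend it
  to an independent set of more than \<open>card S\<close> vectors. Independence is stated for the
  family, so distinctness of its members comes out of it: two equal members would satisfy a relation
  with coefficients 1 and -1.\<close>

lemma (in vector_space) family_spans_of_card:
  fixes v :: "'i \<Rightarrow> 'b"
  assumes I: "finite I" and S: "finite S" and card: "card S \<le> card I"
    and v: "\<And>i. i \<in> I \<Longrightarrow> v i \<in> span S"
    and indep: "\<And>a. (\<Sum>i\<in>I. a i *s v i) = 0 \<Longrightarrow> (\<And>i. i \<in> I \<Longrightarrow> a i = 0)"
    and w: "w \<in> span S"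
  obtains a where "w = (\<Sum>i\<in>I. a i *s v i)"
proof -
  have inj: "inj_on v I"
  proof (rule inj_onI, rule ccontr)
    fix i j assume ij: "i \<in> I" "j \<in> I" "v i = v j" "i \<noteq> j"
    define a where "a k = (if k = i then 1 else if k = j then - 1 else (0 :: 'a))" for k
    have "(\<Sum>k\<in>I. a k *s v k) = (\<Sum>k\<in>{i, j}. a k *s v k)"
      using I ij by (intro sum.mono_neutral_right) (auto simp: a_def)
    also have "\<dots> = 0" using ij by (simp add: a_def)
    finally have "a i = 0" using indep ij(1) by blast
    then show False by (simp add: a_def)
  qed
  have "independent (v ` I)"
  proof (subst dependent_finite)
    show "finite (v ` I)" using I by simp
    show "\<not> (\<exists>u. (\<exists>x\<in>v ` I. u x \<noteq> 0) \<and> (\<Sum>x\<in>v ` I. u x *s x) = 0)"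
    proof clarify
      fix u i assume i: "i \<in> I" "u (v i) \<noteq> 0" and "(\<Sum>x\<in>v ` I. u x *s x) = 0"
      then have "(\<Sum>i\<in>I. u (v i) *s v i) = 0" by (simp add: sum.reindex[OF inj])
      then have "u (v i) = 0" using indep[of "\<lambda>i. u (v i)"] i(1) by blast
      then show False using i(2) by simp
    qed
  qed
  have "w \<in> span (v ` I)"
  proof (rule ccontr)
    assume w': "w \<notin> span (v ` I)"
    then have ind: "independent (insert w (v ` I))"
      using \<open>independent (v ` I)\<close> by (simp add: independent_insert)
    have "insert w (v ` I) \<subseteq> span S" using v w by auto
    then have "card (insert w (v ` I)) \<le> card S"
      using independent_span_bound[OF S ind] by simp
    moreover have "w \<notin> v ` I" using w' by (rule contrapos_nn) (rule span_base)
    ultimately show False using card I inj by (simp add: card_image)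
  qed
  then obtain u where "w = (\<Sum>x\<in>v ` I. u x *s x)"
    using I by (auto simp: span_finite)
  then have "w = (\<Sum>i\<in>I. u (v i) *s v i)" by (simp add: sum.reindex[OF inj])
  then show ?thesis by (rule that)
qed

section \<open>Direct sums, copies and matrix algebras in coordinates\<close>

lemma alg_sum_simps:
  "carrier (A \<oplus>\<^sub>\<rat> B) = carrier A \<times> carrier B"
  "monoid.mult (A \<oplus>\<^sub>\<rat> B) x y = (fst x \<otimes>\<^bsub>A\<^esub> fst y, snd x \<otimes>\<^bsub>B\<^esub> snd y)"
  "ring.add (A \<oplus>\<^sub>\<rat> B) x y = (fst x \<oplus>\<^bsub>A\<^esub> fst y, snd x \<oplus>\<^bsub>B\<^esub> snd y)"
  "monoid.one (A \<oplus>\<^sub>\<rat> B) = (\<one>\<^bsub>A\<^esub>, \<one>\<^bsub>B\<^esub>)"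
  "module.smult (A \<oplus>\<^sub>\<rat> B) c x = (c \<odot>\<^bsub>A\<^esub> fst x, c \<odot>\<^bsub>B\<^esub> snd x)"
  by (auto simp: alg_sum_def RDirProd_def DirProd_def monoid.defs ring.defs split: prod.splits)

lemma carrier_RDirProd_list_replicate:
  "carrier (RDirProd_list (replicate n R)) = {xs. length xs = n \<and> set xs \<subseteq> carrier R}"
proof (induction n)
  case 0
  then show ?case by auto
next
  case (Suc n)
  show ?case
  proof (intro Set.set_eqI iffI)
    fix xs assume "xs \<in> carrier (RDirProd_list (replicate (Suc n) R))"
    then show "xs \<in> {xs. length xs = Suc n \<and> set xs \<subseteq> carrier R}"
      using Suc by (auto simp: RDirProd_list_carrier)
  next
    fix xs assume xs: "xs \<in> {xs. length xs = Suc n \<and> set xs \<subseteq> carrier R}"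
    then obtain y ys where "xs = y # ys" by (cases xs) auto
    with xs Suc show "xs \<in> carrier (RDirProd_list (replicate (Suc n) R))"
      by (auto simp: RDirProd_list_carrier image_iff)
  qed
qed

lemma RDirProd_list_replicate_ops:
  assumes "length xs = n" "length ys = n" "set xs \<subseteq> carrier R" "set ys \<subseteq> carrier R"
  shows "xs \<otimes>\<^bsub>RDirProd_list (replicate n R)\<^esub> ys = map2 (monoid.mult R) xs ys"
    and "xs \<oplus>\<^bsub>RDirProd_list (replicate n R)\<^esub> ys = map2 (ring.add R) xs ys"
  using assms
proof (induction n arbitrary: xs ys)
  case 0
  case 1
  then show ?case 
    using nil_ring_simprules by (auto simp: monoid.defs)
next
  case 0
  case 2
  then show ?case by (auto simp: monoid.defs)
next
  case (Suc n)
  let ?S = "RDirProd_list (replicate n R)"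
  {
    fix xs ys assume asm: "length xs = Suc n" "length ys = Suc n" "set xs \<subseteq> carrier R" "set ys \<subseteq> carrier R"
    obtain x xs' y ys' where xs: "xs = x # xs'" "ys = y # ys'"
      using asm(1,2) by (meson length_Suc_conv)
    have mem: "(x, xs') \<in> carrier (RDirProd R ?S)" "(y, ys') \<in> carrier (RDirProd R ?S)"
      using asm xs by (auto simp: RDirProd_carrier carrier_RDirProd_list_replicate)
    note hom = RDirProd_list_hom1[of R "replicate n R"]
    have "xs \<otimes>\<^bsub>RDirProd_list (replicate (Suc n) R)\<^esub> ys = (x \<otimes>\<^bsub>R\<^esub> y) # (xs' \<otimes>\<^bsub>?S\<^esub> ys')"
      using ring_hom_mult[OF hom mem] xs by (simp add: RDirProd_def DirProd_def monoid.defs)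
    moreover have "xs \<oplus>\<^bsub>RDirProd_list (replicate (Suc n) R)\<^esub> ys = (x \<oplus>\<^bsub>R\<^esub> y) # (xs' \<oplus>\<^bsub>?S\<^esub> ys')"
      using ring_hom_add[OF hom mem] xs by (simp add: RDirProd_def DirProd_def monoid.defs)
    moreover have "xs' \<otimes>\<^bsub>?S\<^esub> ys' = map2 (monoid.mult R) xs' ys'" "xs' \<oplus>\<^bsub>?S\<^esub> ys' = map2 (ring.add R) xs' ys'"
      using Suc.IH[of xs' ys'] asm xs by auto
    ultimately have "xs \<otimes>\<^bsub>RDirProd_list (replicate (Suc n) R)\<^esub> ys = map2 (monoid.mult R) xs ys"
      "xs \<oplus>\<^bsub>RDirProd_list (replicate (Suc n) R)\<^esub> ys = map2 (ring.add R) xs ys"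
      by (simp_all add: xs)
  }
  note * = this
  case 1 then show ?case by (intro *)
  case 2 then show ?case by (intro *)
qed

lemma alg_copies_simps:
  "carrier (alg_copies n A) = {xs. length xs = n \<and> set xs \<subseteq> carrier A}"
  "length xs = n \<Longrightarrow> length ys = n \<Longrightarrow> set xs \<subseteq> carrier A \<Longrightarrow> set ys \<subseteq> carrier A \<Longrightarrow>
    monoid.mult (alg_copies n A) xs ys = map2 (monoid.mult A) xs ys"
  "length xs = n \<Longrightarrow> length ys = n \<Longrightarrow> set xs \<subseteq> carrier A \<Longrightarrow> set ys \<subseteq> carrier A \<Longrightarrow>
    ring.add (alg_copies n A) xs ys = map2 (ring.add A) xs ys"
  "monoid.one (alg_copies n A) = replicate n \<one>\<^bsub>A\<^esub>"
  "module.smult (alg_copies n A) c xs = map (\<lambda>x. c \<odot>\<^bsub>A\<^esub> x) xs"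
proof -
  have [simp]: "carrier (alg_copies n A) = carrier (RDirProd_list (replicate n A))"
    "monoid.mult (alg_copies n A) = monoid.mult (RDirProd_list (replicate n A))"
    "ring.add (alg_copies n A) = ring.add (RDirProd_list (replicate n A))"
    "monoid.one (alg_copies n A) = monoid.one (RDirProd_list (replicate n A))"
    by (simp_all add: alg_copies_def ring.defs)
  show "carrier (alg_copies n A) = {xs. length xs = n \<and> set xs \<subseteq> carrier A}"
    by (simp add: carrier_RDirProd_list_replicate)
  show "length xs = n \<Longrightarrow> length ys = n \<Longrightarrow> set xs \<subseteq> carrier A \<Longrightarrow> set ys \<subseteq> carrier A \<Longrightarrow>
    monoid.mult (alg_copies n A) xs ys = map2 (monoid.mult A) xs ys"
    by (simp add: RDirProd_list_replicate_ops)
  show "length xs = n \<Longrightarrow> length ys = n \<Longrightarrow> set xs \<subseteq> carrier A \<Longrightarrow> set ys \<subseteq> carrier A \<Longrightarrow>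
    ring.add (alg_copies n A) xs ys = map2 (ring.add A) xs ys"
    by (simp add: RDirProd_list_replicate_ops)
  show "monoid.one (alg_copies n A) = replicate n \<one>\<^bsub>A\<^esub>"
    by (simp add: RDirProd_list_one) (induction n; simp)
  show "module.smult (alg_copies n A) c xs = map (\<lambda>x. c \<odot>\<^bsub>A\<^esub> x) xs"
    by (simp add: alg_copies_def ring.defs)
qed

lemma matrix_algebra_simps:
  "carrier (matrix_algebra n K) = {A \<in> carrier_mat n n. \<forall>i < n. \<forall>j < n. A $$ (i, j) \<in> K}"
  "monoid.mult (matrix_algebra n K) = (*)"
  "ring.add (matrix_algebra n K) = (+)"
  "monoid.one (matrix_algebra n K) = 1\<^sub>m n"
  "module.smult (matrix_algebra n K) = (\<lambda>c A. of_rat c \<cdot>\<^sub>m A)"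
  by (auto simp: matrix_algebra_def elements_mat_def UN_subset_iff image_subset_iff)

lemma rat_group_algebra_simps:
  assumes "finite (carrier G)"
  shows "carrier (rat_group_algebra G) = {f. \<forall>x. x \<notin> carrier G \<longrightarrow> f x = 0}"
    and "f \<in> carrier (rat_group_algebra G) \<Longrightarrow> monoid.mult (rat_group_algebra G) f g =
      (\<lambda>x. if x \<in> carrier G then \<Sum>y\<in>carrier G. f y * g (inv\<^bsub>G\<^esub> y \<otimes>\<^bsub>G\<^esub> x) else 0)"
    and "ring.add (rat_group_algebra G) = (\<lambda>f g x. f x + g x)"
    and "monoid.one (rat_group_algebra G) = (\<lambda>x. if x = \<one>\<^bsub>G\<^esub> then 1 else 0)"
    and "module.smult (rat_group_algebra G) = (\<lambda>c f x. c * f x)"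
proof -
  show C: "carrier (rat_group_algebra G) = {f. \<forall>x. x \<notin> carrier G \<longrightarrow> f x = 0}"
    by (auto simp: rat_group_algebra_def intro: finite_subset[OF _ assms])
  show "monoid.mult (rat_group_algebra G) f g =
      (\<lambda>x. if x \<in> carrier G then \<Sum>y\<in>carrier G. f y * g (inv\<^bsub>G\<^esub> y \<otimes>\<^bsub>G\<^esub> x) else 0)"
    if "f \<in> carrier (rat_group_algebra G)"
    using that assms unfolding C
    by (auto simp: rat_group_algebra_def intro!: ext sum.mono_neutral_left)
qed (simp_all add: rat_group_algebra_def)

section \<open>Algebra maps given by representations and by quotients\<close>

text \<open>Substitution of \<open>x = y \<otimes> z\<close> in the convolution. The map
  \<open>e\<close> will be \<open>of_rat\<close> for matrix entries and the identity for sums over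
  cosets.\<close>

lemma (in group) convolution_sum:
  fixes \<phi> :: "'a \<Rightarrow> 'c :: comm_ring_1" and e :: "rat \<Rightarrow> 'c"
  assumes "finite (carrier G)" and f: "f \<in> carrier (rat_group_algebra G)"
    and e_sum: "\<And>h A. e (sum h A) = sum (\<lambda>x::'a. e (h x)) A" and e_mult: "\<And>a b. e (a * b) = e a * e b"
  shows "(\<Sum>x\<in>carrier G. e ((f \<otimes>\<^bsub>rat_group_algebra G\<^esub> g) x) * \<phi> x) =
    (\<Sum>y\<in>carrier G. \<Sum>z\<in>carrier G. e (f y) * e (g z) * \<phi> (y \<otimes> z))"
proof -
  have "(\<Sum>x\<in>carrier G. e ((f \<otimes>\<^bsub>rat_group_algebra G\<^esub> g) x) * \<phi> x) =
      (\<Sum>x\<in>carrier G. \<Sum>y\<in>carrier G. e (f y) * e (g (inv y \<otimes> x)) * \<phi> x)"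
    by (intro sum.cong HOL.refl)
      (simp add: rat_group_algebra_simps(2)[OF assms(1) f] e_sum e_mult sum_distrib_right)
  also have "\<dots> = (\<Sum>y\<in>carrier G. \<Sum>x\<in>carrier G. e (f y) * e (g (inv y \<otimes> x)) * \<phi> x)"
    by (rule sum.swap)
  also have "\<dots> = (\<Sum>y\<in>carrier G. \<Sum>z\<in>carrier G. e (f y) * e (g z) * \<phi> (y \<otimes> z))"
  proof (rule sum.cong[OF HOL.refl])
    fix y assume y: "y \<in> carrier G"
    show "(\<Sum>x\<in>carrier G. e (f y) * e (g (inv y \<otimes> x)) * \<phi> x) =
        (\<Sum>z\<in>carrier G. e (f y) * e (g z) * \<phi> (y \<otimes> z))"
      by (rule sum.reindex_bij_witness[of _ "\<lambda>z. y \<otimes> z" "\<lambda>x. inv y \<otimes> x"])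
        (use y in \<open>auto simp: m_assoc[symmetric]\<close>)
  qed
  finally show ?thesis .
qed

definition mat_of_rep :: "('a, 'b) monoid_scheme \<Rightarrow> nat \<Rightarrow> ('a \<Rightarrow> nat \<Rightarrow> nat \<Rightarrow> complex) \<Rightarrow> ('a \<Rightarrow> rat) \<Rightarrow> complex mat" where
  "mat_of_rep G n M f = mat n n (\<lambda>(s, t). \<Sum>g\<in>carrier G. of_rat (f g) * M g s t)"

lemma mat_of_rep_mem:
  assumes "matrix_rep G n (rat_adjoin \<zeta>) M"
  shows "mat_of_rep G n M f \<in> carrier (matrix_algebra n (rat_adjoin \<zeta>))"
  using assms unfolding matrix_rep_def
  by (auto simp: matrix_algebra_simps mat_of_rep_def intro!: rat_adjoin_sum rat_adjoin_mult rat_adjoin_of_rat)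

lemma mat_of_rep_add: "mat_of_rep G n M (\<lambda>x. f x + g x) = mat_of_rep G n M f + mat_of_rep G n M g"
  by (intro eq_matI) (auto simp: mat_of_rep_def of_rat_add algebra_simps sum.distrib)

lemma mat_of_rep_smult: "mat_of_rep G n M (\<lambda>x. c * f x) = of_rat c \<cdot>\<^sub>m mat_of_rep G n M f"
  by (intro eq_matI) (auto simp: mat_of_rep_def of_rat_mult sum_distrib_left mult.assoc)

lemma (in group) mat_of_rep_mult:
  assumes "finite (carrier G)" "f \<in> carrier (rat_group_algebra G)" and M: "matrix_rep G n K M"
  shows "mat_of_rep G n M (f \<otimes>\<^bsub>rat_group_algebra G\<^esub> g) = mat_of_rep G n M f * mat_of_rep G n M g"
proof (intro eq_matI)
  fix s t assume "s < dim_row (mat_of_rep G n M f * mat_of_rep G n M g)"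
    "t < dim_col (mat_of_rep G n M f * mat_of_rep G n M g)"
  then have st: "s < n" "t < n" by (simp_all add: mat_of_rep_def)
  have "mat_of_rep G n M (f \<otimes>\<^bsub>rat_group_algebra G\<^esub> g) $$ (s, t) =
      (\<Sum>y\<in>carrier G. \<Sum>z\<in>carrier G. of_rat (f y) * of_rat (g z) * M (y \<otimes> z) s t)"
    using st convolution_sum[OF assms(1,2), of of_rat g "\<lambda>x. M x s t"]
    by (simp add: mat_of_rep_def of_rat_sum of_rat_mult)
  also have "\<dots> = (\<Sum>y\<in>carrier G. \<Sum>z\<in>carrier G. \<Sum>j<n. (of_rat (f y) * M y s j) * (of_rat (g z) * M z j t))"
    using M st unfolding matrix_rep_def
    by (intro sum.cong HOL.refl) (simp add: sum_distrib_left ac_simps)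
  also have "\<dots> = (\<Sum>y\<in>carrier G. \<Sum>j<n. \<Sum>z\<in>carrier G. (of_rat (f y) * M y s j) * (of_rat (g z) * M z j t))"
    by (intro sum.cong HOL.refl sum.swap)
  also have "\<dots> = (\<Sum>j<n. \<Sum>y\<in>carrier G. \<Sum>z\<in>carrier G. (of_rat (f y) * M y s j) * (of_rat (g z) * M z j t))"
    by (rule sum.swap)
  also have "\<dots> = (\<Sum>j<n. (\<Sum>y\<in>carrier G. of_rat (f y) * M y s j) * (\<Sum>z\<in>carrier G. of_rat (g z) * M z j t))"
    by (simp add: sum_product)
  also have "\<dots> = (mat_of_rep G n M f * mat_of_rep G n M g) $$ (s, t)"
    using st by (simp add: mat_of_rep_def scalar_prod_def atLeast0LessThan)
  finally show "mat_of_rep G n M (f \<otimes>\<^bsub>rat_group_algebra G\<^esub> g) $$ (s, t) =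
      (mat_of_rep G n M f * mat_of_rep G n M g) $$ (s, t)" .
qed (simp_all add: mat_of_rep_def)

lemma (in group) mat_of_rep_delta:
  assumes "finite (carrier G)" "h \<in> carrier G" "s < n" "t < n"
  shows "mat_of_rep G n M (\<lambda>x. if x = h then 1 else 0) $$ (s, t) = M h s t"
proof -
  have "(\<Sum>g\<in>carrier G. of_rat (if g = h then 1 else 0) * M g s t) = (\<Sum>g\<in>carrier G. if g = h then M g s t else 0)"
    by (intro sum.cong) auto
  then show ?thesis using assms by (simp add: mat_of_rep_def)
qed

lemma (in group) mat_of_rep_one:
  assumes "finite (carrier G)" "matrix_rep G n K M"
  shows "mat_of_rep G n M (\<lambda>x. if x = \<one> then 1 else 0) = 1\<^sub>m n"
  using assms(2) unfolding matrix_rep_def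
  by (intro eq_matI) (auto simp: mat_of_rep_delta[OF assms(1) one_closed] mat_of_rep_def[THEN arg_cong[of _ _ dim_row]] mat_of_rep_def[THEN arg_cong[of _ _ dim_col]])

text \<open>The algebra map that the projection onto \<open>G Mod D\<close> induces on group
  algebras; the value 0 at sets that are not cosets keeps the image in the carrier.\<close>

definition pushforward :: "('a, 'b) monoid_scheme \<Rightarrow> 'a set \<Rightarrow> ('a \<Rightarrow> rat) \<Rightarrow> ('a set \<Rightarrow> rat)" where
  "pushforward G D f C = (if C \<in> carrier (G Mod D) then \<Sum>x\<in>C. f x else 0)"

lemma pushforward_add: "pushforward G D (\<lambda>x. f x + g x) = (\<lambda>C. pushforward G D f C + pushforward G D g C)"
  by (auto simp: pushforward_def sum.distrib)

lemma pushforward_smult: "pushforward G D (\<lambda>x. c * f x) = (\<lambda>C. c * pushforward G D f C)"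
  by (auto simp: pushforward_def sum_distrib_left)

text \<open>A coset sum written as a sum over the whole group against an indicator, the shape that
  \<open>convolution_sum\<close> handles.\<close>

lemma (in group) pushforward_altdef:
  assumes fin: "finite (carrier G)" and D: "D \<lhd> G" and C: "C \<in> rcosets D"
  shows "pushforward G D f C = (\<Sum>x\<in>carrier G. f x * (if D #> x = C then 1 else 0))"
proof -
  have sub: "subgroup D G" using D by (rule normal_imp_subgroup)
  have "C = {x \<in> carrier G. D #> x = C}"
  proof (intro Set.set_eqI iffI)
    fix x assume x: "x \<in> C"
    obtain y where y: "y \<in> carrier G" "C = D #> y" using C by (auto simp: RCOSETS_def)
    then have "D #> x = C" using repr_independence[OF _ y(1) sub] x by auto
    then show "x \<in> {x \<in> carrier G. D #> x = C}"
      using x y r_coset_subset_G[OF subgroup.subset[OF sub] y(1)] by auto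
  next
    fix x assume "x \<in> {x \<in> carrier G. D #> x = C}"
    then show "x \<in> C" using rcos_self[OF _ sub] by auto
  qed
  then have "(\<Sum>x\<in>C. f x) = (\<Sum>x\<in>{x \<in> carrier G. D #> x = C}. f x)" by simp
  also have "\<dots> = (\<Sum>x\<in>carrier G. f x * (if D #> x = C then 1 else 0))"
    using fin by (simp add: sum.If_cases if_distrib[of "\<lambda>c. _ * c"] Int_def cong: if_cong)
  finally show ?thesis using C by (simp add: pushforward_def FactGroup_def)
qed

lemma (in group) pushforward_mult:
  assumes fin: "finite (carrier G)" and D: "D \<lhd> G" and f: "f \<in> carrier (rat_group_algebra G)"
  shows "pushforward G D (f \<otimes>\<^bsub>rat_group_algebra G\<^esub> g) =
    pushforward G D f \<otimes>\<^bsub>rat_group_algebra (G Mod D)\<^esub> pushforward G D g"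
proof
  fix C
  interpret Q: group "G Mod D" using D by (rule normal.factorgroup_is_group)
  have carQ: "carrier (G Mod D) = rcosets D" by (simp add: FactGroup_def)
  have finQ: "finite (carrier (G Mod D))" using fin by (simp add: carQ RCOSETS_def)
  have in_Q: "pushforward G D f \<in> carrier (rat_group_algebra (G Mod D))"
    by (simp add: rat_group_algebra_simps(1)[OF finQ] pushforward_def)
  have coset: "D #> x \<in> rcosets D" if "x \<in> carrier G" for x using that by (auto simp: RCOSETS_def)
  show "pushforward G D (f \<otimes>\<^bsub>rat_group_algebra G\<^esub> g) C =
    (pushforward G D f \<otimes>\<^bsub>rat_group_algebra (G Mod D)\<^esub> pushforward G D g) C"
  proof (cases "C \<in> rcosets D")
    case False
    then show ?thesis
      by (simp add: rat_group_algebra_simps(2)[OF finQ in_Q] carQ) (simp add: pushforward_def FactGroup_def)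
  next
    case C: True
    have "pushforward G D (f \<otimes>\<^bsub>rat_group_algebra G\<^esub> g) C =
        (\<Sum>y\<in>carrier G. \<Sum>z\<in>carrier G. f y * g z * (if D #> (y \<otimes> z) = C then 1 else 0))"
      using convolution_sum[OF fin f, of "\<lambda>x. x" g "\<lambda>x. if D #> x = C then 1 else 0"]
      by (simp add: pushforward_altdef[OF fin D C])
    also have "\<dots> = (\<Sum>y\<in>carrier G. f y * pushforward G D g (inv\<^bsub>G Mod D\<^esub> (D #> y) \<otimes>\<^bsub>G Mod D\<^esub> C))"
    proof (rule sum.cong[OF HOL.refl])
      fix y assume y: "y \<in> carrier G"
      have Y: "D #> y \<in> carrier (G Mod D)" using y coset carQ by simp
      have eq: "D #> (y \<otimes> z) = C \<longleftrightarrow> D #> z = inv\<^bsub>G Mod D\<^esub> (D #> y) \<otimes>\<^bsub>G Mod D\<^esub> C" if z: "z \<in> carrier G" for z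
      proof -
        have "D #> (y \<otimes> z) = (D #> y) \<otimes>\<^bsub>G Mod D\<^esub> (D #> z)"
          using normal.rcos_sum[OF D y z] by (simp add: FactGroup_def)
        then show ?thesis
          using Q.inv_solve_left[of "D #> z" "D #> y" C] Y C z coset carQ by auto
      qed
      have "inv\<^bsub>G Mod D\<^esub> (D #> y) \<otimes>\<^bsub>G Mod D\<^esub> C \<in> rcosets D"
        using Y C Q.m_closed Q.inv_closed carQ by metis
      from pushforward_altdef[OF fin D this]
      show "(\<Sum>z\<in>carrier G. f y * g z * (if D #> (y \<otimes> z) = C then 1 else 0)) =
        f y * pushforward G D g (inv\<^bsub>G Mod D\<^esub> (D #> y) \<otimes>\<^bsub>G Mod D\<^esub> C)"
        by (simp add: sum_distrib_left mult.assoc eq cong: sum.cong)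
    qed
    \<comment> \<open>The second factor depends on \<open>y\<close> only through its coset, so the
      sum is grouped by cosets.\<close>
    also have "\<dots> = (\<Sum>Y\<in>rcosets D. \<Sum>y\<in>{y \<in> carrier G. D #> y = Y}. f y * pushforward G D g (inv\<^bsub>G Mod D\<^esub> (D #> y) \<otimes>\<^bsub>G Mod D\<^esub> C))"
      using fin finQ coset carQ by (intro sum.group[symmetric]) auto
    also have "\<dots> = (\<Sum>Y\<in>rcosets D. pushforward G D f Y * pushforward G D g (inv\<^bsub>G Mod D\<^esub> Y \<otimes>\<^bsub>G Mod D\<^esub> C))"
    proof (rule sum.cong[OF HOL.refl])
      fix Y assume Y: "Y \<in> rcosets D"
      have "pushforward G D f Y = (\<Sum>y\<in>{y \<in> carrier G. D #> y = Y}. f y)"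
        unfolding pushforward_altdef[OF fin D Y]
        using fin by (simp add: sum.If_cases if_distrib[of "\<lambda>c. _ * c"] Int_def cong: if_cong)
      then show "(\<Sum>y\<in>{y \<in> carrier G. D #> y = Y}. f y * pushforward G D g (inv\<^bsub>G Mod D\<^esub> (D #> y) \<otimes>\<^bsub>G Mod D\<^esub> C)) =
          pushforward G D f Y * pushforward G D g (inv\<^bsub>G Mod D\<^esub> Y \<otimes>\<^bsub>G Mod D\<^esub> C)"
        by (simp add: sum_distrib_right)
    qed
    also have "\<dots> = (pushforward G D f \<otimes>\<^bsub>rat_group_algebra (G Mod D)\<^esub> pushforward G D g) C"
      using C by (simp add: rat_group_algebra_simps(2)[OF finQ in_Q] carQ)
    finally show ?thesis .
  qed
qed

lemma (in group) pushforward_one: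
  assumes fin: "finite (carrier G)" and D: "D \<lhd> G"
  shows "pushforward G D (\<lambda>x. if x = \<one> then 1 else 0) = (\<lambda>C. if C = D then 1 else 0)"
proof
  fix C
  have sub: "subgroup D G" using D by (rule normal_imp_subgroup)
  have D1: "D #> \<one> = D" using coset_mult_one[OF subgroup.subset[OF sub]] .
  have DD: "D \<in> rcosets D" using D1 by (force simp: RCOSETS_def)
  show "pushforward G D (\<lambda>x. if x = \<one> then 1 else 0) C = (if C = D then 1 else 0)"
  proof (cases "C \<in> rcosets D")
    case True
    have "pushforward G D (\<lambda>x. if x = \<one> then 1 else 0) C =
        (\<Sum>x\<in>carrier G. if x = \<one> then (if D #> x = C then 1 else 0) else 0)"
      unfolding pushforward_altdef[OF fin D True] by (intro sum.cong) auto
    then show ?thesis using fin D1 by auto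
  next
    case False
    then show ?thesis using DD by (auto simp: pushforward_def FactGroup_def)
  qed
qed


text \<open>
  For surjectivity, both sides are compared inside complex-valued functions on a finite index set: the
  images of the group elements are independent over \<open>\<rat>\<close>, and by \<open>card\<close> they are at least as many as the
  obvious generators of the target.
\<close>

theorem (in group) group_algebra_decomposition:
  fixes n m k p :: nat and \<zeta> :: complex
  assumes fin: "finite (carrier G)" and p: "Factorial_Ring.prime p" and root: "primitive_root_of_unity p \<zeta>"
    and D: "D \<lhd> G"
    and M: "\<And>i. i < k \<Longrightarrow> matrix_rep G n (rat_adjoin \<zeta>) (M i)"
    and L: "matrix_rep G m (rat_adjoin \<zeta>) L"
    and joint: "\<And>f :: 'a \<Rightarrow> rat. (\<And>i s t. i < k \<Longrightarrow> s < n \<Longrightarrow> t < n \<Longrightarrow> (\<Sum>g\<in>carrier G. of_rat (f g) * M i g s t) = 0) \<Longrightarrow>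
        (\<And>s t. s < m \<Longrightarrow> t < m \<Longrightarrow> (\<Sum>g\<in>carrier G. of_rat (f g) * L g s t) = 0) \<Longrightarrow>
        (\<And>g. g \<in> carrier G \<Longrightarrow> (\<Sum>x\<in>D #> g. f x) = 0) \<Longrightarrow> (\<And>g. g \<in> carrier G \<Longrightarrow> f g = 0)"
    and card: "card (carrier (G Mod D)) + (k * (n * n) + m * m) * (p - 1) \<le> card (carrier G)"
  shows "rat_group_algebra G \<simeq>\<^sub>\<rat> rat_group_algebra (G Mod D)
    \<oplus>\<^sub>\<rat> alg_copies k (matrix_algebra n (rat_adjoin \<zeta>)) \<oplus>\<^sub>\<rat> matrix_algebra m (rat_adjoin \<zeta>)"
proof -
  let ?K = "rat_adjoin \<zeta>"
  let ?A = "rat_group_algebra G"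
  let ?B = "rat_group_algebra (G Mod D) \<oplus>\<^sub>\<rat> alg_copies k (matrix_algebra n ?K) \<oplus>\<^sub>\<rat> matrix_algebra m ?K"
  have carQ: "carrier (G Mod D) = rcosets D" by (simp add: FactGroup_def)
  have finQ: "finite (carrier (G Mod D))" using fin by (simp add: carQ RCOSETS_def)
  define F where "F f = (pushforward G D f, map (\<lambda>i. mat_of_rep G n (M i) f) [0..<k], mat_of_rep G m L f)" for f
  have in_k: "length (map (\<lambda>i. mat_of_rep G n (M i) f) [0..<k]) = k"
    "set (map (\<lambda>i. mat_of_rep G n (M i) f) [0..<k]) \<subseteq> carrier (matrix_algebra n ?K)" for f
    using mat_of_rep_mem[OF M] by auto
  have push_in: "pushforward G D f \<in> carrier (rat_group_algebra (G Mod D))" for f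
    by (simp add: rat_group_algebra_simps(1)[OF finQ] pushforward_def)
  have F_in: "F f \<in> carrier ?B" for f
    unfolding F_def alg_sum_simps alg_copies_simps
    using in_k push_in mat_of_rep_mem[OF L] by blast
  have F_add: "F (f \<oplus>\<^bsub>?A\<^esub> g) = F f \<oplus>\<^bsub>?B\<^esub> F g" for f g
    unfolding F_def alg_sum_simps fst_conv snd_conv alg_copies_simps(3)[OF in_k(1) in_k(1) in_k(2) in_k(2)]
    by (simp add: rat_group_algebra_simps[OF fin] rat_group_algebra_simps(3)[OF finQ] matrix_algebra_simps
        pushforward_add mat_of_rep_add map2_map_map)
  have F_mult: "F (f \<otimes>\<^bsub>?A\<^esub> g) = F f \<otimes>\<^bsub>?B\<^esub> F g" if f: "f \<in> carrier ?A" for f g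
    unfolding F_def alg_sum_simps fst_conv snd_conv alg_copies_simps(2)[OF in_k(1) in_k(1) in_k(2) in_k(2)]
    using mat_of_rep_mult[OF fin f M] mat_of_rep_mult[OF fin f L]
    by (simp add: matrix_algebra_simps pushforward_mult[OF fin D f] map2_map_map)
  have F_one: "F \<one>\<^bsub>?A\<^esub> = \<one>\<^bsub>?B\<^esub>"
    unfolding F_def alg_sum_simps alg_copies_simps
    using mat_of_rep_one[OF fin M] mat_of_rep_one[OF fin L]
    by (simp add: rat_group_algebra_simps[OF fin] rat_group_algebra_simps(4)[OF finQ] matrix_algebra_simps
        pushforward_one[OF fin D] map_replicate_const[symmetric] cong: map_cong)
      (intro nth_equalityI; simp)
  have F_smult: "F (c \<odot>\<^bsub>?A\<^esub> f) = c \<odot>\<^bsub>?B\<^esub> F f" for c f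
    unfolding F_def alg_sum_simps alg_copies_simps
    by (simp add: rat_group_algebra_simps[OF fin] rat_group_algebra_simps(5)[OF finQ] matrix_algebra_simps
        pushforward_smult mat_of_rep_smult)
  have F_inj: "f = 0" if f: "f \<in> carrier ?A"
    and push: "\<And>c. c \<in> carrier (G Mod D) \<Longrightarrow> pushforward G D f c = 0"
    and Mf: "\<And>i s t. i < k \<Longrightarrow> s < n \<Longrightarrow> t < n \<Longrightarrow> mat_of_rep G n (M i) f $$ (s, t) = 0"
    and Lf: "\<And>s t. s < m \<Longrightarrow> t < m \<Longrightarrow> mat_of_rep G m L f $$ (s, t) = 0" for f
  proof
    fix g
    show "f g = 0 g"
    proof (cases "g \<in> carrier G")
      case True
      have "(\<Sum>x\<in>D #> g. f x) = 0" if "g \<in> carrier G" for g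
      proof -
        have "D #> g \<in> carrier (G Mod D)" using that by (auto simp: carQ RCOSETS_def)
        then show ?thesis using push by (simp add: pushforward_def)
      qed
      then show ?thesis using joint[of f g] Mf Lf True by (simp add: mat_of_rep_def)
    next
      case False
      then show ?thesis using f by (simp add: rat_group_algebra_simps[OF fin])
    qed
  qed
  \<comment> \<open>Coordinates of the target: \<open>Inl\<close> of a coset for the abelian part,
    and \<open>Inr (i, s, t)\<close> for entry \<open>(s, t)\<close> of block \<open>i\<close>,
    where \<open>i = k\<close> denotes the block of size \<open>m\<close>. Rationals act on the
    complex values through \<open>of_rat\<close>.\<close>
  let ?scale = "\<lambda>(a::rat) (f :: 'a set + nat \<times> nat \<times> nat \<Rightarrow> complex) x. of_rat a * f x"
  interpret V: vector_space ?scale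
    by unfold_locales (auto simp: fun_eq_iff algebra_simps of_rat_add of_rat_mult)
  have V_sum: "(\<Sum>i\<in>I. ?scale (a i) (v i)) x = (\<Sum>i\<in>I. of_rat (a i) * v i x)" for I :: "'i set" and a v x
    by (induction I rule: infinite_finite_induct) auto
  define \<delta> where "\<delta> x z = (\<lambda>y. if y = x then z else 0)" for x :: "'a set + nat \<times> nat \<times> nat" and z :: complex
  define T1 :: "('a set + nat \<times> nat \<times> nat) set" where "T1 = Inl ` carrier (G Mod D)"
  define T2 :: "('a set + nat \<times> nat \<times> nat) set"
    where "T2 = Inr ` ({..<k} \<times> {..<n} \<times> {..<n} \<union> {k} \<times> {..<m} \<times> {..<m})"
  \<comment> \<open>One generator for each coset and \<open>p - 1\<close> powers of
    \<open>\<zeta>\<close> for each matrix entry, in agreement with the left side of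
    \<open>card\<close>.\<close>
  define S where "S = (\<lambda>x. \<delta> x 1) ` T1 \<union> (\<lambda>(x, j). \<delta> x (\<zeta> ^ j)) ` (T2 \<times> {..<p - 1})"
  have finS: "finite S" using finQ by (simp add: S_def T1_def T2_def)
  have cardS: "card S \<le> card (carrier G)"
  proof -
    have "card S \<le> card T1 + card (T2 \<times> {..<p - 1})"
      unfolding S_def using finQ
      by (intro order_trans[OF card_Un_le add_mono] card_image_le) (simp_all add: T1_def T2_def)
    also have "card T1 = card (carrier (G Mod D))" by (simp add: T1_def card_image)
    also have "card (T2 \<times> {..<p - 1}) = card T2 * (p - 1)" by (simp add: card_cartesian_product)
    also have "card T2 \<le> k * (n * n) + m * m"
      unfolding T2_def by (simp add: card_image order_trans[OF card_Un_le])
    finally show ?thesis using card by (meson add_left_mono le_trans mult_le_mono1)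
  qed
  have span_S: "w \<in> V.span S" if off: "\<And>x. x \<notin> T1 \<union> T2 \<Longrightarrow> w x = 0"
    and w1: "\<And>x. x \<in> T1 \<Longrightarrow> w x \<in> range of_rat" and w2: "\<And>x. x \<in> T2 \<Longrightarrow> w x \<in> ?K" for w
  proof -
    have fin12: "finite (T1 \<union> T2)" using finQ by (simp add: T1_def T2_def)
    have "w = (\<Sum>x\<in>T1 \<union> T2. \<delta> x (w x))"
    proof
      fix y
      have "(\<Sum>x\<in>T1 \<union> T2. \<delta> x (w x)) y = (\<Sum>x\<in>T1 \<union> T2. \<delta> x (w x) y)"
        using V_sum[of "\<lambda>_. 1" "\<lambda>x. \<delta> x (w x)" "T1 \<union> T2" y] by simp
      also have "\<dots> = (\<Sum>x\<in>T1 \<union> T2. if x = y then w y else 0)"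
        by (intro sum.cong) (auto simp: \<delta>_def)
      also have "\<dots> = w y" using fin12 off by simp
      finally show "w y = (\<Sum>x\<in>T1 \<union> T2. \<delta> x (w x)) y" by simp
    qed
    moreover have "\<delta> x (w x) \<in> V.span S" if x: "x \<in> T1 \<union> T2" for x
    proof (cases "x \<in> T1")
      case True
      then obtain a where "w x = of_rat a" using w1 by blast
      then have "\<delta> x (w x) = ?scale a (\<delta> x 1)" by (auto simp: \<delta>_def)
      moreover have "\<delta> x 1 \<in> S" using True by (simp add: S_def)
      ultimately show ?thesis using V.span_scale[OF V.span_base] by metis
    next
      case False
      then have x2: "x \<in> T2" using x by simp
      obtain a where a: "w x = (\<Sum>j<p - 1. of_rat (a j) * \<zeta> ^ j)"
        by (rule rat_adjoin_combination[OF p root w2[OF x2]])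
      have "\<delta> x (w x) = (\<Sum>j<p - 1. ?scale (a j) (\<delta> x (\<zeta> ^ j)))"
        by (rule ext) (simp only: V_sum, simp add: \<delta>_def a)
      moreover have "\<delta> x (\<zeta> ^ j) \<in> S" if "j < p - 1" for j
        using x2 that by (auto simp: S_def)
      ultimately show ?thesis
        by (simp only:) (rule V.span_sum, rule V.span_scale, rule V.span_base, simp)
    qed
    ultimately show ?thesis by (metis (no_types, lifting) V.span_sum)
  qed
  \<comment> \<open>\<open>E\<close> lists all coordinates of an element of the target in one
    function, so that linear algebra can take place in \<open>V\<close>.\<close>
  define E where "E F = (\<lambda>x. case x of Inl c \<Rightarrow> if c \<in> carrier (G Mod D) then complex_of_rat (fst F c) else 0
    | Inr (i, s, t) \<Rightarrow> if i < k \<and> s < n \<and> t < n then (fst (snd F) ! i) $$ (s, t)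
        else if i = k \<and> s < m \<and> t < m then snd (snd F) $$ (s, t) else 0)"
    for F :: "('a set \<Rightarrow> rat) \<times> complex mat list \<times> complex mat"
  have E_span: "E x \<in> V.span S" if x: "x \<in> carrier ?B" for x
  proof (rule span_S)
    obtain u xs y where [simp]: "x = (u, xs, y)" by (metis surj_pair)
    have mem: "length xs = k" "\<And>i. i < k \<Longrightarrow> xs ! i \<in> carrier (matrix_algebra n ?K)" "y \<in> carrier (matrix_algebra m ?K)"
      using x by (auto simp: alg_sum_simps alg_copies_simps)
    show "E x z = 0" if "z \<notin> T1 \<union> T2" for z
      using that by (auto simp: E_def T1_def T2_def split: sum.splits prod.splits)
    show "E x z \<in> range of_rat" if "z \<in> T1" for z
      using that by (auto simp: E_def T1_def)
    show "E x z \<in> ?K" if "z \<in> T2" for z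
      using that mem by (auto simp: E_def T2_def matrix_algebra_simps rat_adjoin_0)
  qed
  \<comment> \<open>The group elements as members of the group algebra; \<open>eps\<close> below is
    the linearity of \<open>F\<close> followed by \<open>E\<close>, expanded in this basis.\<close>
  define \<epsilon> where "\<epsilon> g = (\<lambda>x. if x = g then 1 else (0::rat))" for g :: 'a
  have eps: "(\<Sum>g\<in>carrier G. of_rat (a g) * E (F (\<epsilon> g)) x) = E (F (\<lambda>g. if g \<in> carrier G then a g else 0)) x" for a :: "'a \<Rightarrow> rat" and x
  proof (cases x)
    case (Inl c)
    show ?thesis
    proof (cases "c \<in> carrier (G Mod D)")
      case True
      have c: "c \<in> rcosets D" using True carQ by simp
      have "pushforward G D (\<epsilon> g) c = (if D #> g = c then 1 else 0)" if "g \<in> carrier G" for g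
      proof -
        have "pushforward G D (\<epsilon> g) c = (\<Sum>x\<in>carrier G. if x = g then (if D #> x = c then 1 else 0) else 0)"
          unfolding pushforward_altdef[OF fin D c] by (intro sum.cong) (auto simp: \<epsilon>_def)
        then show ?thesis using fin that by simp
      qed
      moreover have "pushforward G D (\<lambda>g. if g \<in> carrier G then a g else 0) c = (\<Sum>g\<in>carrier G. a g * (if D #> g = c then 1 else 0))"
        unfolding pushforward_altdef[OF fin D c] by (intro sum.cong) auto
      ultimately show ?thesis using True by (simp add: Inl E_def F_def of_rat_sum of_rat_mult cong: sum.cong)
    qed (simp add: Inl E_def)
  next
    case (Inr y)
    obtain i s t where y: "y = (i, s, t)" by (metis surj_pair)
    have mat: "mat_of_rep G d R (\<lambda>g. if g \<in> carrier G then a g else 0) $$ (s, t) = (\<Sum>g\<in>carrier G. of_rat (a g) * R g s t)"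
      if "s < d" "t < d" for d R using that by (simp add: mat_of_rep_def)
    consider "i < k \<and> s < n \<and> t < n" | "i = k \<and> s < m \<and> t < m"
      | "\<not> (i < k \<and> s < n \<and> t < n)" "\<not> (i = k \<and> s < m \<and> t < m)" by blast
    then show ?thesis
    proof cases
      case 1
      then show ?thesis by (simp add: Inr y E_def F_def mat mat_of_rep_delta[OF fin] \<epsilon>_def cong: sum.cong)
    next
      case 2
      then show ?thesis by (simp add: Inr y E_def F_def mat mat_of_rep_delta[OF fin] \<epsilon>_def cong: sum.cong)
    next
      case 3
      then have "E F' x = 0" for F' by (auto simp: Inr y E_def)
      then show ?thesis by simp
    qed
  qed
  have E_inj: "x = y" if x: "x \<in> carrier ?B" and y: "y \<in> carrier ?B" and xy: "E x = E y" for x y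
  proof -
    obtain u xs v u' xs' v' where eqs: "x = (u, xs, v)" "y = (u', xs', v')" by (metis surj_pair)
    have mem: "u \<in> carrier (rat_group_algebra (G Mod D))" "u' \<in> carrier (rat_group_algebra (G Mod D))"
      "length xs = k" "length xs' = k" "\<And>i. i < k \<Longrightarrow> xs ! i \<in> carrier_mat n n" "\<And>i. i < k \<Longrightarrow> xs' ! i \<in> carrier_mat n n"
      "v \<in> carrier_mat m m" "v' \<in> carrier_mat m m"
      using x y eqs by (auto simp: alg_sum_simps alg_copies_simps matrix_algebra_simps subset_iff)
    have "u c = u' c" for c
      using fun_cong[OF xy, of "Inl c"] mem(1,2) eqs
      by (cases "c \<in> carrier (G Mod D)") (auto simp: E_def rat_group_algebra_simps[OF finQ])
    then have "u = u'" by blast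
    moreover have "xs ! i = xs' ! i" if i: "i < k" for i
    proof (intro eq_matI)
      fix s t assume "s < dim_row (xs' ! i)" "t < dim_col (xs' ! i)"
      then have "s < n" "t < n" using mem(6)[OF i] by auto
      then show "xs ! i $$ (s, t) = xs' ! i $$ (s, t)"
        using fun_cong[OF xy, of "Inr (i, s, t)"] i eqs by (simp add: E_def)
    qed (use mem(5)[OF i] mem(6)[OF i] in auto)
    then have "xs = xs'" using mem(3,4) by (intro nth_equalityI) auto
    moreover have "v = v'"
    proof (intro eq_matI)
      fix s t assume "s < dim_row v'" "t < dim_col v'"
      then have "s < m" "t < m" using mem(8) by auto
      then show "v $$ (s, t) = v' $$ (s, t)"
        using fun_cong[OF xy, of "Inr (k, s, t)"] eqs by (simp add: E_def)
    qed (use mem(7,8) in auto)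
    ultimately show ?thesis using eqs by simp
  qed
  have F_inj': "f = 0" if f: "f \<in> carrier ?A" and zero: "E (F f) = 0" for f
  proof (rule F_inj[OF f])
    show "pushforward G D f c = 0" if "c \<in> carrier (G Mod D)" for c
      using fun_cong[OF zero, of "Inl c"] that by (simp add: E_def F_def)
    show "mat_of_rep G n (M i) f $$ (s, t) = 0" if "i < k" "s < n" "t < n" for i s t
      using fun_cong[OF zero, of "Inr (i, s, t)"] that by (simp add: E_def F_def)
    show "mat_of_rep G m L f $$ (s, t) = 0" if "s < m" "t < m" for s t
      using fun_cong[OF zero, of "Inr (k, s, t)"] that by (simp add: E_def F_def)
  qed
  have ext_in: "(\<lambda>g. if g \<in> carrier G then a g else 0) \<in> carrier ?A" for a :: "'a \<Rightarrow> rat"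
    by (simp add: rat_group_algebra_simps[OF fin])
  have eps': "(\<Sum>g\<in>carrier G. ?scale (a g) (E (F (\<epsilon> g)))) = E (F (\<lambda>g. if g \<in> carrier G then a g else 0))" for a :: "'a \<Rightarrow> rat"
    by (rule ext) (simp only: V_sum eps)
  have F_surj: "\<exists>f \<in> carrier ?A. F f = x" if x: "x \<in> carrier ?B" for x
  proof -
    \<comment> \<open>The images of the group elements are independent because \<open>F\<close> has
      trivial kernel, and \<open>cardS\<close> makes them numerous enough to span.\<close>
    obtain a where a: "E x = (\<Sum>g\<in>carrier G. ?scale (a g) (E (F (\<epsilon> g))))"
    proof (rule V.family_spans_of_card[OF fin finS cardS _ _ E_span[OF x]])
      show "E (F (\<epsilon> g)) \<in> V.span S" for g by (rule E_span[OF F_in])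
      show "a g = 0" if "(\<Sum>g\<in>carrier G. ?scale (a g) (E (F (\<epsilon> g)))) = 0" "g \<in> carrier G" for a g
      proof -
        have "(\<lambda>g. if g \<in> carrier G then a g else 0) = 0"
          using that(1) unfolding eps' by (intro F_inj'[OF ext_in])
        from fun_cong[OF this, of g] show ?thesis using that(2) by simp
      qed
    qed
    then have "E x = E (F (\<lambda>g. if g \<in> carrier G then a g else 0))" by (simp only: eps')
    then have "x = F (\<lambda>g. if g \<in> carrier G then a g else 0)" by (rule E_inj[OF x F_in])
    then show ?thesis using ext_in by blast
  qed
  have F_inj_on: "inj_on F (carrier ?A)"
  proof (rule inj_onI)
    fix f g assume f: "f \<in> carrier ?A" and g: "g \<in> carrier ?A" and eq: "F f = F g"
    define d where "d = (\<lambda>x. f x - g x)"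
    have dA: "d \<in> carrier ?A" using f g by (simp add: d_def rat_group_algebra_simps[OF fin])
    have "E (F d) = 0"
    proof
      fix x
      have lin: "E (F h) x = (\<Sum>y\<in>carrier G. of_rat (h y) * E (F (\<epsilon> y)) x)" if "h \<in> carrier ?A" for h
      proof -
        have "(\<lambda>y. if y \<in> carrier G then h y else 0) = h"
          using that by (auto simp: rat_group_algebra_simps[OF fin])
        then show ?thesis using eps[of h x] by simp
      qed
      show "E (F d) x = 0 x"
        using lin[OF f] lin[OF g] eq unfolding lin[OF dA]
        by (simp add: d_def of_rat_diff left_diff_distrib sum_subtractf)
    qed
    then have "d = 0" by (rule F_inj'[OF dA])
    show "f = g"
    proof
      fix x show "f x = g x" using fun_cong[OF \<open>d = 0\<close>, of x] by (simp add: d_def)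
    qed
  qed
  have "F \<in> Ring.ring_hom ?A ?B"
    by (rule ring_hom_memI) (simp_all only: F_in F_mult F_add F_one)
  moreover have "bij_betw F (carrier ?A) (carrier ?B)"
    unfolding bij_betw_def using F_inj_on F_in F_surj by (auto simp: image_iff) metis
  ultimately have "F \<in> ring_iso ?A ?B" by (simp add: ring_iso_def)
  then show ?thesis
    unfolding rat_algebra_isomorphic_def using F_smult by blast
qed

section \<open>Adjoining an element to a subgroup\<close>

context group
begin

text \<open>The product of \<open>K\<close> with the cyclic group of \<open>u\<close>; it is a
  subgroup when \<open>u\<close> normalizes \<open>K\<close>, see \<open>subgroup_adj\<close>.
  Natural exponents suffice because the groups are finite.\<close>

definition adj :: "'a set \<Rightarrow> 'a \<Rightarrow> 'a set" where
  "adj K u = {k \<otimes> u [^] i | k (i::nat). k \<in> K}"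

definition centralizer :: "'a \<Rightarrow> 'a set" where
  "centralizer h = {g \<in> carrier G. g \<otimes> h = h \<otimes> g}"

lemma adj_memI: "k \<in> K \<Longrightarrow> k \<otimes> u [^] (i::nat) \<in> adj K u"
  by (auto simp: adj_def)

lemma subgroup_nat_pow: "subgroup S G \<Longrightarrow> u \<in> S \<Longrightarrow> u [^] (i::nat) \<in> S"
  by (induction i) (auto simp: subgroup.one_closed subgroup.m_closed)

lemma adj_subset: "subgroup S G \<Longrightarrow> K \<subseteq> S \<Longrightarrow> u \<in> S \<Longrightarrow> adj K u \<subseteq> S"
  by (auto simp: adj_def subgroup.m_closed subgroup_nat_pow)

lemma adj_base: "subgroup K G \<Longrightarrow> u \<in> carrier G \<Longrightarrow> K \<subseteq> adj K u"
  using adj_memI[of _ K u 0] subgroup.mem_carrier by fastforce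

lemma adj_self: "subgroup K G \<Longrightarrow> u \<in> carrier G \<Longrightarrow> u \<in> adj K u"
  using adj_memI[of \<one> K u 1] subgroup.one_closed[of K G] by simp

text \<open>Since \<open>i\<close> is prime to \<open>p\<close>, Bezout gives
  \<open>a * i = b * p + 1\<close>, so \<open>u\<close> is a quotient of powers of the two given
  elements of \<open>S\<close>.\<close>

lemma nat_pow_in_prime:
  assumes S: "subgroup S G" and u: "u \<in> carrier G" and p: "Factorial_Ring.prime p"
    and "u [^] (p::nat) \<in> S" "u [^] i \<in> S" "0 < i" "i < p"
  shows "u \<in> S"
proof -
  have "coprime i p"
    by (subst coprime_commute, rule prime_imp_coprime[OF p]) (use assms(6,7) in \<open>auto dest: dvd_imp_le\<close>)
  then obtain a b where "i * a = p * b + 1"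
    using bezout_nat[of i p] assms(6) by (auto simp: coprime_iff_gcd_eq_1)
  then have ab: "a * i = b * p + 1" by (simp add: mult.commute)
  have "u [^] (a * i) = u [^] (b * p) \<otimes> u" using u ab by simp
  then have "u = inv (u [^] (b * p)) \<otimes> u [^] (a * i)"
    using u by (simp add: m_assoc[symmetric])
  moreover have "u [^] (b * p) \<in> S"
    using subgroup_nat_pow[OF S assms(4), of b] u by (simp add: nat_pow_pow mult.commute)
  moreover have "u [^] (a * i) \<in> S"
    using subgroup_nat_pow[OF S assms(5), of a] u by (simp add: nat_pow_pow mult.commute)
  ultimately show ?thesis
    using S by (metis subgroup.m_closed subgroup.m_inv_closed)
qed

lemma conj_nat_pow:
  assumes "u \<in> carrier G" "g \<in> carrier G"
  shows "g \<otimes> u [^] (i::nat) \<otimes> inv g = (g \<otimes> u \<otimes> inv g) [^] i"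
proof (induction i)
  case 0
  then show ?case using assms by simp
next
  case (Suc i)
  have "(g \<otimes> u \<otimes> inv g) [^] Suc i = (g \<otimes> u [^] i \<otimes> inv g) \<otimes> (g \<otimes> u \<otimes> inv g)"
    using Suc by simp
  also have "\<dots> = g \<otimes> u [^] i \<otimes> (inv g \<otimes> g) \<otimes> u \<otimes> inv g"
    using assms by (simp only: m_assoc m_closed inv_closed nat_pow_closed)
  also have "\<dots> = g \<otimes> u [^] Suc i \<otimes> inv g" using assms by (simp add: m_assoc)
  finally show ?case by simp
qed

lemma conj_mult:
  assumes "a \<in> carrier G" "b \<in> carrier G" "g \<in> carrier G"
  shows "g \<otimes> (a \<otimes> b) \<otimes> inv g = (g \<otimes> a \<otimes> inv g) \<otimes> (g \<otimes> b \<otimes> inv g)"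
proof -
  have "(g \<otimes> a \<otimes> inv g) \<otimes> (g \<otimes> b \<otimes> inv g) = g \<otimes> a \<otimes> (inv g \<otimes> g) \<otimes> b \<otimes> inv g"
    using assms by (simp only: m_assoc m_closed inv_closed)
  then show ?thesis using assms by (simp add: m_assoc)
qed

lemma conj_comp:
  assumes "a \<in> carrier G" "g \<in> carrier G" "h \<in> carrier G"
  shows "(g \<otimes> h) \<otimes> a \<otimes> inv (g \<otimes> h) = g \<otimes> (h \<otimes> a \<otimes> inv h) \<otimes> inv g"
  using assms by (simp add: inv_mult_group m_assoc)

lemma conj_adj:
  assumes S: "subgroup S G" and "K \<subseteq> carrier G" "u \<in> carrier G" "g \<in> carrier G"
    and "\<And>k. k \<in> K \<Longrightarrow> g \<otimes> k \<otimes> inv g \<in> S" "g \<otimes> u \<otimes> inv g \<in> S" and "s \<in> adj K u"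
  shows "g \<otimes> s \<otimes> inv g \<in> S"
proof -
  obtain k i where s: "k \<in> K" "s = k \<otimes> u [^] (i::nat)" using assms(7) by (auto simp: adj_def)
  have "g \<otimes> s \<otimes> inv g = (g \<otimes> k \<otimes> inv g) \<otimes> (g \<otimes> u \<otimes> inv g) [^] i"
    using s assms(2-4) by (simp add: conj_mult conj_nat_pow subset_iff)
  then show ?thesis using S assms(5,6) s by (simp add: subgroup.m_closed subgroup_nat_pow)
qed

lemma conj_pow_mem:
  assumes "K \<subseteq> carrier G" "u \<in> carrier G" "\<And>k. k \<in> K \<Longrightarrow> u \<otimes> k \<otimes> inv u \<in> K" "k \<in> K"
  shows "u [^] (i::nat) \<otimes> k \<otimes> inv (u [^] i) \<in> K"
proof (induction i)
  case 0
  then show ?case using assms by auto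
next
  case (Suc i)
  have "u [^] Suc i = u \<otimes> u [^] i" by (rule nat_pow_Suc2[OF assms(2)])
  then have "u [^] Suc i \<otimes> k \<otimes> inv (u [^] Suc i) = u \<otimes> (u [^] i \<otimes> k \<otimes> inv (u [^] i)) \<otimes> inv u"
    using assms by (simp only: conj_comp nat_pow_closed subsetD)
  then show ?case using assms(3) Suc by simp
qed

lemma subgroup_adj:
  assumes fin: "finite (carrier G)" and K: "subgroup K G" and u: "u \<in> carrier G"
    and norm: "\<And>k. k \<in> K \<Longrightarrow> u \<otimes> k \<otimes> inv u \<in> K"
  shows "subgroup (adj K u) G"
proof (rule finite_subgroupI)
  have KG: "K \<subseteq> carrier G" using K by (rule subgroup.subset)
  show sub: "adj K u \<subseteq> carrier G" using KG u by (auto simp: adj_def)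
  show "finite (adj K u)" using fin sub finite_subset by blast
  show "adj K u \<noteq> {}" using adj_self[OF K u] by blast
  fix a b assume "a \<in> adj K u" "b \<in> adj K u"
  then obtain k i l j where ab: "k \<in> K" "a = k \<otimes> u [^] (i::nat)" "l \<in> K" "b = l \<otimes> u [^] (j::nat)"
    by (auto simp: adj_def)
  have cl: "k \<in> carrier G" "l \<in> carrier G" using ab KG by auto
  have "a \<otimes> b = k \<otimes> (u [^] i \<otimes> l) \<otimes> u [^] j" using ab cl u by (simp add: m_assoc)
  also have "u [^] i \<otimes> l = (u [^] i \<otimes> l \<otimes> inv (u [^] i)) \<otimes> u [^] i"
    using cl u by (simp add: m_assoc)
  also have "k \<otimes> ((u [^] i \<otimes> l \<otimes> inv (u [^] i)) \<otimes> u [^] i) \<otimes> u [^] j =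
      (k \<otimes> (u [^] i \<otimes> l \<otimes> inv (u [^] i))) \<otimes> u [^] (i + j)"
    using cl u by (simp only: nat_pow_mult[OF u, symmetric] m_assoc m_closed inv_closed nat_pow_closed)
  finally show "a \<otimes> b \<in> adj K u"
    using conj_pow_mem[OF KG u norm ab(3)] ab(1) K by (simp add: adj_memI subgroup.m_closed)
qed

lemma adj_cases:
  assumes K: "subgroup K G" and u: "u \<in> carrier G" and up: "u [^] p \<in> K" and p: "0 < p" and g: "g \<in> adj K u"
  obtains k i where "k \<in> K" "i < p" "g = k \<otimes> u [^] (i::nat)"
proof -
  obtain k i where k: "k \<in> K" "g = k \<otimes> u [^] (i::nat)" using g by (auto simp: adj_def)
  have "u [^] i = u [^] (p * (i div p) + i mod p)" by simp
  also have "\<dots> = (u [^] p) [^] (i div p) \<otimes> u [^] (i mod p)"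
    using u by (simp only: nat_pow_mult[symmetric] nat_pow_pow)
  finally have "g = (k \<otimes> (u [^] p) [^] (i div p)) \<otimes> u [^] (i mod p)"
    using k u up K by (simp add: m_assoc subgroup.mem_carrier)
  moreover have "k \<otimes> (u [^] p) [^] (i div p) \<in> K"
    using K k up by (simp add: subgroup.m_closed subgroup_nat_pow)
  ultimately show ?thesis using that p mod_less_divisor by blast
qed

text \<open>Different exponents would put some \<open>u [^] (j - i)\<close> with
  \<open>0 < j - i < p\<close> into \<open>K\<close>, and with it \<open>u\<close>, by
  \<open>nat_pow_in_prime\<close>.\<close>

lemma adj_unique:
  assumes K: "subgroup K G" and u: "u \<in> carrier G" and p: "Factorial_Ring.prime p"
    and up: "u [^] p \<in> K" and notin: "u \<notin> K"
    and eq: "k \<otimes> u [^] i = l \<otimes> u [^] (j::nat)" and kl: "k \<in> K" "l \<in> K" and ij: "i < p" "j < p"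
  shows "k = l \<and> i = j"
proof -
  have cl: "k \<in> carrier G" "l \<in> carrier G" using kl K by (auto simp: subgroup.mem_carrier)
  have *: False if "k \<otimes> u [^] i = l \<otimes> u [^] j" "k \<in> K" "l \<in> K" "i < j" "j < p" for k l i j
  proof -
    have cl: "k \<in> carrier G" "l \<in> carrier G" using that K by (auto simp: subgroup.mem_carrier)
    have "k \<otimes> u [^] i = (l \<otimes> u [^] (j - i)) \<otimes> u [^] i"
      using that cl u by (simp add: m_assoc nat_pow_mult)
    then have "k = l \<otimes> u [^] (j - i)" using cl u by simp
    then have "u [^] (j - i) = inv l \<otimes> k" using cl u by (simp add: m_assoc[symmetric])
    then have "u [^] (j - i) \<in> K" using that K by (simp add: subgroup.m_closed subgroup.m_inv_closed)
    moreover have "0 < j - i" "j - i < p" using that by auto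
    ultimately show False using nat_pow_in_prime[OF K u p up, of "j - i"] notin by blast
  qed
  have "i = j" using *[of k i l j] *[of l j k i] eq kl ij by (metis linorder_neqE_nat)
  then show ?thesis using eq cl u by simp
qed

lemma bij_adj:
  assumes K: "subgroup K G" and u: "u \<in> carrier G" and p: "Factorial_Ring.prime p"
    and up: "u [^] p \<in> K" and notin: "u \<notin> K"
  shows "bij_betw (\<lambda>(k, i). k \<otimes> u [^] (i::nat)) (K \<times> {..<p}) (adj K u)"
  unfolding bij_betw_def
proof
  show "inj_on (\<lambda>(k, i). k \<otimes> u [^] (i::nat)) (K \<times> {..<p})"
  proof (rule inj_onI)
    fix a b assume ab: "a \<in> K \<times> {..<p}" "b \<in> K \<times> {..<p}"
      "(\<lambda>(k, i). k \<otimes> u [^] (i::nat)) a = (\<lambda>(k, i). k \<otimes> u [^] (i::nat)) b"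
    obtain k i l j where [simp]: "a = (k, i)" "b = (l, j)" by (metis surj_pair)
    show "a = b" using adj_unique[OF assms, of k i l j] ab by simp
  qed
  show "(\<lambda>(k, i). k \<otimes> u [^] (i::nat)) ` (K \<times> {..<p}) = adj K u"
  proof (intro Set.set_eqI iffI)
    fix g assume "g \<in> adj K u"
    then obtain k i where "k \<in> K" "i < p" "g = k \<otimes> u [^] (i::nat)"
      by (rule adj_cases[OF K u up prime_gt_0_nat[OF p]])
    then show "g \<in> (\<lambda>(k, i). k \<otimes> u [^] (i::nat)) ` (K \<times> {..<p})" by force
  qed (auto simp: adj_memI)
qed

lemma card_adj:
  assumes "subgroup K G" "u \<in> carrier G" "Factorial_Ring.prime p" "u [^] p \<in> K" "u \<notin> K"
  shows "card (adj K u) = p * card K"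
  using bij_betw_same_card[OF bij_adj[OF assms]] by (simp add: card_cartesian_product mult.commute)

lemma subgroup_card_dvd:
  assumes "finite (carrier G)" and H: "subgroup H G" and K: "subgroup K G" and HK: "H \<subseteq> K"
  shows "card H dvd card K"
proof -
  interpret K: group "G\<lparr>carrier := K\<rparr>" using K by (rule subgroup_imp_group)
  have "subgroup H (G\<lparr>carrier := K\<rparr>)" using subgroup_incl[OF H K HK] .
  then have "card (rcosets\<^bsub>G\<lparr>carrier := K\<rparr>\<^esub> H) * card H = card K"
    using K.lagrange by (simp add: Coset.order_def)
  then show ?thesis by (metis dvd_triv_right)
qed

text \<open>By Lagrange, \<open>p\<close> is the product of the index of \<open>D\<close> in
  \<open>S\<close> and that of \<open>S\<close> in \<open>C\<close>; the first one is not 1 because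
  of \<open>u\<close>.\<close>

lemma prime_index_maximal:
  assumes fin: "finite (carrier G)" and D: "subgroup D G" and S: "subgroup S G" and C: "subgroup C G"
    and sub: "D \<subseteq> S" "S \<subseteq> C" and card: "card C = p * card D" and p: "Factorial_Ring.prime p"
    and u: "u \<in> S" "u \<notin> D"
  shows "S = C"
proof -
  have finC: "finite C" using C fin finite_subset subgroup.subset by blast
  have D0: "card D > 0"
    using finC sub subgroup.one_closed[OF D] finite_subset[of D C] by (auto simp: card_gt_0_iff)
  obtain a where a: "card S = card D * a" using subgroup_card_dvd[OF fin D S sub(1)] by (auto simp: dvd_def)
  obtain b where b: "card C = card S * b" using subgroup_card_dvd[OF fin S C sub(2)] by (auto simp: dvd_def)
  have "card D * p = card D * (a * b)" using card a b by (metis mult.assoc mult.commute)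
  then have "p = a * b" using D0 by (metis mult_cancel1 neq0_conv)
  moreover have "a \<noteq> 1"
  proof
    assume "a = 1"
    then have "card D = card S" using a by simp
    then have "D = S" using card_subset_eq[of S D] finC sub finite_subset by blast
    then show False using u by blast
  qed
  ultimately have "b = 1" using p by (metis nat_dvd_1_iff_1 dvd_triv_left nat_mult_1_right prime_nat_iff mult_cancel1 not_prime_0 mult_eq_0_iff)
  then have "card S = card C" using b by simp
  then show ?thesis using card_subset_eq finC sub(2) by blast
qed

lemma subgroup_centralizer: assumes h: "h \<in> carrier G" shows "subgroup (centralizer h) G"
proof (rule subgroupI)
  have "\<one> \<in> centralizer h" using h by (simp add: centralizer_def)
  then show "centralizer h \<noteq> {}" by blast
  fix a assume a: "a \<in> centralizer h"
  then have [simp]: "a \<in> carrier G" and ah: "a \<otimes> h = h \<otimes> a" by (auto simp: centralizer_def)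
  have "h = inv a \<otimes> (a \<otimes> h)" using h by (simp add: m_assoc[symmetric])
  also have "\<dots> = inv a \<otimes> h \<otimes> a" unfolding ah using h by (simp add: m_assoc)
  finally have "inv a \<otimes> h = h \<otimes> inv a" using inv_solve_right[of "inv a \<otimes> h" h a] h by simp
  then show "inv a \<in> centralizer h" by (simp add: centralizer_def)
  fix b assume b: "b \<in> centralizer h"
  then have "a \<otimes> b \<otimes> h = a \<otimes> (h \<otimes> b)" using h by (simp add: centralizer_def m_assoc)
  also have "\<dots> = (h \<otimes> a) \<otimes> b" using b h by (simp add: centralizer_def m_assoc[symmetric] ah)
  finally show "a \<otimes> b \<in> centralizer h" using b h by (simp add: centralizer_def m_assoc)
qed (auto simp: centralizer_def)

lemma centralizer_commutes: "g \<in> centralizer h \<Longrightarrow> g \<otimes> h = h \<otimes> g"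
  by (simp add: centralizer_def)

lemma center_carrier: "z \<in> center G \<Longrightarrow> z \<in> carrier G"
  by (simp add: center_def)

lemma center_commutes: "z \<in> center G \<Longrightarrow> g \<in> carrier G \<Longrightarrow> z \<otimes> g = g \<otimes> z"
  by (simp add: center_def)

lemma subgroup_center: "subgroup (center G) G"
proof -
  have "center G = (\<Inter>h\<in>carrier G. centralizer h)"
    by (auto simp: center_def centralizer_def)
  then show ?thesis
    using subgroups_Inter[of "centralizer ` carrier G"] subgroup_centralizer carrier_not_empty by auto
qed

lemma center_conj: "z \<in> center G \<Longrightarrow> g \<in> carrier G \<Longrightarrow> g \<otimes> z \<otimes> inv g = z"
  using center_commutes[of z g] center_carrier[of z] by (metis inv_solve_right m_closed)

text \<open>The equation \<open>u \<otimes> h = h \<otimes> u \<otimes> t\<close> is the working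
  form of \<open>comm G u h = t\<close>. For central \<open>t\<close>, each factor \<open>u\<close>
  moved past \<open>h\<close> contributes one \<open>t\<close>.\<close>

lemma commutation_pow:
  assumes uh: "u \<otimes> h = h \<otimes> u \<otimes> t" and t: "t \<in> center G" and u: "u \<in> carrier G" and h: "h \<in> carrier G"
  shows "u [^] (i::nat) \<otimes> h = h \<otimes> u [^] i \<otimes> t [^] i"
proof (induction i)
  case 0
  then show ?case using h by simp
next
  case (Suc i)
  have tc: "t \<in> carrier G" using t by (rule center_carrier)
  have tu: "t [^] i \<otimes> u = u \<otimes> t [^] i"
    using center_commutes[OF t u] tc u by (metis group_commutes_pow)
  have "u [^] Suc i \<otimes> h = u [^] i \<otimes> (u \<otimes> h)" using u h by (simp add: m_assoc)
  also have "\<dots> = (u [^] i \<otimes> h) \<otimes> (u \<otimes> t)" using u h tc uh by (simp add: m_assoc)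
  also have "\<dots> = h \<otimes> u [^] i \<otimes> (t [^] i \<otimes> u) \<otimes> t" using u h tc Suc by (simp add: m_assoc)
  also have "\<dots> = h \<otimes> u [^] Suc i \<otimes> t [^] Suc i" unfolding tu using u h tc by (simp add: m_assoc)
  finally show ?case .
qed

lemma commutation_mult_pow:
  assumes uh: "u \<otimes> h = h \<otimes> u \<otimes> t" and t: "t \<in> center G" and u: "u \<in> carrier G" and h: "h \<in> carrier G"
    and k: "k \<in> carrier G" and kh: "k \<otimes> h = h \<otimes> k"
  shows "(k \<otimes> u [^] (i::nat)) \<otimes> h = h \<otimes> (k \<otimes> u [^] i) \<otimes> t [^] i"
proof -
  have "(k \<otimes> u [^] i) \<otimes> h = k \<otimes> (h \<otimes> u [^] i \<otimes> t [^] i)"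
    using u h k commutation_pow[OF uh t u h] by (simp add: m_assoc)
  also have "\<dots> = (k \<otimes> h) \<otimes> u [^] i \<otimes> t [^] i"
    using u h k center_carrier[OF t] by (simp add: m_assoc)
  finally show ?thesis unfolding kh using u h k center_carrier[OF t] by (simp add: m_assoc)
qed

lemma commutation_inv:
  assumes "u \<otimes> h = h \<otimes> u \<otimes> t" and t: "t \<in> center G" and u: "u \<in> carrier G" and h: "h \<in> carrier G"
  shows "h \<otimes> u = u \<otimes> h \<otimes> inv t"
proof -
  have "u \<otimes> h \<otimes> inv t = h \<otimes> u \<otimes> (t \<otimes> inv t)"
    using assms center_carrier[OF t] by (simp only: m_assoc m_closed inv_closed)
  then show ?thesis using u h center_carrier[OF t] by simp
qed

text \<open>Moving a new \<open>v\<close> to the left past \<open>w [^] n\<close> costs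
  \<open>t [^] n\<close>; these costs add up to the triangular number in the exponent.\<close>

lemma class2_mult_pow:
  assumes wv: "w \<otimes> v = v \<otimes> w \<otimes> t" and t: "t \<in> center G" and v: "v \<in> carrier G" and w: "w \<in> carrier G"
  shows "(v \<otimes> w) [^] (n::nat) = v [^] n \<otimes> w [^] n \<otimes> t [^] (n * (n - 1) div 2)"
proof (induction n)
  case 0
  then show ?case by simp
next
  case (Suc n)
  have tc: "t \<in> carrier G" using t by (rule center_carrier)
  have tt: "t [^] (i::nat) \<otimes> g = g \<otimes> t [^] i" if "g \<in> carrier G" for g i
    using center_commutes[OF t that] tc that by (metis group_commutes_pow)
  have tri: "Suc n * (Suc n - 1) div 2 = n + n * (n - 1) div 2"
    by (cases n) (simp_all add: algebra_simps)
  have "(v \<otimes> w) [^] Suc n = v [^] n \<otimes> w [^] n \<otimes> (t [^] (n * (n - 1) div 2) \<otimes> (v \<otimes> w))"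
    using Suc v w tc by (simp add: m_assoc)
  also have "\<dots> = v [^] n \<otimes> (w [^] n \<otimes> v) \<otimes> w \<otimes> t [^] (n * (n - 1) div 2)"
    using v w tc by (subst tt) (simp_all add: m_assoc)
  also have "\<dots> = v [^] n \<otimes> v \<otimes> w [^] n \<otimes> (t [^] n \<otimes> w) \<otimes> t [^] (n * (n - 1) div 2)"
    unfolding commutation_pow[OF wv t w v] using v w tc by (simp add: m_assoc)
  also have "\<dots> = v [^] Suc n \<otimes> w [^] Suc n \<otimes> t [^] (n + n * (n - 1) div 2)"
    unfolding tt[OF w] using v w tc by (simp add: m_assoc nat_pow_mult)
  finally show ?case unfolding tri .
qed

lemma prime_order_generator:
  assumes fin: "finite (carrier G)" and S: "subgroup S G" and p: "Factorial_Ring.prime p" and card: "card S = p"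
    and t: "t \<in> S" "t \<noteq> \<one>"
  shows "S = adj {\<one>} t" and "t [^] p = \<one>"
proof -
  have tc: "t \<in> carrier G" using S t(1) by (rule subgroup.mem_carrier)
  have one: "subgroup {\<one>} G" by (rule triv_subgroup)
  have "t [^] card S = \<one>"
  proof -
    interpret S: group "G\<lparr>carrier := S\<rparr>" using S by (rule subgroup_imp_group)
    have "t [^]\<^bsub>G\<lparr>carrier := S\<rparr>\<^esub> (Coset.order (G\<lparr>carrier := S\<rparr>)) = \<one>"
      using S.pow_order_eq_1[of t] t by simp
    then show ?thesis using nat_pow_consistent[of t _ S] by (simp add: Coset.order_def)
  qed
  then show tp: "t [^] p = \<one>" using card by simp
  have "card (adj {\<one>} t) = p"
    using card_adj[OF one tc p] tp t by simp
  moreover have "adj {\<one>} t \<subseteq> S"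
    using adj_subset[OF S _ t(1), of "{\<one>}"] subgroup.one_closed[OF S] by simp
  moreover have "finite S" using S fin finite_subset subgroup.subset by blast
  ultimately show "S = adj {\<one>} t" using card card_subset_eq by metis
qed

text \<open>The inverse of \<open>a\<close> is a power of the generator \<open>t\<close>. This
  supplies the exponents that later cancel \<open>p\<close>-th powers or commutators.\<close>

lemma prime_order_solve:
  assumes fin: "finite (carrier G)" and S: "subgroup S G" and p: "Factorial_Ring.prime p" and card: "card S = p"
    and a: "a \<in> S" and t: "t \<in> S" "t \<noteq> \<one>"
  obtains m :: nat where "a \<otimes> t [^] m = \<one>"
proof -
  have "inv a \<in> adj {\<one>} t"
    using prime_order_generator(1)[OF fin S p card t] a S subgroup.m_inv_closed by metis
  then obtain m :: nat where "inv a = \<one> \<otimes> t [^] m" by (auto simp: adj_def)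
  then have "a \<otimes> t [^] m = a \<otimes> inv a" using S t subgroup.mem_carrier by fastforce
  then show ?thesis using that a S subgroup.mem_carrier by fastforce
qed

lemma prime_order_pow_neq_one:
  assumes fin: "finite (carrier G)" and S: "subgroup S G" and p: "Factorial_Ring.prime p" and card: "card S = p"
    and t: "t \<in> S" "t \<noteq> \<one>" and i: "0 < i" "i < p"
  shows "t [^] (i::nat) \<noteq> \<one>"
  using nat_pow_in_prime[OF triv_subgroup subgroup.mem_carrier[OF S t(1)] p, of i]
    prime_order_generator(2)[OF assms(1-6)] t i by auto

end

section \<open>Groups and quotients of order $p^3$\<close>

text \<open>The center is exactly <c>, which gives the second claim, since all commutators are
  powers of \<open>c\<close>. For the first claim, if \<open>u [^] p\<close> is nontrivial it
  generates the center, and a suitable power of \<open>u\<close> multiplied to \<open>v\<close>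
  cancels \<open>v [^] p\<close>.\<close>

lemma (in group) order_p3:
  assumes fin: "finite (carrier G)" and p: "Factorial_Ring.prime p" and odd: "odd p"
    and card: "card (carrier G) = p ^ 3"
    and c: "c \<in> center G" "c \<noteq> \<one>" "c [^] p = \<one>"
    and comm: "\<And>g h. g \<in> carrier G \<Longrightarrow> h \<in> carrier G \<Longrightarrow> \<exists>k::nat. g \<otimes> h = h \<otimes> g \<otimes> c [^] k"
    and uv: "u \<in> carrier G" "v \<in> carrier G" "u \<otimes> v \<noteq> v \<otimes> u"
  shows "\<exists>y \<in> carrier G. y [^] p = \<one> \<and> y \<notin> adj {\<one>} c"
    and "g \<in> carrier G \<Longrightarrow> g \<notin> adj {\<one>} c \<Longrightarrow>
      \<exists>h \<in> carrier G. \<exists>i. 0 < i \<and> i < p \<and> g \<otimes> h = h \<otimes> g \<otimes> c [^] i"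
proof -
  have cc: "c \<in> carrier G" using c(1) by (rule center_carrier)
  have one: "subgroup {\<one>} G" by (rule triv_subgroup)
  have C: "subgroup (adj {\<one>} c) G"
    using cc by (intro subgroup_adj[OF fin one cc]) simp
  have cardC: "card (adj {\<one>} c) = p" using card_adj[OF one cc p] c by simp
  have Z: "subgroup (center G) G" by (rule subgroup_center)
  have CZ: "adj {\<one>} c \<subseteq> center G"
    using subgroup.one_closed[OF Z] by (intro adj_subset[OF Z _ c(1)]) simp
  have finZ: "finite (center G)" using fin Z finite_subset subgroup.subset by blast
  have center_eq: "center G = adj {\<one>} c"
  proof -
    have "card (center G) dvd p ^ 3"
      using subgroup_card_dvd[OF fin Z subgroup_self] card subgroup.subset[OF Z] by simp
    then obtain a where a: "a \<le> 3" "card (center G) = p ^ a"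
      using p by (metis divides_primepow_nat)
    have "a \<noteq> 3"
    proof
      assume "a = 3"
      then have "center G = carrier G" using a card fin subgroup.subset[OF Z] by (simp add: card_subset_eq)
      then show False using uv center_commutes by blast
    qed
    \<comment> \<open>A center of index \<open>p\<close> would be properly contained in the
      centralizer of \<open>u\<close>, which would then be the whole group.\<close>
    moreover have "a \<noteq> 2"
    proof
      assume "a = 2"
      then have "card (carrier G) = p * card (center G)" using a card by (simp add: power_numeral_reduce)
      moreover have "center G \<subseteq> centralizer u" using uv by (auto simp: center_def centralizer_def)
      moreover have "u \<notin> center G" using uv center_commutes by blast
      moreover have "u \<in> centralizer u" using uv by (simp add: centralizer_def)
      ultimately have "centralizer u = carrier G"
        using prime_index_maximal[OF fin Z subgroup_centralizer[OF uv(1)] subgroup_self _ _ _ p]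
          subgroup.subset[OF subgroup_centralizer[OF uv(1)]] by blast
      then have "v \<in> centralizer u" using uv by simp
      then show False using uv by (simp add: centralizer_def)
    qed
    ultimately have "a \<le> 1" using a by simp
    then have "card (center G) \<le> p" using a prime_gt_0_nat[OF p] by (cases a) auto
    then show ?thesis using CZ cardC finZ by (metis card_seteq)
  qed
  show "\<exists>h \<in> carrier G. \<exists>i. 0 < i \<and> i < p \<and> g \<otimes> h = h \<otimes> g \<otimes> c [^] i"
    if g: "g \<in> carrier G" "g \<notin> adj {\<one>} c" for g
  proof -
    have "g \<notin> center G" using g center_eq by simp
    then obtain h where h: "h \<in> carrier G" "g \<otimes> h \<noteq> h \<otimes> g" using g by (auto simp: center_def)
    obtain k :: nat where k: "g \<otimes> h = h \<otimes> g \<otimes> c [^] k" using comm g h by blast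
    have "c [^] k \<in> adj {\<one>} c" using adj_memI[of \<one> "{\<one>}" c k] cc by simp
    then obtain l i where i: "l \<in> {\<one>}" "i < p" "c [^] k = l \<otimes> c [^] (i::nat)"
      using adj_cases[OF one cc _ prime_gt_0_nat[OF p]] c by blast
    then have eq: "g \<otimes> h = h \<otimes> g \<otimes> c [^] i" using k cc by simp
    moreover have "i \<noteq> 0" using eq h g by (cases "i = 0") auto
    ultimately show ?thesis using i h by blast
  qed
  \<comment> \<open>The commutator of \<open>g [^] p\<close> with \<open>h\<close> is the
    \<open>p\<close>-th power of a power of \<open>c\<close>, hence trivial.\<close>
  have pow_central: "g [^] p \<in> adj {\<one>} c" if g: "g \<in> carrier G" for g
  proof -
    have "g [^] p \<otimes> h = h \<otimes> g [^] p" if h: "h \<in> carrier G" for h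
    proof -
      obtain k :: nat where k: "g \<otimes> h = h \<otimes> g \<otimes> c [^] k" using comm g h by blast
      have "(c [^] k) [^] p = (c [^] p) [^] k" using cc by (simp add: nat_pow_pow mult.commute)
      then show ?thesis
        using commutation_pow[OF k _ g h, of p] subgroup_nat_pow[OF Z c(1)] g h c by simp
    qed
    then show ?thesis unfolding center_eq[symmetric] using g by (simp add: center_def)
  qed
  have notin: "g \<notin> adj {\<one>} c" if "g \<in> carrier G" "h \<in> carrier G" "g \<otimes> h \<noteq> h \<otimes> g" for g h
    using that unfolding center_eq[symmetric] by (auto simp: center_def)
  show "\<exists>y \<in> carrier G. y [^] p = \<one> \<and> y \<notin> adj {\<one>} c"
  proof (cases "u [^] p = \<one>")
    case True
    then show ?thesis using notin uv by blast
  next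
    case False
    obtain m :: nat where m: "v [^] p \<otimes> (u [^] p) [^] m = \<one>"
      using prime_order_solve[OF fin C p cardC pow_central[OF uv(2)] pow_central[OF uv(1)] False] by blast
    let ?w = "u [^] m"
    have w: "?w \<in> carrier G" using uv by simp
    obtain k :: nat where k: "?w \<otimes> v = v \<otimes> ?w \<otimes> c [^] k" using comm w uv by blast
    \<comment> \<open>This is where \<open>p\<close> must be odd: \<open>p * (p - 1) div 2\<close>
      is a multiple of \<open>p\<close>, so the commutator term in the \<open>p\<close>-th power of
      the product disappears.\<close>
    obtain q where q0: "p = 2 * q + 1" using odd by (rule oddE)
    have "p * (p - 1) = 2 * (p * q)" by (simp add: q0)
    then have q: "p * (p - 1) div 2 = p * q" by (simp only: nonzero_mult_div_cancel_left[OF zero_neq_numeral[symmetric]])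
    have ck: "(c [^] k) [^] (p * q) = \<one>"
    proof -
      have "(c [^] k) [^] (p * q) = (c [^] p) [^] (k * q)" using cc by (simp add: nat_pow_pow ac_simps)
      then show ?thesis using c by simp
    qed
    have "(v \<otimes> ?w) [^] p = v [^] p \<otimes> ?w [^] p \<otimes> (c [^] k) [^] (p * (p - 1) div 2)"
      by (rule class2_mult_pow[OF k subgroup_nat_pow[OF Z c(1)] uv(2) w])
    also have "?w [^] p = (u [^] p) [^] m" using uv by (simp add: nat_pow_pow mult.commute)
    also have "v [^] p \<otimes> (u [^] p) [^] m \<otimes> (c [^] k) [^] (p * (p - 1) div 2) = \<one>"
      unfolding m q ck by simp
    finally have pow: "(v \<otimes> ?w) [^] p = \<one>" .
    \<comment> \<open>\<open>?w\<close> commutes with \<open>u\<close>, being a power of it, while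
      \<open>v\<close> does not; so the product is noncentral.\<close>
    have "v \<otimes> ?w \<notin> adj {\<one>} c"
    proof (rule notin)
      show "v \<otimes> ?w \<in> carrier G" using uv by simp
      show "u \<in> carrier G" by fact
      show "v \<otimes> ?w \<otimes> u \<noteq> u \<otimes> (v \<otimes> ?w)"
      proof
        assume eq: "v \<otimes> ?w \<otimes> u = u \<otimes> (v \<otimes> ?w)"
        have "?w \<otimes> u = u \<otimes> ?w" using uv by (metis nat_pow_Suc nat_pow_Suc2)
        then have "(v \<otimes> u) \<otimes> ?w = (u \<otimes> v) \<otimes> ?w" using eq uv by (simp add: m_assoc)
        then have "v \<otimes> u = u \<otimes> v" using uv by simp
        then show False using uv by simp
      qed
    qed
    then show ?thesis using pow uv w by (intro bexI[of _ "v \<otimes> ?w"]) simp_all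
  qed
qed

context group
begin

lemma coset_hom_pow:
  assumes N: "N \<lhd> G" and g: "g \<in> carrier G"
  shows "N #> g [^] (i::nat) = (N #> g) [^]\<^bsub>G Mod N\<^esub> i"
proof (induction i)
  case 0
  show ?case using coset_mult_one[OF subgroup.subset[OF normal_imp_subgroup[OF N]]] by simp
next
  case (Suc i)
  have "N #> g [^] Suc i = (N #> g [^] i) <#> (N #> g)"
    using normal.rcos_sum[OF N nat_pow_closed[OF g] g] by simp
  then show ?case using Suc by simp
qed

lemma coset_eq_iff:
  assumes "subgroup N G" "a \<in> carrier G" "b \<in> carrier G"
  shows "N #> a = N #> b \<longleftrightarrow> a \<otimes> inv b \<in> N"
proof -
  have "a \<otimes> inv b \<in> N \<longleftrightarrow> a \<in> N #> b"
    using assms subgroup.rcos_module[OF assms(1) is_group] by blast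
  also have "\<dots> \<longleftrightarrow> N #> b = N #> a"
    using assms repr_independence[OF _ _ assms(1)] repr_independenceD[OF assms(1)] rcos_self[OF _ assms(1)] by metis
  finally show ?thesis by auto
qed

lemma coset_absorb:
  assumes N: "subgroup N G" and n: "n \<in> N" and "a \<in> carrier G" and z: "n \<in> center G"
  shows "N #> (a \<otimes> n) = N #> a"
proof -
  have "a \<otimes> n \<otimes> inv a = n" using center_conj assms by blast
  then show ?thesis using assms coset_eq_iff[OF N, of "a \<otimes> n" a] center_carrier[OF z] by simp
qed

text \<open>Transfer of \<open>order_p3\<close> to \<open>G Mod N\<close>, with everything given by
  representatives: equations in the quotient become equalities of cosets in
  \<open>G\<close>.\<close>

lemma quotient_order_p3:
  assumes fin: "finite (carrier G)" and p: "Factorial_Ring.prime p" and odd: "odd p"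
    and N: "N \<lhd> G" and card: "card (carrier G) = p ^ 3 * card N"
    and c: "c \<in> carrier G" "c \<notin> N" "c [^] p \<in> N"
    and central: "\<forall>g\<in>carrier G. N #> (c \<otimes> g) = N #> (g \<otimes> c)"
    and comm: "\<forall>g\<in>carrier G. \<forall>h\<in>carrier G. \<exists>k::nat. N #> (g \<otimes> h) = N #> (h \<otimes> g \<otimes> c [^] k)"
    and uv: "u \<in> carrier G" "v \<in> carrier G" "N #> (u \<otimes> v) \<noteq> N #> (v \<otimes> u)"
  defines "Q \<equiv> G Mod N"
  shows "\<exists>Y \<in> carrier Q. Y [^]\<^bsub>Q\<^esub> p = \<one>\<^bsub>Q\<^esub> \<and> Y \<notin> group.adj Q {\<one>\<^bsub>Q\<^esub>} (N #> c)"
    and "W \<in> carrier Q \<Longrightarrow> W \<notin> group.adj Q {\<one>\<^bsub>Q\<^esub>} (N #> c) \<Longrightarrow>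
      \<exists>H \<in> carrier Q. \<exists>i. 0 < i \<and> i < p \<and> W \<otimes>\<^bsub>Q\<^esub> H = H \<otimes>\<^bsub>Q\<^esub> W \<otimes>\<^bsub>Q\<^esub> (N #> c) [^]\<^bsub>Q\<^esub> i"
    and "N #> c \<in> center Q" "(N #> c) [^]\<^bsub>Q\<^esub> p = \<one>\<^bsub>Q\<^esub>" "N #> c \<noteq> \<one>\<^bsub>Q\<^esub>" "card (carrier Q) = p ^ 3" "finite (carrier Q)"
proof -
  have sub: "subgroup N G" using N by (rule normal_imp_subgroup)
  interpret Q: group Q unfolding Q_def using N by (rule normal.factorgroup_is_group)
  have carQ: "carrier Q = (\<lambda>g. N #> g) ` carrier G" by (simp add: Q_def carrier_FactGroup)
  show finQ: "finite (carrier Q)" using fin by (simp add: carQ)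
  have mult: "(N #> g) \<otimes>\<^bsub>Q\<^esub> (N #> h) = N #> (g \<otimes> h)" if "g \<in> carrier G" "h \<in> carrier G" for g h
    using normal.rcos_sum[OF N that] by (simp add: Q_def)
  have pow: "(N #> g) [^]\<^bsub>Q\<^esub> (i::nat) = N #> g [^] i" if "g \<in> carrier G" for g i
    using coset_hom_pow[OF N that] by (simp add: Q_def)
  have one: "\<one>\<^bsub>Q\<^esub> = N" by (simp add: Q_def)
  have coset_N: "N #> g = N \<longleftrightarrow> g \<in> N" if "g \<in> carrier G" for g
    using that sub coset_join1[of N g] coset_join2[of g N] subgroup.subset by blast
  show cardQ: "card (carrier Q) = p ^ 3"
  proof -
    have "card (rcosets N) * card N = p ^ 3 * card N"
      using lagrange[OF sub] card by (simp add: Coset.order_def)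
    moreover have "card N > 0"
      using subgroup.one_closed[OF sub] subgroup.subset[OF sub] fin by (metis card_gt_0_iff empty_iff finite_subset)
    ultimately show ?thesis by (simp add: Q_def FactGroup_def)
  qed
  show cQ: "N #> c \<in> center Q"
    using c central by (auto simp: center_def carQ mult)
  show cp: "(N #> c) [^]\<^bsub>Q\<^esub> p = \<one>\<^bsub>Q\<^esub>" using c by (simp add: pow one coset_N)
  show c1: "N #> c \<noteq> \<one>\<^bsub>Q\<^esub>" using c by (simp add: one coset_N)
  have commQ: "\<exists>k::nat. g \<otimes>\<^bsub>Q\<^esub> h = h \<otimes>\<^bsub>Q\<^esub> g \<otimes>\<^bsub>Q\<^esub> (N #> c) [^]\<^bsub>Q\<^esub> k"
    if gh: "g \<in> carrier Q" "h \<in> carrier Q" for g h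
  proof -
    obtain a b where ab: "a \<in> carrier G" "g = N #> a" "b \<in> carrier G" "h = N #> b" using gh by (auto simp: carQ)
    obtain k :: nat where "N #> (a \<otimes> b) = N #> (b \<otimes> a \<otimes> c [^] k)" using comm ab by blast
    then show ?thesis using ab c by (intro exI[of _ k]) (simp add: mult pow)
  qed
  have UV: "N #> u \<in> carrier Q" "N #> v \<in> carrier Q" "(N #> u) \<otimes>\<^bsub>Q\<^esub> (N #> v) \<noteq> (N #> v) \<otimes>\<^bsub>Q\<^esub> (N #> u)"
    using uv by (simp_all add: carQ mult)
  show "\<exists>Y \<in> carrier Q. Y [^]\<^bsub>Q\<^esub> p = \<one>\<^bsub>Q\<^esub> \<and> Y \<notin> group.adj Q {\<one>\<^bsub>Q\<^esub>} (N #> c)"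
    by (rule Q.order_p3(1)[OF finQ p odd cardQ cQ c1 cp commQ UV])
  show "\<exists>H \<in> carrier Q. \<exists>i. 0 < i \<and> i < p \<and> W \<otimes>\<^bsub>Q\<^esub> H = H \<otimes>\<^bsub>Q\<^esub> W \<otimes>\<^bsub>Q\<^esub> (N #> c) [^]\<^bsub>Q\<^esub> i"
    if "W \<in> carrier Q" "W \<notin> group.adj Q {\<one>\<^bsub>Q\<^esub>} (N #> c)"
    by (rule Q.order_p3(2)[OF finQ p odd cardQ cQ c1 cp commQ UV that])
qed

end

text \<open>In the quotient, \<open>B\<close> is generated by the noncentral \<open>Y\<close> of
  order \<open>p\<close> found in \<open>order_p3\<close>, which leaves index \<open>p\<close>; the
  induced representation is then inflated to \<open>G\<close>. Inflation sees \<open>f\<close> only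
  through its sums over cosets of \<open>N\<close>, and the kernel condition is about these
  sums.\<close>

lemma (in group) quotient_representation:
  assumes fin: "finite (carrier G)" and p: "Factorial_Ring.prime p" and odd: "odd p"
    and root: "primitive_root_of_unity p \<zeta>"
    and N: "N \<lhd> G" and card: "card (carrier G) = p ^ 3 * card N"
    and c: "c \<in> carrier G" "c \<notin> N" "c [^] p \<in> N"
    and central: "\<And>g. g \<in> carrier G \<Longrightarrow> N #> (c \<otimes> g) = N #> (g \<otimes> c)"
    and comm: "\<And>g h. g \<in> carrier G \<Longrightarrow> h \<in> carrier G \<Longrightarrow> \<exists>k::nat. N #> (g \<otimes> h) = N #> (h \<otimes> g \<otimes> c [^] k)"
    and uv: "u \<in> carrier G" "v \<in> carrier G" "N #> (u \<otimes> v) \<noteq> N #> (v \<otimes> u)"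
  obtains M where "matrix_rep G p (rat_adjoin \<zeta>) M"
    and "\<And>f. (\<And>s t. s < p \<Longrightarrow> t < p \<Longrightarrow> (\<Sum>g\<in>carrier G. of_rat (f g) * M g s t) = 0) \<Longrightarrow>
      (\<And>g. g \<in> carrier G \<Longrightarrow> (\<Sum>x\<in>N #> (c \<otimes> g). f x) = (\<Sum>x\<in>N #> g. f x))"
proof -
  define Q where "Q = G Mod N"
  have central': "\<forall>g\<in>carrier G. N #> (c \<otimes> g) = N #> (g \<otimes> c)"
    and comm': "\<forall>g\<in>carrier G. \<forall>h\<in>carrier G. \<exists>k::nat. N #> (g \<otimes> h) = N #> (h \<otimes> g \<otimes> c [^] k)"
    using central comm by blast+
  note Qfacts = quotient_order_p3[OF fin p odd N card c central' comm' uv, folded Q_def]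
  have sub: "subgroup N G" using N by (rule normal_imp_subgroup)
  interpret Q: group Q unfolding Q_def using N by (rule normal.factorgroup_is_group)
  have carQ: "carrier Q = (\<lambda>g. N #> g) ` carrier G" by (simp add: Q_def carrier_FactGroup)
  have mult: "(N #> g) \<otimes>\<^bsub>Q\<^esub> (N #> h) = N #> (g \<otimes> h)" if "g \<in> carrier G" "h \<in> carrier G" for g h
    using normal.rcos_sum[OF N that] by (simp add: Q_def)
  have oneQ: "\<one>\<^bsub>Q\<^esub> = N #> \<one>"
    using coset_mult_one[OF subgroup.subset[OF sub]] by (simp add: Q_def)
  let ?c = "N #> c"
  have cc: "?c \<in> carrier Q" using Qfacts(3) by (rule Q.center_carrier)
  obtain Y where Y: "Y \<in> carrier Q" "Y [^]\<^bsub>Q\<^esub> p = \<one>\<^bsub>Q\<^esub>" "Y \<notin> Q.adj {\<one>\<^bsub>Q\<^esub>} ?c"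
    using Qfacts(1) by blast
  have one: "subgroup {\<one>\<^bsub>Q\<^esub>} Q" by (rule Q.triv_subgroup)
  have one_c: "\<one>\<^bsub>Q\<^esub> \<in> Q.adj {\<one>\<^bsub>Q\<^esub>} ?c" using Q.adj_base[OF one cc] by simp
  have Y1: "Y \<noteq> \<one>\<^bsub>Q\<^esub>" using Y(3) one_c by auto
  have sY: "subgroup (Q.adj {\<one>\<^bsub>Q\<^esub>} Y) Q"
    using Y(1) by (intro Q.subgroup_adj[OF Qfacts(7) one]) auto
  have sc: "subgroup (Q.adj {\<one>\<^bsub>Q\<^esub>} ?c) Q"
    using cc by (intro Q.subgroup_adj[OF Qfacts(7) one]) auto
  have "induction_data Q p p ?c (Q.adj {\<one>\<^bsub>Q\<^esub>} Y) \<zeta>"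
  proof (intro induction_data.intro induction_data_axioms.intro)
    show "group Q" by (rule Q.is_group)
    show "finite (carrier Q)" by (rule Qfacts(7))
    show "Factorial_Ring.prime p" "primitive_root_of_unity p \<zeta>" by fact+
    show "?c \<in> carrier Q" "?c [^]\<^bsub>Q\<^esub> p = \<one>\<^bsub>Q\<^esub>" using cc Qfacts(4) by auto
    show "g \<otimes>\<^bsub>Q\<^esub> ?c = ?c \<otimes>\<^bsub>Q\<^esub> g" if "g \<in> carrier Q" for g
      using Q.center_commutes[OF Qfacts(3) that] by simp
    show "subgroup (Q.adj {\<one>\<^bsub>Q\<^esub>} Y) Q" by (rule sY)
    show "card (carrier Q) = p * p * card (Q.adj {\<one>\<^bsub>Q\<^esub>} Y)"
      using Q.card_adj[OF one Y(1) p] Y(2) Y1 Qfacts(6) by (simp add: power3_eq_cube)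
    \<comment> \<open>A nontrivial power of \<open>Y\<close> that is a power of \<open>?c\<close>
      would put \<open>Y\<close> itself into <?c>, against the choice of \<open>Y\<close>; and a
      trivial power of \<open>?c\<close> with exponent between 0 and \<open>p\<close> would make
      \<open>?c\<close> trivial.\<close>
    show "?c [^]\<^bsub>Q\<^esub> i \<notin> Q.adj {\<one>\<^bsub>Q\<^esub>} Y" if i: "0 < i" "i < p" for i
    proof
      assume "?c [^]\<^bsub>Q\<^esub> i \<in> Q.adj {\<one>\<^bsub>Q\<^esub>} Y"
      then obtain l j where j: "l \<in> {\<one>\<^bsub>Q\<^esub>}" "j < p" "?c [^]\<^bsub>Q\<^esub> i = l \<otimes>\<^bsub>Q\<^esub> Y [^]\<^bsub>Q\<^esub> (j::nat)"
        using Q.adj_cases[OF one Y(1) _ prime_gt_0_nat[OF p]] Y(2) by blast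
      then have eq: "?c [^]\<^bsub>Q\<^esub> i = Y [^]\<^bsub>Q\<^esub> j" using Y(1) by simp
      show False
      proof (cases "j = 0")
        case True
        then have "?c [^]\<^bsub>Q\<^esub> i \<in> {\<one>\<^bsub>Q\<^esub>}" using eq by simp
        then show False using Q.nat_pow_in_prime[OF one cc p, of i] Qfacts(4,5) i by simp
      next
        case False
        have "Y [^]\<^bsub>Q\<^esub> j \<in> Q.adj {\<one>\<^bsub>Q\<^esub>} ?c"
          unfolding eq[symmetric] using Q.subgroup_nat_pow[OF sc Q.adj_self[OF one cc]] .
        then show False using Q.nat_pow_in_prime[OF sc Y(1) p, of j] Y j False one_c by simp
      qed
    qed
    show "\<exists>h\<in>carrier Q. \<exists>i>0. i < p \<and> inv\<^bsub>Q\<^esub> h \<otimes>\<^bsub>Q\<^esub> (g \<otimes>\<^bsub>Q\<^esub> h) = g \<otimes>\<^bsub>Q\<^esub> ?c [^]\<^bsub>Q\<^esub> i"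
      if g: "g \<in> carrier Q" and off: "\<And>i. i < p \<Longrightarrow> g \<noteq> ?c [^]\<^bsub>Q\<^esub> i" for g
    proof -
      have "g \<notin> Q.adj {\<one>\<^bsub>Q\<^esub>} ?c"
      proof
        assume "g \<in> Q.adj {\<one>\<^bsub>Q\<^esub>} ?c"
        then obtain l j where "l \<in> {\<one>\<^bsub>Q\<^esub>}" "j < p" "g = l \<otimes>\<^bsub>Q\<^esub> ?c [^]\<^bsub>Q\<^esub> (j::nat)"
          using Q.adj_cases[OF one cc _ prime_gt_0_nat[OF p]] Qfacts(4) by blast
        then show False using off cc by simp
      qed
      then obtain h i where h: "h \<in> carrier Q" "0 < i" "i < p"
        "g \<otimes>\<^bsub>Q\<^esub> h = h \<otimes>\<^bsub>Q\<^esub> g \<otimes>\<^bsub>Q\<^esub> ?c [^]\<^bsub>Q\<^esub> i"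
        using Qfacts(2)[OF g] by blast
      then have "inv\<^bsub>Q\<^esub> h \<otimes>\<^bsub>Q\<^esub> (g \<otimes>\<^bsub>Q\<^esub> h) = g \<otimes>\<^bsub>Q\<^esub> ?c [^]\<^bsub>Q\<^esub> i"
        using g cc by (simp add: Q.m_assoc[symmetric])
      then show ?thesis using h by blast
    qed
  qed
  then interpret I: induction_data Q p p ?c "Q.adj {\<one>\<^bsub>Q\<^esub>} Y" \<zeta> .
  have "\<exists>R. matrix_rep Q p (rat_adjoin \<zeta>) R \<and>
      (\<forall>f. (\<forall>s<p. \<forall>t<p. (\<Sum>g\<in>carrier Q. of_rat (f g) * R g s t) = 0) \<longrightarrow>
        (\<forall>g\<in>carrier Q. f (?c \<otimes>\<^bsub>Q\<^esub> g) = f g))"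
    by (rule I.induced_representation, rule exI, rule conjI, assumption) blast
  then obtain R where R: "matrix_rep Q p (rat_adjoin \<zeta>) R"
    and ker: "\<forall>f. (\<forall>s<p. \<forall>t<p. (\<Sum>g\<in>carrier Q. of_rat (f g) * R g s t) = 0) \<longrightarrow>
        (\<forall>g\<in>carrier Q. f (?c \<otimes>\<^bsub>Q\<^esub> g) = f g)"
    by (elim exE conjE)
  have rep: "matrix_rep G p (rat_adjoin \<zeta>) (\<lambda>g. R (N #> g))"
    using R unfolding matrix_rep_def
    by (simp add: carQ mult[symmetric] oneQ)
  have ker': "(\<Sum>x\<in>N #> (c \<otimes> g). f x) = (\<Sum>x\<in>N #> g. f x)"
    if zero: "\<And>s t. s < p \<Longrightarrow> t < p \<Longrightarrow> (\<Sum>g\<in>carrier G. of_rat (f g) * R (N #> g) s t) = 0"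
      and g: "g \<in> carrier G" for f g
  proof -
    have "(\<Sum>W\<in>carrier Q. of_rat (\<Sum>x\<in>W. f x) * R W s t) = 0" if "s < p" "t < p" for s t
    proof -
      have fiber: "{g \<in> carrier G. N #> g = W} = W" if W: "W \<in> carrier Q" for W
      proof -
        obtain h where h: "h \<in> carrier G" "W = N #> h" using W by (auto simp: carQ)
        have "g \<in> N #> h \<Longrightarrow> g \<in> carrier G" for g
          using r_coset_subset_G[OF subgroup.subset[OF sub] h(1)] by blast
        then show ?thesis
          unfolding h(2) using repr_independence[OF _ h(1) sub] rcos_self[OF _ sub] by blast
      qed
      have "(\<Sum>g\<in>carrier G. of_rat (f g) * R (N #> g) s t) =
          (\<Sum>W\<in>carrier Q. \<Sum>g\<in>{g \<in> carrier G. N #> g = W}. of_rat (f g) * R (N #> g) s t)"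
        using fin Qfacts(7) by (intro sum.group[symmetric]) (auto simp: carQ)
      also have "\<dots> = (\<Sum>W\<in>carrier Q. \<Sum>g\<in>{g \<in> carrier G. N #> g = W}. of_rat (f g) * R W s t)"
        by (intro sum.cong) auto
      also have "\<dots> = (\<Sum>W\<in>carrier Q. of_rat (\<Sum>x\<in>W. f x) * R W s t)"
        by (intro sum.cong HOL.refl) (simp add: fiber of_rat_sum sum_distrib_right)
      finally show ?thesis using zero[OF that] by simp
    qed
    then have "\<forall>g\<in>carrier Q. (\<lambda>W. \<Sum>x\<in>W. f x) (?c \<otimes>\<^bsub>Q\<^esub> g) = (\<lambda>W. \<Sum>x\<in>W. f x) g"
      using ker by blast
    then show ?thesis using g c(1) by (simp add: mult carQ)
  qed
  have "\<exists>M. matrix_rep G p (rat_adjoin \<zeta>) M \<and>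
      (\<forall>f. (\<forall>s<p. \<forall>t<p. (\<Sum>g\<in>carrier G. of_rat (f g) * M g s t) = 0) \<longrightarrow>
        (\<forall>g\<in>carrier G. (\<Sum>x\<in>N #> (c \<otimes> g). f x) = (\<Sum>x\<in>N #> g. f x)))"
    using rep ker' by (intro exI[of _ "\<lambda>g. R (N #> g)"]) blast
  then show ?thesis using that by blast
qed

section \<open>The common structure of the two families\<close>

lemma periodic_shift_sum:
  fixes h :: "nat \<Rightarrow> 'c :: cancel_comm_monoid_add"
  assumes "\<And>b. h (b + p) = h b"
  shows "(\<Sum>b<p. h (a + b)) = (\<Sum>b<p. h b)"
proof (induction a)
  case (Suc a)
  have "(\<Sum>b<p. h (Suc a + b)) + h a = (\<Sum>b<Suc p. h (a + b))"
    by (subst sum.lessThan_Suc_shift) (simp add: add.commute)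
  also have "\<dots> = (\<Sum>b<p. h (a + b)) + h a" using assms[of a] by simp
  finally show ?case using Suc by simp
qed simp

text \<open>An affine plane argument: the lines \<open>b = i j + b\<^sub>0\<close> of each slope and the vertical lines have sum zero,
  so the sum over the lines through a point counts that point \<open>p\<close> times.\<close>

lemma affine_plane_zero:
  fixes h :: "nat \<Rightarrow> nat \<Rightarrow> rat"
  assumes p: "Factorial_Ring.prime p"
    and per: "\<And>j b. h j (b + p) = h j b"
    and vert: "\<And>j. (\<Sum>b<p. h j b) = 0"
    and slope: "\<And>i b. i < p \<Longrightarrow> (\<Sum>j<p. h j (i * j + Suc b)) = (\<Sum>j<p. h j (i * j + b))"
  shows "h 0 0 = 0"
proof -
  have p0: "0 < p" using p by (rule prime_gt_0_nat)
  have per_mult: "h j (b + k * p) = h j b" for j b k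
  proof (induction k)
    case (Suc k)
    have "h j (b + Suc k * p) = h j ((b + k * p) + p)" by (simp add: algebra_simps)
    then show ?case using per Suc by simp
  qed simp
  have per_mod: "h j (b mod p) = h j b" for j b
    using per_mult[of j "b mod p" "b div p"] by simp
  \<comment> \<open>Parallel lines have equal sums by \<open>slope\<close>, and the \<open>p\<close>
    sums of one direction add up to the sum over the whole plane, which is 0 by
    \<open>vert\<close>.\<close>
  have line: "(\<Sum>j<p. h j (i * j)) = 0" if i: "i < p" for i
  proof -
    have const: "(\<Sum>j<p. h j (i * j + b)) = (\<Sum>j<p. h j (i * j))" for b
    proof (induction b)
      case (Suc b)
      then show ?case using slope[OF i, of b] by simp
    qed simp
    have "of_nat p * (\<Sum>j<p. h j (i * j)) = (\<Sum>b<p. \<Sum>j<p. h j (i * j + b))"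
      unfolding const by simp
    also have "\<dots> = (\<Sum>j<p. \<Sum>b<p. h j (i * j + b))" by (rule sum.swap)
    also have "\<dots> = 0" using periodic_shift_sum[of "h _" p] per vert by simp
    finally show ?thesis using p0 by simp
  qed
  \<comment> \<open>For \<open>j\<close> prime to \<open>p\<close>, multiplication by
    \<open>j\<close> permutes the residues, so the lines through the origin meet column
    \<open>j\<close> once in every point, and the column sum is 0.\<close>
  have perm: "(\<Sum>i<p. h j (i * j)) = 0" if j: "0 < j" "j < p" for j
  proof -
    have "inj_on (\<lambda>i. (i * j) mod p) {..<p}"
    proof (rule inj_onI)
      fix a b assume ab: "a \<in> {..<p}" "b \<in> {..<p}" "(a * j) mod p = (b * j) mod p"
      have *: "a = b" if "a \<le> b" "b < p" "(a * j) mod p = (b * j) mod p" for a b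
      proof -
        have "p dvd b * j - a * j"
          using that mod_eq_dvd_iff_nat[of "a * j" "b * j" p] by simp
        then have "p dvd (b - a) * j" by (simp add: diff_mult_distrib)
        moreover have "\<not> p dvd j" using j by (auto dest: dvd_imp_le)
        ultimately have "p dvd b - a" using p by (simp add: prime_dvd_mult_iff)
        then show ?thesis using that by (auto dest: dvd_imp_le)
      qed
      show "a = b" using *[of a b] *[of b a] ab by (metis lessThan_iff nle_le)
    qed
    moreover have "(\<lambda>i. (i * j) mod p) ` {..<p} \<subseteq> {..<p}" using p0 by auto
    ultimately have bij: "bij_betw (\<lambda>i. (i * j) mod p) {..<p} {..<p}"
      unfolding bij_betw_def using endo_inj_surj by blast
    have "(\<Sum>i<p. h j (i * j)) = (\<Sum>i<p. h j ((i * j) mod p))" by (simp add: per_mod)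
    also have "\<dots> = (\<Sum>b<p. h j b)" using sum.reindex_bij_betw[OF bij, of "h j"] by simp
    finally show ?thesis using vert by simp
  qed
  have "(\<Sum>j<p. \<Sum>i<p. h j (i * j)) = (\<Sum>i<p. \<Sum>j<p. h j (i * j))" by (rule sum.swap)
  also have "\<dots> = 0" using line by simp
  also have "(\<Sum>j<p. \<Sum>i<p. h j (i * j)) = (\<Sum>j<p. if j = 0 then of_nat p * h 0 0 else 0)"
    using perm by (intro sum.cong) auto
  also have "\<dots> = of_nat p * h 0 0" using p0 by simp
  finally show ?thesis using p0 by simp
qed

text \<open>
  In \<open>\<Phi>\<^sub>7(1\<^sup>5)\<close> take \<open>(x, y, c, d) = (\<alpha>\<^sub>1, \<alpha>, \<alpha>\<^sub>2, \<beta>)\<close>, in \<open>\<Phi>\<^sub>8(32)\<close> take \<open>(\<alpha>\<^sub>1, \<alpha>\<^sub>2, \<alpha>\<^sub>1\<^sup>p, \<alpha>\<^sub>2\<^sup>p)\<close>.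
\<close>

locale phi_group = group G for G (structure) +
  fixes p :: nat and x y c d z1 z2 :: 'a
  assumes fin: "finite (carrier G)" and p: "Factorial_Ring.prime p" and odd: "odd p"
    and card_G: "card (carrier G) = p ^ 5"
    and x: "x \<in> carrier G" and y: "y \<in> carrier G" and c: "c \<in> carrier G" and d: "d \<in> carrier G"
    and xy: "x \<otimes> y = y \<otimes> x \<otimes> c"
    and cx: "c \<otimes> x = x \<otimes> c" and cd: "c \<otimes> d = d \<otimes> c" and dy: "d \<otimes> y = y \<otimes> d"
    and cy: "c \<otimes> y = y \<otimes> c \<otimes> z1" and z1: "z1 \<in> center G" "z1 \<noteq> \<one>"
    and dx: "d \<otimes> x = x \<otimes> d \<otimes> z2" and z2: "z2 \<in> center G" "z2 \<noteq> \<one>"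
    and cp: "c [^] p \<in> center G" and dp: "d [^] p \<in> center G"
    and xp: "x [^] p \<in> adj (center G) c" and yp: "y [^] p \<in> adj (center G) d"
    and gen: "\<And>S. subgroup S G \<Longrightarrow> center G \<subseteq> S \<Longrightarrow> x \<in> S \<Longrightarrow> y \<in> S \<Longrightarrow> d \<in> S \<Longrightarrow> S = carrier G"
begin

text \<open>Each group in the chain \<open>Z < S1 < S2 < S3 < S4 = G\<close> has index \<open>p\<close> in the next one; \<open>S1 = G'\<close> and \<open>S2\<close> is the
  second center.\<close>

abbreviation "Z \<equiv> center G"
definition "S1 = adj Z c"
definition "S2 = adj S1 d"
definition "S3 = adj S2 x"
definition "S4 = adj S3 y"

lemma p0: "0 < p" using p by (rule prime_gt_0_nat)

lemma Z: "subgroup Z G" by (rule subgroup_center)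

lemma z1_carrier [simp]: "z1 \<in> carrier G" and z2_carrier [simp]: "z2 \<in> carrier G"
  using z1 z2 center_carrier by auto

lemmas [simp] = x y c d

lemma Z_centralizer: "g \<in> carrier G \<Longrightarrow> Z \<subseteq> centralizer g"
  by (auto simp: center_def centralizer_def)

lemmas centr = subgroup_centralizer

lemma S1: "subgroup S1 G"
  unfolding S1_def by (rule subgroup_adj[OF fin Z c]) (simp add: center_conj)

lemma S1_centralizer: "g \<in> carrier G \<Longrightarrow> c \<otimes> g = g \<otimes> c \<Longrightarrow> S1 \<subseteq> centralizer g"
  unfolding S1_def by (rule adj_subset[OF centr Z_centralizer]) (auto simp: centralizer_def)

lemma conj_centralizer: "k \<in> centralizer g \<Longrightarrow> g \<in> carrier G \<Longrightarrow> g \<otimes> k \<otimes> inv g = k"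
  by (simp add: centralizer_def) (metis inv_solve_right m_closed)

lemma S2: "subgroup S2 G"
  unfolding S2_def
proof (rule subgroup_adj[OF fin S1 d])
  fix k assume "k \<in> S1"
  then show "d \<otimes> k \<otimes> inv d \<in> S1" using S1_centralizer[OF d cd] conj_centralizer by auto
qed

lemma S2_centralizer: "g \<in> carrier G \<Longrightarrow> c \<otimes> g = g \<otimes> c \<Longrightarrow> d \<otimes> g = g \<otimes> d \<Longrightarrow> S2 \<subseteq> centralizer g"
  unfolding S2_def by (rule adj_subset[OF centr S1_centralizer]) (auto simp: centralizer_def)

lemma S1_S2: "S1 \<subseteq> S2" unfolding S2_def by (rule adj_base[OF S1 d])
lemma Z_S1: "Z \<subseteq> S1" unfolding S1_def by (rule adj_base[OF Z c])
lemma c_S1: "c \<in> S1" unfolding S1_def by (rule adj_self[OF Z c])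
lemma d_S2: "d \<in> S2" unfolding S2_def by (rule adj_self[OF S1 d])
lemma Z_S2: "Z \<subseteq> S2" using Z_S1 S1_S2 by blast

lemma conj_of_commutation:
  assumes "u \<otimes> h = h \<otimes> u \<otimes> t" "t \<in> Z" "u \<in> carrier G" "h \<in> carrier G"
  shows "h \<otimes> u \<otimes> inv h = u \<otimes> inv t"
proof -
  have tc: "t \<in> carrier G" using assms by (simp add: center_carrier)
  have "h \<otimes> u = u \<otimes> h \<otimes> inv t" by (rule commutation_inv[OF assms])
  also have "\<dots> = u \<otimes> inv t \<otimes> h"
    using center_commutes[OF subgroup.m_inv_closed[OF Z assms(2)] assms(4)] assms(3,4) tc by (simp add: m_assoc)
  finally show ?thesis using assms tc by (simp add: m_assoc)
qed

lemma conj_c_y: "y \<otimes> c \<otimes> inv y = c \<otimes> inv z1" by (rule conj_of_commutation[OF cy z1(1) c y])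
lemma conj_d_x: "x \<otimes> d \<otimes> inv x = d \<otimes> inv z2" by (rule conj_of_commutation[OF dx z2(1) d x])
lemma conj_d_y: "y \<otimes> d \<otimes> inv y = d" by (rule conj_centralizer) (simp_all add: centralizer_def dy)

lemma conj_S1_y: assumes "k \<in> S1" shows "y \<otimes> k \<otimes> inv y \<in> S1"
proof (rule conj_adj[OF S1 subgroup.subset[OF Z] c y])
  show "y \<otimes> z \<otimes> inv y \<in> S1" if "z \<in> Z" for z using center_conj[OF that y] that Z_S1 by auto
  have "inv z1 \<in> S1" using z1 Z_S1 subgroup.m_inv_closed[OF S1] by blast
  then show "y \<otimes> c \<otimes> inv y \<in> S1" unfolding conj_c_y by (rule subgroup.m_closed[OF S1 c_S1])
  show "k \<in> adj Z c" using assms by (simp add: S1_def)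
qed

lemma conj_S1_x: "k \<in> S1 \<Longrightarrow> x \<otimes> k \<otimes> inv x \<in> S1"
  using S1_centralizer[OF x cx] conj_centralizer[OF _ x] by auto

lemma conj_S1_d: "k \<in> S1 \<Longrightarrow> d \<otimes> k \<otimes> inv d \<in> S1"
  using S1_centralizer[OF d cd] conj_centralizer[OF _ d] by auto

lemma conj_S2_x: assumes "k \<in> S2" shows "x \<otimes> k \<otimes> inv x \<in> S2"
proof (rule conj_adj[OF S2 subgroup.subset[OF S1] d x])
  show "x \<otimes> s \<otimes> inv x \<in> S2" if "s \<in> S1" for s using conj_S1_x[OF that] S1_S2 by auto
  have "inv z2 \<in> S2" using z2 Z_S2 subgroup.m_inv_closed[OF S2] by blast
  then show "x \<otimes> d \<otimes> inv x \<in> S2" unfolding conj_d_x by (rule subgroup.m_closed[OF S2 d_S2])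
  show "k \<in> adj S1 d" using assms by (simp add: S2_def)
qed

lemma S3: "subgroup S3 G"
  unfolding S3_def by (rule subgroup_adj[OF fin S2 x conj_S2_x])

lemma S2_S3: "S2 \<subseteq> S3" unfolding S3_def by (rule adj_base[OF S2 x])
lemma x_S3: "x \<in> S3" unfolding S3_def by (rule adj_self[OF S2 x])

lemma conj_S2_y: "k \<in> S2 \<Longrightarrow> y \<otimes> k \<otimes> inv y \<in> S2"
  by (rule conj_adj[OF S2 subgroup.subset[OF S1] d y])
    (use S2_def S1_S2 conj_S1_y conj_d_y d_S2 in auto)

lemma conj_x_y: "y \<otimes> x \<otimes> inv y = x \<otimes> inv (y \<otimes> c \<otimes> inv y)"
proof -
  have "(y \<otimes> x \<otimes> inv y) \<otimes> (y \<otimes> c \<otimes> inv y) = y \<otimes> x \<otimes> (inv y \<otimes> y) \<otimes> c \<otimes> inv y"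
    by (simp only: m_assoc m_closed inv_closed x y c)
  also have "\<dots> = (y \<otimes> x \<otimes> c) \<otimes> inv y" by (simp add: m_assoc)
  also have "\<dots> = x" unfolding xy[symmetric] by (simp add: m_assoc)
  finally show ?thesis by (metis c inv_closed inv_solve_right m_closed x y)
qed

lemma conj_S3_y: assumes "k \<in> S3" shows "y \<otimes> k \<otimes> inv y \<in> S3"
proof (rule conj_adj[OF S3 subgroup.subset[OF S2] x y])
  show "y \<otimes> s \<otimes> inv y \<in> S3" if "s \<in> S2" for s using conj_S2_y[OF that] S2_S3 by auto
  have "y \<otimes> c \<otimes> inv y \<in> S3" using conj_S1_y[OF c_S1] S1_S2 S2_S3 by blast
  then show "y \<otimes> x \<otimes> inv y \<in> S3" unfolding conj_x_y
    by (rule subgroup.m_closed[OF S3 x_S3 subgroup.m_inv_closed[OF S3]])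
  show "k \<in> adj S2 x" using assms by (simp add: S3_def)
qed

lemma S4: "subgroup S4 G"
  unfolding S4_def by (rule subgroup_adj[OF fin S3 y conj_S3_y])

lemma S4_eq: "S4 = carrier G"
proof (rule gen[OF S4])
  have "S3 \<subseteq> S4" unfolding S4_def by (rule adj_base[OF S3 y])
  then show "Z \<subseteq> S4" "x \<in> S4" "d \<in> S4" using Z_S2 S2_S3 x_S3 d_S2 by auto
  show "y \<in> S4" unfolding S4_def by (rule adj_self[OF S3 y])
qed

lemma noncommuting:
  assumes "t \<in> Z" "t \<noteq> \<one>" "u \<in> carrier G" "h \<in> carrier G" "u \<otimes> h = h \<otimes> u \<otimes> t"
  shows "u \<otimes> h \<noteq> h \<otimes> u"
proof
  assume "u \<otimes> h = h \<otimes> u"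
  then have "(h \<otimes> u) \<otimes> t = (h \<otimes> u) \<otimes> \<one>" using assms by simp
  moreover have "h \<otimes> u \<in> carrier G" "t \<in> carrier G" using assms by (simp_all add: center_carrier)
  ultimately have "t = \<one>" by (metis l_cancel one_closed)
  then show False using assms by simp
qed

lemma cy_neq: "c \<otimes> y \<noteq> y \<otimes> c" by (rule noncommuting[OF z1 c y cy])
lemma dx_neq: "d \<otimes> x \<noteq> x \<otimes> d" by (rule noncommuting[OF z2 d x dx])

text \<open>Each step of the chain is proper because the lower group centralizes an element with
  which the adjoined one does not commute: \<open>y\<close> for \<open>c\<close>, \<open>x\<close>
  for \<open>d\<close>, \<open>d\<close> for \<open>x\<close>, and \<open>c\<close> for
  \<open>y\<close>.\<close>

lemma c_notin: "c \<notin> Z" using cy_neq center_commutes[of c y] by auto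
lemma d_notin: "d \<notin> S1" using S1_centralizer[OF x cx] dx_neq by (auto simp: centralizer_def)
lemma x_notin: "x \<notin> S2" using S2_centralizer[OF d cd HOL.refl] dx_neq by (auto simp: centralizer_def)
lemma y_notin: "y \<notin> S3"
proof -
  have "S2 \<subseteq> centralizer c" by (rule S2_centralizer[OF c HOL.refl cd[symmetric]])
  then have "S3 \<subseteq> centralizer c"
    unfolding S3_def by (rule adj_subset[OF centr[OF c]]) (simp add: centralizer_def cx)
  then show ?thesis using cy_neq by (auto simp: centralizer_def)
qed

lemma xp_S2: "x [^] p \<in> S2" using xp S1_S2 unfolding S1_def by auto
lemma yp_S3: "y [^] p \<in> S3"
  using yp adj_subset[OF S2 Z_S2 d_S2] S2_S3 by auto
lemma dp_S1: "d [^] p \<in> S1" using dp Z_S1 by auto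

lemma card_S1': "card S1 = p * card Z" unfolding S1_def by (rule card_adj[OF Z c p cp c_notin])
lemma card_S2': "card S2 = p * card S1" unfolding S2_def by (rule card_adj[OF S1 d p dp_S1 d_notin])
lemma card_S3': "card S3 = p * card S2" unfolding S3_def by (rule card_adj[OF S2 x p xp_S2 x_notin])
lemma card_S4': "card S4 = p * card S3" unfolding S4_def by (rule card_adj[OF S3 y p yp_S3 y_notin])

text \<open>Four steps of index \<open>p\<close> lead from the center to a group of order
  p^5.\<close>

lemma card_Z: "card Z = p"
proof -
  have "card (carrier G) = p * (p * (p * (p * card Z)))"
    by (simp only: S4_eq[symmetric] card_S4' card_S3' card_S2' card_S1')
  moreover have "card (carrier G) = p * (p * (p * (p * p)))"
    using card_G by (simp add: eval_nat_numeral)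
  ultimately show ?thesis using p0 by (metis mult_cancel1 neq0_conv)
qed

lemma card_S1: "card S1 = p ^ 2" using card_S1' card_Z by (simp add: power2_eq_square)
lemma card_S2: "card S2 = p ^ 3" using card_S2' card_S1 by (simp add: eval_nat_numeral)

lemma gen_closed:
  assumes "\<And>g h. g \<in> S \<Longrightarrow> h \<in> S \<Longrightarrow> g \<otimes> h \<in> S" "S \<subseteq> carrier G" "Z \<subseteq> S" "x \<in> S" "y \<in> S" "d \<in> S"
  shows "S = carrier G"
proof (rule gen)
  show "subgroup S G"
    using assms finite_subset[OF assms(2) fin] by (intro finite_subgroupI) auto
qed (use assms in auto)

text \<open>The elements that conjugate \<open>N\<close> into itself are closed under products and
  contain the center, so it is enough to test \<open>x\<close>, \<open>y\<close> and
  \<open>d\<close>.\<close>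

lemma normal_from_generators:
  assumes N: "subgroup N G" and "\<And>n. n \<in> N \<Longrightarrow> x \<otimes> n \<otimes> inv x \<in> N"
    "\<And>n. n \<in> N \<Longrightarrow> y \<otimes> n \<otimes> inv y \<in> N" "\<And>n. n \<in> N \<Longrightarrow> d \<otimes> n \<otimes> inv d \<in> N"
  shows "N \<lhd> G"
proof -
  let ?S = "{g \<in> carrier G. \<forall>n\<in>N. g \<otimes> n \<otimes> inv g \<in> N}"
  have Nc: "n \<in> carrier G" if "n \<in> N" for n using that N by (rule subgroup.mem_carrier[rotated])
  have "?S = carrier G"
  proof (rule gen_closed)
    fix g h assume gh: "g \<in> ?S" "h \<in> ?S"
    have "g \<otimes> h \<otimes> n \<otimes> inv (g \<otimes> h) \<in> N" if n: "n \<in> N" for n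
      using gh n conj_comp[OF Nc[OF n], of g h] by auto
    then show "g \<otimes> h \<in> ?S" using gh by auto
  next
    have "z \<otimes> n \<otimes> inv z = n" if "z \<in> Z" "n \<in> N" for z n
      using center_commutes[OF that(1) Nc[OF that(2)]] center_carrier[OF that(1)] Nc[OF that(2)]
      by (simp add: m_assoc)
    then show "Z \<subseteq> ?S" using center_carrier by auto
  qed (use assms in auto)
  then show ?thesis using N by (auto simp: normal_inv_iff)
qed

lemma S1_normal: "S1 \<lhd> G"
  by (rule normal_from_generators[OF S1 conj_S1_x conj_S1_y conj_S1_d])

section \<open>Commutation modulo a normal subgroup\<close>

text \<open>For normal \<open>N\<close> this is the preimage of the centralizer of the coset of
  \<open>h\<close> in the quotient by \<open>N\<close>; it allows arguments in the quotient to be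
  carried out inside \<open>G\<close>.\<close>

definition cmod :: "'a set \<Rightarrow> 'a \<Rightarrow> 'a set" where
  "cmod N h = {g \<in> carrier G. g \<otimes> h \<otimes> inv g \<otimes> inv h \<in> N}"

lemma cmod_sym:
  assumes N: "subgroup N G" and g: "g \<in> carrier G" and h: "h \<in> carrier G" and gh: "g \<in> cmod N h"
  shows "h \<in> cmod N g"
proof -
  have "inv (g \<otimes> h \<otimes> inv g \<otimes> inv h) \<in> N"
    using gh subgroup.m_inv_closed[OF N] by (simp add: cmod_def)
  then show ?thesis using g h by (simp add: cmod_def inv_mult_group m_assoc)
qed

lemma subgroup_cmod:
  assumes N: "N \<lhd> G" and h: "h \<in> carrier G" shows "subgroup (cmod N h) G"
proof (rule finite_subgroupI)
  have sub: "subgroup N G" using N by (rule normal_imp_subgroup)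
  show "cmod N h \<subseteq> carrier G" by (auto simp: cmod_def)
  then show "finite (cmod N h)" using fin finite_subset by blast
  have "\<one> \<in> cmod N h" using h subgroup.one_closed[OF sub] by (simp add: cmod_def)
  then show "cmod N h \<noteq> {}" by blast
  fix a b assume ab: "a \<in> cmod N h" "b \<in> cmod N h"
  then have [simp]: "a \<in> carrier G" "b \<in> carrier G" by (auto simp: cmod_def)
  have "a \<otimes> b \<otimes> h \<otimes> inv (a \<otimes> b) \<otimes> inv h =
      (a \<otimes> (b \<otimes> h \<otimes> inv b \<otimes> inv h) \<otimes> inv a) \<otimes> (a \<otimes> h \<otimes> inv a \<otimes> inv h)"
  proof -
    have "(a \<otimes> (b \<otimes> h \<otimes> inv b \<otimes> inv h) \<otimes> inv a) \<otimes> (a \<otimes> h \<otimes> inv a \<otimes> inv h) =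
        a \<otimes> b \<otimes> h \<otimes> inv b \<otimes> (inv h \<otimes> ((inv a \<otimes> a) \<otimes> h)) \<otimes> inv a \<otimes> inv h"
      using h by (simp only: m_assoc m_closed inv_closed \<open>a \<in> carrier G\<close> \<open>b \<in> carrier G\<close>)
    also have "\<dots> = a \<otimes> b \<otimes> h \<otimes> inv b \<otimes> inv a \<otimes> inv h" using h by simp
    finally show ?thesis using h by (simp add: inv_mult_group m_assoc)
  qed
  moreover have "a \<otimes> (b \<otimes> h \<otimes> inv b \<otimes> inv h) \<otimes> inv a \<in> N"
    using ab N by (simp add: cmod_def normal_inv_iff)
  ultimately show "a \<otimes> b \<in> cmod N h"
    using ab subgroup.m_closed[OF sub] by (simp add: cmod_def)
qed

lemma cmod_self: "subgroup N G \<Longrightarrow> h \<in> carrier G \<Longrightarrow> h \<in> cmod N h"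
  using subgroup.one_closed[of N G] by (simp add: cmod_def m_assoc)

lemma cmod_commutation:
  assumes "u \<otimes> h = h \<otimes> u \<otimes> t" "N \<lhd> G" "t \<in> N" "u \<in> carrier G" "h \<in> carrier G"
  shows "u \<in> cmod N h"
proof -
  have tc: "t \<in> carrier G" using assms(2,3) normal_imp_subgroup subgroup.mem_carrier by metis
  have "u \<otimes> h \<otimes> inv u \<otimes> inv h = (h \<otimes> u) \<otimes> t \<otimes> inv (h \<otimes> u)"
    using assms(1,4,5) tc by (simp add: inv_mult_group m_assoc[symmetric])
  then show ?thesis using assms by (simp add: cmod_def normal_inv_iff)
qed

lemma cmod_center: "subgroup N G \<Longrightarrow> h \<in> carrier G \<Longrightarrow> Z \<subseteq> cmod N h"
  using subgroup.one_closed[of N G] by (auto simp: cmod_def center_carrier center_commutes[of _ h] m_assoc)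

lemma Z_normal: "Z \<lhd> G"
  by (rule normal_from_generators[OF Z]) (simp_all add: center_conj)

text \<open>\<open>c\<close> and \<open>d\<close> commute modulo \<open>Z\<close> with the
  generators \<open>x\<close>, \<open>y\<close>, \<open>d\<close> and with \<open>Z\<close>, hence
  with everything, because \<open>cmod Z c\<close> and \<open>cmod Z d\<close> are
  subgroups.\<close>

lemma S2_central_mod_Z:
  assumes g: "g \<in> carrier G" shows "S2 \<subseteq> cmod Z g"
proof -
  have one: "\<one> \<in> Z" by (rule subgroup.one_closed[OF Z])
  have c_all: "cmod Z c = carrier G"
  proof (rule gen[OF subgroup_cmod[OF Z_normal c]])
    show "Z \<subseteq> cmod Z c" by (rule cmod_center[OF Z c])
    show "x \<in> cmod Z c" using cmod_commutation[OF _ Z_normal one x c] cx by simp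
    show "d \<in> cmod Z c" using cmod_commutation[OF _ Z_normal one d c] cd by simp
    show "y \<in> cmod Z c" by (rule cmod_sym[OF Z c y cmod_commutation[OF cy Z_normal z1(1) c y]])
  qed
  have d_all: "cmod Z d = carrier G"
  proof (rule gen[OF subgroup_cmod[OF Z_normal d]])
    show "Z \<subseteq> cmod Z d" by (rule cmod_center[OF Z d])
    show "x \<in> cmod Z d" by (rule cmod_sym[OF Z d x cmod_commutation[OF dx Z_normal z2(1) d x]])
    show "d \<in> cmod Z d" by (rule cmod_self[OF Z d])
    show "y \<in> cmod Z d" using cmod_commutation[OF _ Z_normal one y d] dy by simp
  qed
  note sub = subgroup_cmod[OF Z_normal g]
  show ?thesis
    unfolding S2_def S1_def
    using cmod_sym[OF Z g c] cmod_sym[OF Z g d] c_all d_all g cmod_center[OF Z g]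
    by (intro adj_subset[OF sub] ) auto
qed

text \<open>The commutators of the generators are \<open>c\<close>, \<open>z2\<close> and 1, up to
  inversion; all lie in \<open>S1\<close>, so the quotient by \<open>S1\<close> is abelian.\<close>

lemma commutators_S1:
  assumes g: "g \<in> carrier G" and h: "h \<in> carrier G" shows "g \<in> cmod S1 h"
proof -
  note sub = subgroup_cmod[OF S1_normal]
  have one: "\<one> \<in> S1" by (rule subgroup.one_closed[OF S1])
  have x_y: "x \<in> cmod S1 y" by (rule cmod_commutation[OF xy S1_normal c_S1 x y])
  have d_x: "d \<in> cmod S1 x" by (rule cmod_commutation[OF dx S1_normal _ d x]) (use z2 Z_S1 in auto)
  have d_y: "d \<in> cmod S1 y" using cmod_commutation[OF _ S1_normal one d y] dy by simp
  have x_all: "cmod S1 x = carrier G"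
    by (rule gen[OF sub[OF x] cmod_center[OF S1 x] cmod_self[OF S1 x] cmod_sym[OF S1 x y x_y] d_x])
  have y_all: "cmod S1 y = carrier G"
    by (rule gen[OF sub[OF y] cmod_center[OF S1 y] x_y cmod_self[OF S1 y] d_y])
  have d_all: "cmod S1 d = carrier G"
    by (rule gen[OF sub[OF d] cmod_center[OF S1 d] cmod_sym[OF S1 d x d_x] cmod_sym[OF S1 d y d_y] cmod_self[OF S1 d]])
  have "cmod S1 h = carrier G"
    using cmod_sym[OF S1 h x] cmod_sym[OF S1 h y] cmod_sym[OF S1 h d] x_all y_all d_all h
    by (intro gen[OF sub[OF h] cmod_center[OF S1 h]]) auto
  then show ?thesis using g by simp
qed

text \<open>For the less obvious inclusion, \<open>c\<close> is the commutator of \<open>x\<close>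
  and \<open>y\<close>, and the commutator \<open>z1\<close> of \<open>c\<close> and
  \<open>y\<close> generates \<open>Z\<close>, which has prime order.\<close>

lemma derived_eq: "derived G (carrier G) = S1"
proof
  show "derived G (carrier G) \<subseteq> S1"
    unfolding derived_def
  proof (rule generate_subgroup_incl[OF _ S1])
    show "derived_set G (carrier G) \<subseteq> S1"
      using commutators_S1 by (auto simp: cmod_def)
  qed
  have sub: "subgroup (derived G (carrier G)) G" by (rule derived_is_subgroup) simp
  have comm: "g \<otimes> h \<otimes> inv g \<otimes> inv h \<in> derived G (carrier G)" if "g \<in> carrier G" "h \<in> carrier G" for g h
    unfolding derived_def by (rule generate.incl) (use that in auto)
  have in_derived: "t \<in> derived G (carrier G)" if "u \<otimes> h = h \<otimes> u \<otimes> t" "u \<in> carrier G" "h \<in> carrier G" "t \<in> carrier G" for u h t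
  proof -
    \<comment> \<open>The generators of \<open>derived\<close> have the form x y x^-1 y^-1, so
      \<open>t\<close> has to be presented as the commutator of the inverses of \<open>u\<close> and
      \<open>h\<close>.\<close>
    have "t = inv u \<otimes> inv h \<otimes> (u \<otimes> h)"
      using that(2-) unfolding that(1) by (simp add: m_assoc[symmetric]) (simp add: m_assoc)
    then have "t = inv u \<otimes> inv h \<otimes> inv (inv u) \<otimes> inv (inv h)"
      using that by (simp add: m_assoc)
    then show ?thesis using comm[of "inv u" "inv h"] that by simp
  qed
  have z1_in: "z1 \<in> derived G (carrier G)" by (rule in_derived[OF cy c y]) simp
  have c_in: "c \<in> derived G (carrier G)" by (rule in_derived[OF xy x y c])
  have "Z = adj {\<one>} z1" by (rule prime_order_generator(1)[OF fin Z p card_Z z1])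
  also have "\<dots> \<subseteq> derived G (carrier G)"
    using subgroup.one_closed[OF sub] by (intro adj_subset[OF sub _ z1_in]) simp
  finally show "S1 \<subseteq> derived G (carrier G)"
    unfolding S1_def by (rule adj_subset[OF sub _ c_in])
qed

lemma inv_Z: "t \<in> Z \<Longrightarrow> t \<noteq> \<one> \<Longrightarrow> inv t \<in> Z \<and> inv t \<noteq> \<one>"
  using subgroup.m_inv_closed[OF Z] center_carrier inv_eq_1_iff by auto

text \<open>Descent along the chain. An element \<open>k \<otimes> u [^] i\<close> of
  \<open>adj K u\<close> with \<open>0 < i < p\<close> is tested against some \<open>h\<close> that
  centralizes \<open>K\<close> and has commutator \<open>t\<close> with \<open>u\<close>: the result
  \<open>t [^] i\<close> is nontrivial and central. From top to bottom \<open>h\<close> is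
  \<open>c\<close>, \<open>d\<close>, \<open>x\<close>, \<open>y\<close>.\<close>

lemma fully_ramified:
  assumes g: "g \<in> carrier G" "g \<notin> Z"
  shows "\<exists>h \<in> carrier G. \<exists>t \<in> Z. t \<noteq> \<one> \<and> g \<otimes> h = h \<otimes> g \<otimes> t"
proof -
  have step: "g \<in> K \<or> ?thesis"
    if g': "g \<in> adj K u" and K: "subgroup K G" and u: "u \<in> carrier G" and up: "u [^] p \<in> K" and h: "h \<in> carrier G"
      and Kh: "K \<subseteq> centralizer h" and uh: "u \<otimes> h = h \<otimes> u \<otimes> t" and t: "t \<in> Z" "t \<noteq> \<one>" for K u h t
  proof -
    obtain k i where k: "k \<in> K" "i < p" "g = k \<otimes> u [^] (i::nat)" by (rule adj_cases[OF K u up p0 g'])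
    have kc: "k \<in> carrier G" using K k(1) by (rule subgroup.mem_carrier)
    show ?thesis
    proof (cases "i = 0")
      case True
      then show ?thesis using k kc by simp
    next
      case False
      have "g \<otimes> h = h \<otimes> g \<otimes> t [^] i"
        unfolding k(3) using Kh k(1) by (intro commutation_mult_pow[OF uh t(1) u h kc]) (auto simp: centralizer_def)
      moreover have "t [^] i \<in> Z" by (rule subgroup_nat_pow[OF Z t(1)])
      moreover have "t [^] i \<noteq> \<one>" using prime_order_pow_neq_one[OF fin Z p card_Z t] False k(2) by simp
      ultimately show ?thesis using h by blast
    qed
  qed
  have S2_c: "S2 \<subseteq> centralizer c" by (rule S2_centralizer[OF c HOL.refl cd[symmetric]])
  have S3_c: "S3 \<subseteq> centralizer c"
    unfolding S3_def by (rule adj_subset[OF centr[OF c] S2_c]) (simp add: centralizer_def cx)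
  have S2_d: "S2 \<subseteq> centralizer d" by (rule S2_centralizer[OF d cd HOL.refl])
  have "g \<in> S3 \<or> ?thesis"
    using step[OF _ S3 y yp_S3 c S3_c commutation_inv[OF cy z1(1) c y]] g S4_eq inv_Z[OF z1]
    unfolding S4_def by blast
  moreover have "g \<in> S2 \<or> ?thesis" if "g \<in> S3"
    using step[OF _ S2 x xp_S2 d S2_d commutation_inv[OF dx z2(1) d x]] that inv_Z[OF z2]
    unfolding S3_def by blast
  moreover have "g \<in> S1 \<or> ?thesis" if "g \<in> S2"
    using step[OF _ S1 d dp_S1 x S1_centralizer[OF x cx] dx z2] that unfolding S2_def by blast
  moreover have "g \<in> Z \<or> ?thesis" if "g \<in> S1"
    using step[OF _ Z c cp y Z_centralizer[OF y] cy z1] that unfolding S1_def by blast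
  ultimately show ?thesis using g by blast
qed

end

text \<open>The noncentral element of order \<open>p\<close> of the quotient, lifted back to the
  group; it is applied to the centralizer of an element of order \<open>p\<close> when the
  complement \<open>B\<close> is built.\<close>

lemma (in group) quotient_order_p3_element:
  assumes fin: "finite (carrier G)" and p: "Factorial_Ring.prime p" and odd: "odd p"
    and N: "N \<lhd> G" and card: "card (carrier G) = p ^ 3 * card N"
    and c: "c \<in> carrier G" "c \<notin> N" "c [^] p \<in> N"
    and central: "\<forall>g\<in>carrier G. N #> (c \<otimes> g) = N #> (g \<otimes> c)"
    and comm: "\<forall>g\<in>carrier G. \<forall>h\<in>carrier G. \<exists>k::nat. N #> (g \<otimes> h) = N #> (h \<otimes> g \<otimes> c [^] k)"
    and uv: "u \<in> carrier G" "v \<in> carrier G" "N #> (u \<otimes> v) \<noteq> N #> (v \<otimes> u)"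
  shows "\<exists>y\<in>carrier G. y [^] p \<in> N \<and> y \<notin> adj N c"
proof -
  have sub: "subgroup N G" using N by (rule normal_imp_subgroup)
  interpret Q: group "G Mod N" using N by (rule normal.factorgroup_is_group)
  obtain Y where Y: "Y \<in> carrier (G Mod N)" "Y [^]\<^bsub>G Mod N\<^esub> p = \<one>\<^bsub>G Mod N\<^esub>"
    "Y \<notin> Q.adj {\<one>\<^bsub>G Mod N\<^esub>} (N #> c)"
    using quotient_order_p3(1)[OF assms] by blast
  obtain y where y: "y \<in> carrier G" "Y = N #> y" using Y(1) by (auto simp: carrier_FactGroup)
  have "N #> y [^] p = N" using Y(2) y coset_hom_pow[OF N y(1)] by simp
  then have "y [^] p \<in> N" using y rcos_self[OF nat_pow_closed[OF y(1)] sub] by metis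
  moreover have "y \<notin> adj N c"
  proof
    assume "y \<in> adj N c"
    then obtain n k where nk: "n \<in> N" "y = n \<otimes> c [^] (k::nat)" by (auto simp: adj_def)
    have nc: "n \<in> carrier G" using sub nk(1) by (rule subgroup.mem_carrier)
    have "N #> y = (N #> n) <#> (N #> c [^] k)"
      unfolding nk(2) using normal.rcos_sum[OF N nc nat_pow_closed[OF c(1)]] by simp
    also have "N #> n = N" using coset_join2[OF nc sub nk(1)] .
    finally have "Y = \<one>\<^bsub>G Mod N\<^esub> \<otimes>\<^bsub>G Mod N\<^esub> (N #> c) [^]\<^bsub>G Mod N\<^esub> k"
      using y coset_hom_pow[OF N c(1)] by simp
    then show False using Y(3) Q.adj_memI[of "\<one>\<^bsub>G Mod N\<^esub>" "{\<one>\<^bsub>G Mod N\<^esub>}" "N #> c" k] by simp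
  qed
  ultimately show ?thesis using y(1) by blast
qed

context phi_group
begin

text \<open>\<open>S2\<close> is central modulo \<open>Z\<close>, so conjugation changes
  \<open>w\<close> only by an element of \<open>Z\<close>.\<close>

lemma adj_Z_normal:
  assumes w: "w \<in> S2" shows "adj Z w \<lhd> G"
proof -
  have wc: "w \<in> carrier G" using S2 w by (rule subgroup.mem_carrier)
  have sub: "subgroup (adj Z w) G" by (rule subgroup_adj[OF fin Z wc]) (simp add: center_conj wc)
  have "g \<otimes> n \<otimes> inv g \<in> adj Z w" if g: "g \<in> carrier G" and n: "n \<in> adj Z w" for g n
  proof (rule conj_adj[OF sub subgroup.subset[OF Z] wc g _ _ n])
    show "g \<otimes> z \<otimes> inv g \<in> adj Z w" if "z \<in> Z" for z
      using that center_conj[OF that g] adj_base[OF Z wc] by auto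
    have "w \<in> cmod Z g" using S2_central_mod_Z[OF g] w by blast
    then have "g \<in> cmod Z w" by (rule cmod_sym[OF Z wc g])
    then have "g \<otimes> w \<otimes> inv g \<otimes> inv w \<in> adj Z w" using adj_base[OF Z wc] by (auto simp: cmod_def)
    then have "(g \<otimes> w \<otimes> inv g \<otimes> inv w) \<otimes> w \<in> adj Z w"
      using adj_self[OF Z wc] by (rule subgroup.m_closed[OF sub])
    then show "g \<otimes> w \<otimes> inv g \<in> adj Z w" using g wc by (simp add: m_assoc)
  qed
  then show ?thesis using sub by (auto simp: normal_inv_iff)
qed

section \<open>The quotients of order p^3\<close>

definition "e i = d \<otimes> c [^] (i::nat)"

lemma c_S2: "c \<in> S2" using c_S1 S1_S2 by blast

lemma e_S2: "e i \<in> S2"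
  unfolding e_def by (rule subgroup.m_closed[OF S2 d_S2 subgroup_nat_pow[OF S2 c_S2]])

lemma e_carrier [simp]: "e i \<in> carrier G" by (simp add: e_def)

lemma c_pow_d: "c [^] (i::nat) \<otimes> d = d \<otimes> c [^] i"
  using cd by (metis c d group_commutes_pow)

lemma e_pow: "e i [^] (j::nat) = d [^] j \<otimes> c [^] (i * j)"
  unfolding e_def using pow_mult_distrib[OF c_pow_d[symmetric], of i j] by (simp add: nat_pow_pow)

lemma e_p: "e i [^] p \<in> Z"
proof -
  have "c [^] (i * p) = (c [^] p) [^] i" by (simp add: nat_pow_pow mult.commute)
  then show ?thesis
    unfolding e_pow using subgroup.m_closed[OF Z dp subgroup_nat_pow[OF Z cp]] by simp
qed

lemma e_notin_centralizer: "e i \<notin> centralizer x"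
proof
  assume e: "e i \<in> centralizer x"
  have "c [^] i \<in> centralizer x"
    by (rule subgroup_nat_pow[OF centr[OF x]]) (simp add: centralizer_def cx)
  then have "e i \<otimes> inv (c [^] i) \<in> centralizer x"
    using subgroup.m_closed[OF centr[OF x] e subgroup.m_inv_closed[OF centr[OF x]]] by blast
  then have "d \<in> centralizer x" by (simp add: e_def m_assoc)
  then show False using dx_neq by (simp add: centralizer_def)
qed

lemma e_notin: "e i \<notin> Z"
  using e_notin_centralizer Z_centralizer[OF x] by blast

text \<open>Besides \<open>S1\<close>, the \<open>N i\<close> with \<open>i < p\<close> are the groups of order \<open>p\<^sup>2\<close> between \<open>Z\<close> and \<open>S2\<close>.\<close>

definition "N i = adj Z (e i)"

lemma N_normal: "N i \<lhd> G" unfolding N_def by (rule adj_Z_normal[OF e_S2])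
lemma N_sub: "subgroup (N i) G" using N_normal by (rule normal_imp_subgroup)
lemma Z_N: "Z \<subseteq> N i" unfolding N_def by (rule adj_base[OF Z]) simp
lemma card_N: "card (N i) = p ^ 2"
  unfolding N_def using card_adj[OF Z e_carrier p e_p e_notin] card_Z by (simp add: power2_eq_square)

text \<open>\<open>c\<close> centralizes \<open>x\<close>. If it were a central element times a
  power of \<open>e i\<close> with exponent prime to \<open>p\<close>, then \<open>e i\<close> would
  centralize \<open>x\<close> as well, but \<open>d\<close> does not.\<close>

lemma c_notin_N: "c \<notin> N i"
proof
  assume "c \<in> N i"
  then obtain z k where k: "z \<in> Z" "k < p" "c = z \<otimes> e i [^] (k::nat)"
    unfolding N_def by (rule adj_cases[OF Z e_carrier e_p p0])
  have zc: "z \<in> carrier G" using k(1) by (rule center_carrier)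
  show False
  proof (cases "k = 0")
    case True
    then show False using k c_notin zc by simp
  next
    case False
    have Zx: "Z \<subseteq> centralizer x" by (rule Z_centralizer[OF x])
    have "inv z \<otimes> c = inv z \<otimes> (z \<otimes> e i [^] k)" unfolding k(3)[symmetric] ..
    then have "e i [^] k = inv z \<otimes> c" using zc by (simp add: m_assoc[symmetric])
    moreover have "inv z \<otimes> c \<in> centralizer x"
      using subgroup.m_closed[OF centr[OF x] subgroup.m_inv_closed[OF centr[OF x]]] Zx k(1) cx
      by (auto simp: centralizer_def[of x])
    ultimately have "e i [^] k \<in> centralizer x" by simp
    then have "e i \<in> centralizer x"
      using nat_pow_in_prime[OF centr[OF x] e_carrier p _ _ _ k(2)] e_p Zx False by blast
    then show False using e_notin_centralizer by blast
  qed
qed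

lemma coset_eq_of_cmod:
  assumes "subgroup H G" "g \<in> carrier G" "h \<in> carrier G" "g \<in> cmod H h"
  shows "H #> (g \<otimes> h) = H #> (h \<otimes> g)"
proof -
  have "g \<otimes> h \<otimes> inv (h \<otimes> g) = g \<otimes> h \<otimes> inv g \<otimes> inv h"
    using assms by (simp add: inv_mult_group m_assoc)
  then show ?thesis using assms coset_eq_iff[OF assms(1), of "g \<otimes> h" "h \<otimes> g"] by (simp add: cmod_def)
qed

lemma cmod_mono: "H \<subseteq> H' \<Longrightarrow> cmod H h \<subseteq> cmod H' h"
  by (auto simp: cmod_def)

text \<open>Commutators lie in \<open>S1\<close>, and modulo \<open>N i\<close>, which contains
  \<open>Z\<close>, they become powers of \<open>c\<close>. The quotient is nonabelian because the
  commutator \<open>c\<close> of \<open>x\<close> and \<open>y\<close> survives in it.\<close>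

lemma small_representation:
  assumes root: "primitive_root_of_unity p \<zeta>"
  obtains M where "matrix_rep G p (rat_adjoin \<zeta>) M"
    and "\<And>f. (\<And>s t. s < p \<Longrightarrow> t < p \<Longrightarrow> (\<Sum>g\<in>carrier G. of_rat (f g) * M g s t) = 0) \<Longrightarrow>
      (\<And>g. g \<in> carrier G \<Longrightarrow> (\<Sum>x\<in>N i #> (c \<otimes> g). f x) = (\<Sum>x\<in>N i #> g. f x))"
proof (rule quotient_representation[OF fin p odd root N_normal _ c c_notin_N])
  show "card (carrier G) = p ^ 3 * card (N i)" using card_G card_N by (simp add: power_add[symmetric])
  show "c [^] p \<in> N i" using cp Z_N by blast
  show "N i #> (c \<otimes> g) = N i #> (g \<otimes> c)" if g: "g \<in> carrier G" for g
    using coset_eq_of_cmod[OF N_sub c g] S2_central_mod_Z[OF g] c_S2 cmod_mono[OF Z_N] by blast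
  show "\<exists>k::nat. N i #> (g \<otimes> h) = N i #> (h \<otimes> g \<otimes> c [^] k)" if g: "g \<in> carrier G" and h: "h \<in> carrier G" for g h
  proof -
    have "g \<otimes> h \<otimes> inv g \<otimes> inv h \<in> S1" using commutators_S1[OF g h] by (simp add: cmod_def)
    then obtain z k where k: "z \<in> Z" "g \<otimes> h \<otimes> inv g \<otimes> inv h = z \<otimes> c [^] (k::nat)"
      by (auto simp: S1_def adj_def)
    have zc: "z \<in> carrier G" using k(1) by (rule center_carrier)
    have "g \<otimes> h = (g \<otimes> h \<otimes> inv g \<otimes> inv h) \<otimes> (h \<otimes> g)"
    proof -
      have "(g \<otimes> h \<otimes> inv g \<otimes> inv h) \<otimes> (h \<otimes> g) = g \<otimes> h \<otimes> (inv g \<otimes> ((inv h \<otimes> h) \<otimes> g))"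
        using g h by (simp only: m_assoc m_closed inv_closed)
      then show ?thesis using g h by simp
    qed
    then have gh: "g \<otimes> h = z \<otimes> (c [^] k \<otimes> (h \<otimes> g))" unfolding k(2) using zc g h by (simp add: m_assoc)
    have "N i #> (g \<otimes> h) = N i #> (c [^] k \<otimes> (h \<otimes> g) \<otimes> z)"
      unfolding gh using center_commutes[OF k(1), of "c [^] k \<otimes> (h \<otimes> g)"] g h by simp
    also have "\<dots> = N i #> (c [^] k \<otimes> (h \<otimes> g))"
      by (rule coset_absorb[OF N_sub subsetD[OF Z_N k(1)] _ k(1)]) (use g h in simp)
    also have "\<dots> = N i #> ((h \<otimes> g) \<otimes> c [^] k)"
      by (rule coset_eq_of_cmod[OF N_sub _ _ subsetD[OF cmod_mono[OF Z_N]
            subsetD[OF S2_central_mod_Z subgroup_nat_pow[OF S2 c_S2]]]]) (use g h in simp_all)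
    finally show ?thesis by blast
  qed
  show "N i #> (x \<otimes> y) \<noteq> N i #> (y \<otimes> x)"
  proof
    assume "N i #> (x \<otimes> y) = N i #> (y \<otimes> x)"
    then have "y \<otimes> x \<otimes> c \<otimes> inv (y \<otimes> x) \<in> N i"
      using coset_eq_iff[OF N_sub, of "x \<otimes> y" "y \<otimes> x"] xy by simp
    then have "inv (y \<otimes> x) \<otimes> (y \<otimes> x \<otimes> c \<otimes> inv (y \<otimes> x)) \<otimes> inv (inv (y \<otimes> x)) \<in> N i"
      using normal.inv_op_closed2[OF N_normal, of "inv (y \<otimes> x)"] by simp
    moreover have "inv (y \<otimes> x) \<otimes> (y \<otimes> x \<otimes> c \<otimes> inv (y \<otimes> x)) \<otimes> inv (inv (y \<otimes> x)) = c"
    proof -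
      have "inv u \<otimes> (u \<otimes> c \<otimes> inv u) \<otimes> inv (inv u) = c" if "u \<in> carrier G" for u
        using that by (simp add: m_assoc) (simp add: m_assoc[symmetric])
      then show ?thesis by simp
    qed
    ultimately show False using c_notin_N by simp
  qed
qed (use x y in auto)

text \<open>The element \<open>w\<close> must have a centralizer that is larger than
  \<open>S2\<close> and nonabelian; \<open>e\<close> and \<open>s\<close> witness this. If
  \<open>c [^] p\<close> is trivial, then \<open>c\<close>, \<open>x\<close>, \<open>d\<close>
  serve. Otherwise \<open>c [^] p\<close> generates \<open>Z\<close>, some
  \<open>d \<otimes> c [^] m\<close> has trivial \<open>p\<close>-th power and is taken as
  \<open>w\<close>, with \<open>s = c\<close> and a product of a power of \<open>x\<close> with
  \<open>y\<close> as \<open>e\<close>.\<close>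

lemma order_p_element_with_partner:
  obtains w e s where "w \<in> S2" "w \<notin> Z" "w [^] p = \<one>" "S2 \<subseteq> centralizer w"
    "e \<in> carrier G" "e \<otimes> w = w \<otimes> e" "e \<notin> S2" "s \<in> S2" "s \<otimes> e \<noteq> e \<otimes> s"
proof (cases "c [^] p = \<one>")
  case True
  show ?thesis
    by (rule that[OF c_S2 c_notin True S2_centralizer[OF c HOL.refl cd[symmetric]] x cx[symmetric] x_notin d_S2 dx_neq])
next
  case False
  obtain m :: nat where m: "d [^] p \<otimes> (c [^] p) [^] m = \<one>"
    by (rule prime_order_solve[OF fin Z p card_Z dp cp False])
  let ?w = "e m"
  have wp: "?w [^] p = \<one>" unfolding e_pow using m by (simp add: nat_pow_pow mult.commute)
  have cw: "c \<otimes> ?w = ?w \<otimes> c"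
  proof -
    have "c \<otimes> ?w = (c \<otimes> d) \<otimes> c [^] m" by (simp add: e_def m_assoc)
    also have "\<dots> = d \<otimes> (c \<otimes> c [^] m)" unfolding cd by (simp add: m_assoc)
    also have "c \<otimes> c [^] m = c [^] m \<otimes> c" by (metis c nat_pow_Suc nat_pow_Suc2)
    finally show ?thesis by (simp add: e_def m_assoc)
  qed
  have dw: "d \<otimes> ?w = ?w \<otimes> d"
    unfolding e_def by (simp add: m_assoc c_pow_d)
  have S2w: "S2 \<subseteq> centralizer ?w" by (rule S2_centralizer[OF e_carrier cw dw])
  have wx: "?w \<otimes> x = x \<otimes> ?w \<otimes> z2"
  proof -
    have "c [^] m \<otimes> x = x \<otimes> c [^] m" using cx by (metis c x group_commutes_pow)
    then have "?w \<otimes> x = d \<otimes> x \<otimes> c [^] m" by (simp add: e_def m_assoc)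
    also have "\<dots> = x \<otimes> d \<otimes> (z2 \<otimes> c [^] m)" unfolding dx by (simp add: m_assoc)
    also have "\<dots> = x \<otimes> ?w \<otimes> z2" using center_commutes[OF z2(1), of "c [^] m"] by (simp add: e_def m_assoc)
    finally show ?thesis .
  qed
  have wy: "?w \<otimes> y = y \<otimes> ?w \<otimes> z1 [^] m"
    unfolding e_def by (rule commutation_mult_pow[OF cy z1(1) c y d dy])
  \<comment> \<open>Passing \<open>y\<close> costs \<open>?w\<close> a factor
    \<open>z1 [^] m\<close>, passing \<open>x [^] k\<close> a factor \<open>z2 [^] k\<close>; the
    exponent \<open>k\<close> makes them cancel.\<close>
  obtain k :: nat where k: "z1 [^] m \<otimes> z2 [^] k = \<one>"
    by (rule prime_order_solve[OF fin Z p card_Z subgroup_nat_pow[OF Z z1(1)] z2])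
  let ?e = "x [^] k \<otimes> y"
  have "x \<otimes> ?w = ?w \<otimes> x \<otimes> inv z2" by (rule commutation_inv[OF wx z2(1)]) simp_all
  have wxk: "?w \<otimes> x [^] k = x [^] k \<otimes> ?w \<otimes> z2 [^] k"
  proof -
    have "x [^] k \<otimes> ?w = ?w \<otimes> x [^] k \<otimes> (inv z2) [^] k"
      by (rule commutation_pow[OF \<open>x \<otimes> ?w = ?w \<otimes> x \<otimes> inv z2\<close> subgroup.m_inv_closed[OF Z z2(1)]]) simp_all
    then have "?w \<otimes> x [^] k = x [^] k \<otimes> ?w \<otimes> inv ((inv z2) [^] k)"
      by (rule commutation_inv[OF _ subgroup_nat_pow[OF Z subgroup.m_inv_closed[OF Z z2(1)]]]) simp_all
    then show ?thesis by (simp add: nat_pow_inv)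
  qed
  have ew: "?e \<otimes> ?w = ?w \<otimes> ?e"
  proof -
    have "?w \<otimes> ?e = (?w \<otimes> x [^] k) \<otimes> y" by (simp add: m_assoc)
    also have "\<dots> = x [^] k \<otimes> ?w \<otimes> (z2 [^] k \<otimes> y)" unfolding wxk by (simp add: m_assoc)
    also have "z2 [^] k \<otimes> y = y \<otimes> z2 [^] k"
      by (rule center_commutes[OF subgroup_nat_pow[OF Z z2(1)] y])
    also have "x [^] k \<otimes> ?w \<otimes> (y \<otimes> z2 [^] k) = x [^] k \<otimes> (?w \<otimes> y) \<otimes> z2 [^] k" by (simp add: m_assoc)
    also have "\<dots> = ?e \<otimes> ?w \<otimes> (z1 [^] m \<otimes> z2 [^] k)" unfolding wy by (simp add: m_assoc)
    finally show ?thesis unfolding k by simp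
  qed
  have ce: "c \<otimes> ?e \<noteq> ?e \<otimes> c"
  proof
    assume eq: "c \<otimes> ?e = ?e \<otimes> c"
    have "c \<otimes> x [^] k = x [^] k \<otimes> c" using cx by (metis c x group_commutes_pow)
    then have "x [^] k \<otimes> (c \<otimes> y) = x [^] k \<otimes> (y \<otimes> c)" using eq by (simp add: m_assoc[symmetric]) 
    then have "c \<otimes> y = y \<otimes> c" by simp
    then show False using cy_neq by simp
  qed
  have "S2 \<subseteq> centralizer c" by (rule S2_centralizer[OF c HOL.refl cd[symmetric]])
  then have "?e \<notin> S2" using ce by (auto simp: centralizer_def)
  then show ?thesis by (rule that[OF e_S2 e_notin wp S2w _ ew _ c_S2 ce, rotated]) simp
qed

end

section \<open>The decomposition\<close>

context phi_group
begin

text \<open>If \<open>w \<in> S2 - Z\<close> has order \<open>p\<close>, its centralizer \<open>C\<close> has order \<open>p\<^sup>4\<close> and \<open>C/\<langle>w\<rangle>\<close> is extraspecial of order \<open>p\<^sup>3\<close>;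
  a noncentral element of order \<open>p\<close> in this quotient provides the second generator of \<open>B\<close>.\<close>

lemma complement_of_center:
  "\<exists>B. subgroup B G \<and> card B = p ^ 2 \<and> (\<forall>i. 0 < i \<longrightarrow> i < p \<longrightarrow> z1 [^] i \<notin> B)"
proof -
  obtain w e s where w: "w \<in> S2" "w \<notin> Z" "w [^] p = \<one>" and S2w: "S2 \<subseteq> centralizer w"
    and e: "e \<in> carrier G" "e \<otimes> w = w \<otimes> e" "e \<notin> S2" and s: "s \<in> S2" "s \<otimes> e \<noteq> e \<otimes> s"
    by (rule order_p_element_with_partner)
  have wc: "w \<in> carrier G" and sc: "s \<in> carrier G" using S2 w s by (auto intro: subgroup.mem_carrier)
  have one: "subgroup {\<one>} G" by (rule triv_subgroup)
  define W where "W = adj {\<one>} w"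
  have W: "subgroup W G" unfolding W_def by (rule subgroup_adj[OF fin one wc]) (simp add: wc)
  have w1: "w \<noteq> \<one>" using w(2) subgroup.one_closed[OF Z] by auto
  have card_W: "card W = p" unfolding W_def using card_adj[OF one wc p] w(3) w1 by simp
  have w_W: "w \<in> W" unfolding W_def by (rule adj_self[OF one wc])
  \<comment> \<open>\<open>W\<close> meets \<open>Z\<close> trivially: a nontrivial power of
    \<open>w\<close> in \<open>Z\<close> would bring \<open>w\<close> into \<open>Z\<close>.\<close>
  have z1_W: "z1 \<notin> W"
  proof
    assume "z1 \<in> W"
    then obtain l j where j: "l \<in> {\<one>}" "j < p" "z1 = l \<otimes> w [^] (j::nat)"
      unfolding W_def using adj_cases[OF one wc _ p0] w(3) by blast
    then have eq: "z1 = w [^] j" using wc by simp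
    show False
    proof (cases "j = 0")
      case True
      then show False using eq z1 by simp
    next
      case False
      then show False
        using nat_pow_in_prime[OF Z wc p, of j] w j(2) eq z1 subgroup.one_closed[OF Z] by auto
    qed
  qed
  have z1p: "z1 [^] p = \<one>" by (rule prime_order_generator(2)[OF fin Z p card_Z z1])
  define C where "C = centralizer w"
  have C: "subgroup C G" unfolding C_def by (rule centr[OF wc])
  have CG: "C \<subseteq> carrier G" using C by (rule subgroup.subset)
  have S2C: "S2 \<subseteq> C" using S2w by (simp add: C_def)
  have eC: "e \<in> C" using e by (simp add: C_def centralizer_def)
  have w_C: "w \<in> C" using wc by (simp add: C_def centralizer_def)
  \<comment> \<open>\<open>C\<close> lies strictly between \<open>S2\<close>, because of
    \<open>e\<close>, and \<open>G\<close>, because \<open>w\<close> is not central.\<close>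
  have card_C: "card C = p ^ 4"
  proof -
    have "card C dvd p ^ 5" using subgroup_card_dvd[OF fin C subgroup_self CG] card_G by simp
    then obtain a where a: "a \<le> 5" "card C = p ^ a" using p by (metis divides_primepow_nat)
    have finC: "finite C" using CG fin finite_subset by blast
    have "card S2 < card C"
      using S2C eC e(3) finC by (intro psubset_card_mono) auto
    then have "p ^ 3 < p ^ a" using card_S2 a by simp
    then have "3 < a" using p0 by (metis power_less_imp_less_exp prime_gt_1_nat[OF p])
    moreover have "a \<noteq> 5"
    proof
      assume "a = 5"
      then have "C = carrier G" using a card_G card_subset_eq[OF fin CG] by simp
      then have "w \<otimes> g = g \<otimes> w" if "g \<in> carrier G" for g
        using that centralizer_commutes[of g w] by (simp add: C_def)
      then have "w \<in> Z" using wc by (simp add: center_def)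
      then show False using w(2) by simp
    qed
    ultimately have "a = 4" using a(1) by simp
    then show ?thesis using a by simp
  qed
  have card_C': "card C = p * card S2" using card_C card_S2 by (simp add: eval_nat_numeral)
  \<comment> \<open>\<open>C\<close> is abelian modulo \<open>Z\<close>: \<open>S2\<close> is
    central modulo \<open>Z\<close> and has prime index in \<open>C\<close>, so that
    \<open>e\<close> together with \<open>S2\<close> generates \<open>C\<close>.\<close>
  have C_cmod: "C \<subseteq> cmod Z h" if h: "h \<in> C" for h
  proof -
    have all: "C \<subseteq> cmod Z h" if "h \<in> C" "e \<in> cmod Z h" for h
    proof -
      have hc: "h \<in> carrier G" using that CG by auto
      have "subgroup (C \<inter> cmod Z h) G"
        using subgroups_Inter_pair[OF C subgroup_cmod[OF Z_normal hc]] .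
      from prime_index_maximal[OF fin S2 this C _ _ card_C' p _ e(3)]
      have "C \<inter> cmod Z h = C" using S2C S2_central_mod_Z[OF hc] eC that by auto
      then show ?thesis by blast
    qed
    have "C \<subseteq> cmod Z e" by (rule all[OF eC cmod_self[OF Z e(1)]])
    then have "h \<in> cmod Z e" using h by blast
    then have "e \<in> cmod Z h" using cmod_sym[OF Z _ e(1)] h CG by blast
    then show ?thesis by (rule all[OF h])
  qed
  have Z_gen: "\<exists>k::nat. t = z1 [^] k" if "t \<in> Z" for t
    using that prime_order_generator(1)[OF fin Z p card_Z z1] by (auto simp: adj_def)
  have C_comm: "\<exists>k::nat. g \<otimes> h = h \<otimes> g \<otimes> z1 [^] k" if g: "g \<in> C" and h: "h \<in> C" for g h
  proof -
    have gh: "g \<in> carrier G" "h \<in> carrier G" using g h CG by auto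
    have "g \<otimes> h \<otimes> inv g \<otimes> inv h \<in> Z" using C_cmod[OF h] g by (auto simp: cmod_def)
    then obtain k :: nat where k: "g \<otimes> h \<otimes> inv g \<otimes> inv h = z1 [^] k" using Z_gen by blast
    have "(g \<otimes> h \<otimes> inv g \<otimes> inv h) \<otimes> (h \<otimes> g) = g \<otimes> h \<otimes> (inv g \<otimes> ((inv h \<otimes> h) \<otimes> g))"
      using gh by (simp only: m_assoc m_closed inv_closed)
    then have "g \<otimes> h = z1 [^] k \<otimes> (h \<otimes> g)" unfolding k using gh by simp
    also have "\<dots> = h \<otimes> g \<otimes> z1 [^] k"
      using center_commutes[OF subgroup_nat_pow[OF Z z1(1)]] gh by simp
    finally show ?thesis by blast
  qed
  let ?C = "G\<lparr>carrier := C\<rparr>"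
  interpret K: group ?C by (rule subgroup_imp_group[OF C])
  have cosets: "r_coset ?C H g = H #> g" for H g by (simp add: r_coset_def)
  have pow: "u [^]\<^bsub>?C\<^esub> (i::nat) = u [^] i" for u i by (rule nat_pow_consistent[symmetric])
  have WC: "W \<subseteq> C" unfolding W_def by (rule adj_subset[OF C _ w_C]) (simp add: subgroup.one_closed[OF C])
  have W_central: "W \<subseteq> centralizer g" if "g \<in> C" for g
    unfolding W_def using that CG wc
    by (intro adj_subset[OF centr]) (auto simp: C_def centralizer_def)
  have WK: "W \<lhd> ?C"
  proof -
    have "g \<otimes> h \<otimes> inv\<^bsub>?C\<^esub> g \<in> W" if "g \<in> C" "h \<in> W" for g h
    proof -
      have "g \<otimes> h \<otimes> inv g = h"
        using that W_central[OF that(1)] CG by (intro conj_centralizer) auto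
      then show ?thesis using that m_inv_consistent[OF C that(1)] by simp
    qed
    then show ?thesis using subgroup_incl[OF W C WC] by (auto simp: K.normal_inv_iff)
  qed
  have z1C: "z1 \<in> C" using Z_S2 S2C z1 by blast
  have "\<exists>v\<in>carrier ?C. v [^]\<^bsub>?C\<^esub> p \<in> W \<and> v \<notin> K.adj W z1"
  proof (rule K.quotient_order_p3_element[OF _ p odd WK _ _ z1_W])
    show "finite (carrier ?C)" using finite_subset[OF CG fin] by simp
    show "card (carrier ?C) = p ^ 3 * card W" using card_C card_W by (simp add: eval_nat_numeral)
    show "z1 \<in> carrier ?C" using z1C by simp
    show "z1 [^]\<^bsub>?C\<^esub> p \<in> W" unfolding pow z1p by (rule subgroup.one_closed[OF W])
    show "\<forall>g\<in>carrier ?C. W #>\<^bsub>?C\<^esub> (z1 \<otimes>\<^bsub>?C\<^esub> g) = W #>\<^bsub>?C\<^esub> (g \<otimes>\<^bsub>?C\<^esub> z1)"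
    proof
      fix g assume "g \<in> carrier ?C"
      then have "g \<in> carrier G" using CG by auto
      then show "W #>\<^bsub>?C\<^esub> (z1 \<otimes>\<^bsub>?C\<^esub> g) = W #>\<^bsub>?C\<^esub> (g \<otimes>\<^bsub>?C\<^esub> z1)"
        using center_commutes[OF z1(1)] by simp
    qed
    show "\<forall>g\<in>carrier ?C. \<forall>h\<in>carrier ?C. \<exists>k::nat. W #>\<^bsub>?C\<^esub> (g \<otimes>\<^bsub>?C\<^esub> h) = W #>\<^bsub>?C\<^esub> (h \<otimes>\<^bsub>?C\<^esub> g \<otimes>\<^bsub>?C\<^esub> z1 [^]\<^bsub>?C\<^esub> k)"
    proof (intro ballI)
      fix g h assume "g \<in> carrier ?C" "h \<in> carrier ?C"
      then obtain k :: nat where "g \<otimes> h = h \<otimes> g \<otimes> z1 [^] k" using C_comm[of g h] by auto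
      then show "\<exists>k::nat. W #>\<^bsub>?C\<^esub> (g \<otimes>\<^bsub>?C\<^esub> h) = W #>\<^bsub>?C\<^esub> (h \<otimes>\<^bsub>?C\<^esub> g \<otimes>\<^bsub>?C\<^esub> z1 [^]\<^bsub>?C\<^esub> k)"
        by (intro exI[of _ k]) (simp add: pow)
    qed
    show "s \<in> carrier ?C" "e \<in> carrier ?C" using s S2C eC by auto
    \<comment> \<open>The commutator of \<open>s\<close> and \<open>e\<close> is a nontrivial
      element of \<open>Z\<close>, hence a generator; lying in \<open>W\<close>, it would force
      \<open>z1\<close> into \<open>W\<close>.\<close>
    show "W #>\<^bsub>?C\<^esub> (s \<otimes>\<^bsub>?C\<^esub> e) \<noteq> W #>\<^bsub>?C\<^esub> (e \<otimes>\<^bsub>?C\<^esub> s)"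
    proof
      assume "W #>\<^bsub>?C\<^esub> (s \<otimes>\<^bsub>?C\<^esub> e) = W #>\<^bsub>?C\<^esub> (e \<otimes>\<^bsub>?C\<^esub> s)"
      then have "s \<otimes> e \<otimes> inv (e \<otimes> s) \<in> W"
        using coset_eq_iff[OF W, of "s \<otimes> e" "e \<otimes> s"] sc e(1) by (simp add: cosets)
      then have t: "s \<otimes> e \<otimes> inv s \<otimes> inv e \<in> W" using sc e(1) by (simp add: inv_mult_group m_assoc)
      have tZ: "s \<otimes> e \<otimes> inv s \<otimes> inv e \<in> Z" using S2_central_mod_Z[OF e(1)] s(1) by (auto simp: cmod_def)
      have "s \<otimes> e \<otimes> inv s \<otimes> inv e \<noteq> \<one>"
      proof
        assume "s \<otimes> e \<otimes> inv s \<otimes> inv e = \<one>"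
        then have "(s \<otimes> e) \<otimes> inv (e \<otimes> s) = \<one>" using sc e(1) by (simp add: inv_mult_group m_assoc)
        then have "s \<otimes> e = \<one> \<otimes> (e \<otimes> s)" using sc e(1) by (metis inv_solve_right m_closed one_closed)
        then show False using s(2) sc e(1) by simp
      qed
      then have "Z = adj {\<one>} (s \<otimes> e \<otimes> inv s \<otimes> inv e)"
        by (rule prime_order_generator(1)[OF fin Z p card_Z tZ])
      also have "\<dots> \<subseteq> W" using subgroup.one_closed[OF W] by (intro adj_subset[OF W _ t]) simp
      finally show False using z1 z1_W by blast
    qed
  qed
  then obtain v where v: "v \<in> C" "v [^] p \<in> W" "v \<notin> adj W z1"
    by (auto simp: pow K.adj_def adj_def)
  have vc: "v \<in> carrier G" using v(1) CG by blast
  have Wz: "subgroup (adj W z1) G"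
    by (rule subgroup_adj[OF fin W z1_carrier])
      (use center_commutes[OF z1(1)] W in \<open>auto simp: subgroup.mem_carrier m_assoc\<close>)
  have W_Wz: "W \<subseteq> adj W z1" by (rule adj_base[OF W z1_carrier])
  have vW: "v \<notin> W" using v(3) W_Wz by blast
  have B: "subgroup (adj W v) G"
  proof (rule subgroup_adj[OF fin W vc])
    fix k assume "k \<in> W"
    then show "v \<otimes> k \<otimes> inv v \<in> W" using W_central[OF v(1)] conj_centralizer[OF _ vc] by auto
  qed
  have card_B: "card (adj W v) = p ^ 2"
    using card_adj[OF W vc p v(2) vW] card_W by (simp add: power2_eq_square)
  \<comment> \<open>A factor \<open>v [^] j\<close> with \<open>0 < j < p\<close> would lie in
    \<open>adj W z1\<close>, and so would \<open>v\<close>, against its choice; without such a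
    factor the power of \<open>z1\<close> lies in \<open>W\<close>, against
    \<open>z1_W\<close>.\<close>
  have notin: "z1 [^] i \<notin> adj W v" if i: "0 < i" "i < p" for i
  proof
    assume "z1 [^] i \<in> adj W v"
    then obtain l j where j: "l \<in> W" "j < p" "z1 [^] i = l \<otimes> v [^] (j::nat)"
      by (rule adj_cases[OF W vc v(2) p0])
    have lc: "l \<in> carrier G" using W j(1) by (rule subgroup.mem_carrier)
    show False
    proof (cases "j = 0")
      case True
      then have "z1 [^] i \<in> W" using j lc by simp
      then show False
        using nat_pow_in_prime[OF W z1_carrier p _ _ i] z1p subgroup.one_closed[OF W] z1_W by simp
    next
      case False
      have "v [^] j = inv l \<otimes> z1 [^] i" unfolding j(3) using lc vc by (simp add: m_assoc[symmetric])
      also have "\<dots> \<in> adj W z1"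
        using subgroup.m_closed[OF Wz subgroup.m_inv_closed[OF Wz subsetD[OF W_Wz j(1)]]
            subgroup_nat_pow[OF Wz adj_self[OF W z1_carrier]]] .
      finally have "v [^] j \<in> adj W z1" .
      then show False
        using nat_pow_in_prime[OF Wz vc p _ _ _ j(2)] v W_Wz False by blast
    qed
  qed
  show ?thesis using B card_B notin by blast
qed

text \<open>Here \<open>z1\<close> generates the center, and the product of \<open>B\<close> with
  the center has order p^3, hence index p^2. The ramification condition is
  \<open>fully_ramified\<close>, every element of \<open>Z\<close> being a power of
  \<open>z1\<close>.\<close>

lemma big_representation:
  assumes root: "primitive_root_of_unity p \<zeta>"
  shows "\<exists>M. matrix_rep G (p ^ 2) (rat_adjoin \<zeta>) M \<and>
    (\<forall>f. (\<forall>s<p ^ 2. \<forall>t<p ^ 2. (\<Sum>g\<in>carrier G. of_rat (f g) * M g s t) = 0) \<longrightarrow>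
      (\<forall>g\<in>carrier G. f (z1 \<otimes> g) = f g))"
proof -
  obtain B where B: "subgroup B G" "card B = p ^ 2" "\<And>i. 0 < i \<Longrightarrow> i < p \<Longrightarrow> z1 [^] i \<notin> B"
    using complement_of_center by blast
  have z1p: "z1 [^] p = \<one>" by (rule prime_order_generator(2)[OF fin Z p card_Z z1])
  have Z_gen: "\<exists>i<p. t = z1 [^] i" if "t \<in> Z" for t
  proof -
    have "t \<in> adj {\<one>} z1" using that prime_order_generator(1)[OF fin Z p card_Z z1] by simp
    then obtain l i where "l \<in> {\<one>}" "i < p" "t = l \<otimes> z1 [^] (i::nat)"
      using adj_cases[OF triv_subgroup z1_carrier _ p0] z1p by blast
    then show ?thesis by auto
  qed
  have "induction_data G p (p ^ 2) z1 B \<zeta>"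
  proof (intro induction_data.intro induction_data_axioms.intro)
    show "card (carrier G) = p * p ^ 2 * card B" using card_G B(2) by (simp add: eval_nat_numeral)
    show "g \<otimes> z1 = z1 \<otimes> g" if "g \<in> carrier G" for g using center_commutes[OF z1(1) that] by simp
    show "\<exists>h\<in>carrier G. \<exists>i>0. i < p \<and> inv h \<otimes> (g \<otimes> h) = g \<otimes> z1 [^] i"
      if g: "g \<in> carrier G" and off: "\<And>i. i < p \<Longrightarrow> g \<noteq> z1 [^] i" for g
    proof -
      have "g \<notin> Z" using Z_gen off by blast
      then obtain h t where h: "h \<in> carrier G" "t \<in> Z" "t \<noteq> \<one>" "g \<otimes> h = h \<otimes> g \<otimes> t"
        using fully_ramified[OF g] by blast
      obtain i where i: "i < p" "t = z1 [^] i" using Z_gen[OF h(2)] by blast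
      have "i \<noteq> 0" using h(3) i by (cases "i = 0") auto
      moreover have "inv h \<otimes> (g \<otimes> h) = g \<otimes> z1 [^] i"
        unfolding h(4) i(2) using g h(1) by (simp add: m_assoc[symmetric])
      ultimately show ?thesis using h i by blast
    qed
  qed (use fin p root B z1p is_group in auto)
  then interpret I: induction_data G p "p ^ 2" z1 B \<zeta> .
  show ?thesis
    by (rule I.induced_representation, rule exI, rule conjI, assumption) blast
qed

section \<open>The common kernel of the representations and of the abelianization\<close>

text \<open>The summand depends on an element \<open>t \<otimes> u [^] j\<close> only through
  \<open>j\<close>; the factor \<open>p\<close> is the order of \<open>Z\<close>.\<close>

lemma sum_coset_adj:
  fixes f :: "'a \<Rightarrow> rat"
  assumes inv: "\<And>t g. t \<in> Z \<Longrightarrow> g \<in> carrier G \<Longrightarrow> f (t \<otimes> g) = f g"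
    and u: "u \<in> carrier G" "u [^] p \<in> Z" "u \<notin> Z" and g: "g \<in> carrier G"
  shows "(\<Sum>h\<in>adj Z u #> g. f h) = of_nat p * (\<Sum>j<p. f (u [^] j \<otimes> g))"
proof -
  have sub: "adj Z u \<subseteq> carrier G"
    using adj_subset[OF subgroup_self subgroup.subset[OF Z] u(1)] .
  have "adj Z u #> g = (\<lambda>h. h \<otimes> g) ` adj Z u" by (auto simp: r_coset_def)
  moreover have "inj_on (\<lambda>h. h \<otimes> g) (adj Z u)"
    using sub g by (intro inj_onI) (metis r_cancel subsetD)
  ultimately have "(\<Sum>h\<in>adj Z u #> g. f h) = (\<Sum>h\<in>adj Z u. f (h \<otimes> g))" by (simp add: sum.reindex)
  also have "\<dots> = (\<Sum>(t, j)\<in>Z \<times> {..<p}. f (t \<otimes> u [^] j \<otimes> g))"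
    using sum.reindex_bij_betw[OF bij_adj[OF Z u(1) p u(2,3)], of "\<lambda>h. f (h \<otimes> g)"]
    by (simp add: case_prod_unfold)
  also have "\<dots> = (\<Sum>(t, j)\<in>Z \<times> {..<p}. f (u [^] j \<otimes> g))"
    using inv u g by (intro sum.cong HOL.refl) (auto simp: m_assoc center_carrier)
  also have "\<dots> = (\<Sum>t\<in>Z. \<Sum>j<p. f (u [^] j \<otimes> g))" by (rule sum.cartesian_product[symmetric])
  finally show ?thesis using card_Z by simp
qed

text \<open>Reduction to \<open>affine_plane_zero\<close> on the coset of \<open>S2\<close> through
  \<open>g\<close>, where \<open>d [^] j \<otimes> c [^] b \<otimes> g\<close> has coordinates
  \<open>(j, b)\<close>. Cosets of \<open>S1\<close> are the vertical lines, and since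
  \<open>e i [^] j = d [^] j \<otimes> c [^] (i * j)\<close>, cosets of \<open>N i\<close> are the
  lines of slope \<open>i\<close>.\<close>

lemma joint_kernel:
  fixes f :: "'a \<Rightarrow> rat"
  assumes big: "\<forall>g\<in>carrier G. f (z1 \<otimes> g) = f g"
    and small: "\<And>i g. i < p \<Longrightarrow> g \<in> carrier G \<Longrightarrow> (\<Sum>h\<in>N i #> (c \<otimes> g). f h) = (\<Sum>h\<in>N i #> g. f h)"
    and lin: "\<And>g. g \<in> carrier G \<Longrightarrow> (\<Sum>h\<in>S1 #> g. f h) = 0"
    and g: "g \<in> carrier G"
  shows "f g = 0"
proof -
  have inv: "f (t \<otimes> g) = f g" if t: "t \<in> Z" and g: "g \<in> carrier G" for t g
  proof -
    have "f (z1 [^] (k::nat) \<otimes> g) = f g" for k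
    proof (induction k)
      case (Suc k)
      have "f (z1 [^] Suc k \<otimes> g) = f (z1 \<otimes> (z1 [^] k \<otimes> g))"
        using g nat_pow_Suc2[OF z1_carrier, of k] by (simp add: m_assoc del: nat_pow_Suc)
      then show ?case using big g Suc by simp
    qed (use g in simp)
    moreover have "t \<in> adj {\<one>} z1" using t prime_order_generator(1)[OF fin Z p card_Z z1] by simp
    ultimately show ?thesis by (auto simp: adj_def)
  qed
  define h where "h j b = f (d [^] (j::nat) \<otimes> c [^] (b::nat) \<otimes> g)" for j b
  have pn: "(of_nat p :: rat) \<noteq> 0" using p0 by simp
  have "h 0 0 = 0"
  proof (rule affine_plane_zero[OF p, where h = h])
    fix j b :: nat
    have "d [^] j \<otimes> c [^] (b + p) \<otimes> g = d [^] j \<otimes> c [^] b \<otimes> (c [^] p \<otimes> g)"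
      unfolding nat_pow_mult[OF c, symmetric] using g by (simp only: m_assoc m_closed nat_pow_closed c d)
    also have "\<dots> = (d [^] j \<otimes> c [^] b \<otimes> c [^] p) \<otimes> g" using g by (simp add: m_assoc)
    also have "d [^] j \<otimes> c [^] b \<otimes> c [^] p = c [^] p \<otimes> (d [^] j \<otimes> c [^] b)"
      by (rule center_commutes[OF cp, symmetric]) simp
    also have "\<dots> \<otimes> g = c [^] p \<otimes> (d [^] j \<otimes> c [^] b \<otimes> g)" using g by (simp add: m_assoc)
    finally show "h j (b + p) = h j b" unfolding h_def using inv[OF cp] g by simp
  next
    fix j :: nat
    have "of_nat p * (\<Sum>b<p. f (c [^] b \<otimes> (d [^] j \<otimes> g))) = 0"
      using sum_coset_adj[OF inv c cp c_notin, of "d [^] j \<otimes> g"] lin[of "d [^] j \<otimes> g"] g by (simp add: S1_def)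
    then have "(\<Sum>b<p. f (c [^] b \<otimes> (d [^] j \<otimes> g))) = 0" using pn by simp
    moreover have "c [^] b \<otimes> (d [^] j \<otimes> g) = d [^] j \<otimes> c [^] b \<otimes> g" for b :: nat
    proof -
      have "c [^] b \<otimes> d [^] j = d [^] j \<otimes> c [^] b"
        using c_pow_d[of b] by (metis c d group_commutes_pow nat_pow_closed)
      then show ?thesis using g by (simp add: m_assoc[symmetric])
    qed
    ultimately show "(\<Sum>b<p. h j b) = 0" by (simp add: h_def)
  next
    fix i b :: nat assume i: "i < p"
    have eq: "e i [^] j \<otimes> (c [^] k \<otimes> g) = d [^] j \<otimes> c [^] (i * j + k) \<otimes> g" for j k :: nat
      unfolding e_pow nat_pow_mult[OF c, symmetric] using g by (simp only: m_assoc m_closed nat_pow_closed c d)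
    have "(\<Sum>h\<in>N i #> (c \<otimes> (c [^] b \<otimes> g)). f h) = (\<Sum>h\<in>N i #> (c [^] b \<otimes> g). f h)"
      using small[OF i, of "c [^] b \<otimes> g"] g by simp
    moreover have "c \<otimes> (c [^] b \<otimes> g) = c [^] Suc b \<otimes> g"
      using g nat_pow_Suc2[OF c, of b] by (simp add: m_assoc del: nat_pow_Suc)
    ultimately have "of_nat p * (\<Sum>j<p. f (e i [^] j \<otimes> (c [^] Suc b \<otimes> g))) = of_nat p * (\<Sum>j<p. f (e i [^] j \<otimes> (c [^] b \<otimes> g)))"
      using sum_coset_adj[OF inv e_carrier e_p e_notin, of "c [^] Suc b \<otimes> g"]
        sum_coset_adj[OF inv e_carrier e_p e_notin, of "c [^] b \<otimes> g"] g
      by (simp only: N_def[symmetric] m_closed nat_pow_closed c)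
    then show "(\<Sum>j<p. h j (i * j + Suc b)) = (\<Sum>j<p. h j (i * j + b))"
      using pn unfolding eq h_def by simp
  qed
  then show ?thesis using g by (simp add: h_def)
qed

theorem rat_group_algebra_iso:
  assumes root: "primitive_root_of_unity p \<zeta>"
  shows "rat_group_algebra G \<simeq>\<^sub>\<rat> rat_group_algebra (G Mod commutator_subgroup G)
    \<oplus>\<^sub>\<rat> alg_copies p (matrix_algebra p (rat_adjoin \<zeta>)) \<oplus>\<^sub>\<rat> matrix_algebra (p\<^sup>2) (rat_adjoin \<zeta>)"
proof -
  have "\<exists>M. matrix_rep G p (rat_adjoin \<zeta>) M \<and>
      (\<forall>f. (\<forall>s<p. \<forall>t<p. (\<Sum>g\<in>carrier G. of_rat (f g) * M g s t) = 0) \<longrightarrow>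
        (\<forall>g\<in>carrier G. (\<Sum>h\<in>N i #> (c \<otimes> g). f h) = (\<Sum>h\<in>N i #> g. f h)))" for i
    by (rule small_representation[OF root, of i], rule exI, rule conjI, assumption) blast
  then have "\<exists>M. \<forall>i. matrix_rep G p (rat_adjoin \<zeta>) (M i) \<and>
      (\<forall>f. (\<forall>s<p. \<forall>t<p. (\<Sum>g\<in>carrier G. of_rat (f g) * M i g s t) = 0) \<longrightarrow>
        (\<forall>g\<in>carrier G. (\<Sum>h\<in>N i #> (c \<otimes> g). f h) = (\<Sum>h\<in>N i #> g. f h)))"
    by (intro choice allI)
  then obtain M where M_all: "\<forall>i. matrix_rep G p (rat_adjoin \<zeta>) (M i) \<and>
      (\<forall>f. (\<forall>s<p. \<forall>t<p. (\<Sum>g\<in>carrier G. of_rat (f g) * M i g s t) = 0) \<longrightarrow>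
        (\<forall>g\<in>carrier G. (\<Sum>h\<in>N i #> (c \<otimes> g). f h) = (\<Sum>h\<in>N i #> g. f h)))" ..
  have M: "matrix_rep G p (rat_adjoin \<zeta>) (M i)" for i
    using M_all by (elim allE conjE)
  have M_ker: "(\<forall>s<p. \<forall>t<p. (\<Sum>g\<in>carrier G. of_rat (f g) * M i g s t) = 0) \<longrightarrow>
        (\<forall>g\<in>carrier G. (\<Sum>h\<in>N i #> (c \<otimes> g). f h) = (\<Sum>h\<in>N i #> g. f h))" for i f
    using M_all by (elim allE[of _ i] conjE allE[of _ f])
  obtain L where L: "matrix_rep G (p ^ 2) (rat_adjoin \<zeta>) L"
    and L_ker: "\<forall>f. (\<forall>s<p ^ 2. \<forall>t<p ^ 2. (\<Sum>g\<in>carrier G. of_rat (f g) * L g s t) = 0) \<longrightarrow>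
      (\<forall>g\<in>carrier G. f (z1 \<otimes> g) = f g)"
    using big_representation[OF root] by (elim exE conjE)
  show ?thesis
    unfolding derived_eq
  proof (rule group_algebra_decomposition[OF fin p root S1_normal M L])
    fix f :: "'a \<Rightarrow> rat" and g
    assume Mf: "\<And>i s t. i < p \<Longrightarrow> s < p \<Longrightarrow> t < p \<Longrightarrow> (\<Sum>g\<in>carrier G. of_rat (f g) * M i g s t) = 0"
      and Lf: "\<And>s t. s < p\<^sup>2 \<Longrightarrow> t < p\<^sup>2 \<Longrightarrow> (\<Sum>g\<in>carrier G. of_rat (f g) * L g s t) = 0"
      and Df: "\<And>g. g \<in> carrier G \<Longrightarrow> (\<Sum>x\<in>S1 #> g. f x) = 0" and g: "g \<in> carrier G"
    have "\<forall>g\<in>carrier G. f (z1 \<otimes> g) = f g" using L_ker Lf by blast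
    moreover have "(\<Sum>h\<in>N i #> (c \<otimes> g). f h) = (\<Sum>h\<in>N i #> g. f h)" if "i < p" "g \<in> carrier G" for i g
    proof -
      have "\<forall>s<p. \<forall>t<p. (\<Sum>g\<in>carrier G. of_rat (f g) * M i g s t) = 0" using Mf that(1) by blast
      from M_ker[rule_format, OF this[rule_format] that(2)] show ?thesis by simp
    qed
    ultimately show "f g = 0" using joint_kernel[of f g] Df g by blast
  next
    have "card (carrier (G Mod S1)) * p ^ 2 = p ^ 3 * p ^ 2"
      using lagrange[OF S1] card_G card_S1 by (simp add: FactGroup_def Coset.order_def power_add[symmetric])
    then have card_Q: "card (carrier (G Mod S1)) = p ^ 3"
      by (rule mult_right_cancel[THEN iffD1, rotated]) (use p0 in simp)
    obtain q where q: "p = Suc q" using p0 by (cases p) auto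
    \<comment> \<open>p^3 + (p^3 + p^4)(p - 1) telescopes to p^5; writing \<open>p = Suc q\<close>
      removes the subtraction of naturals.\<close>
    show "card (carrier (G Mod S1)) + (p * (p * p) + p\<^sup>2 * p\<^sup>2) * (p - 1) \<le> card (carrier G)"
      unfolding card_Q card_G by (simp add: q eval_nat_numeral algebra_simps)
  qed
qed

end

section \<open>Isoclinism and presentations\<close>

text \<open>The relations of \<^locale>\<open>phi_group\<close>, each stated as the value of a commutator or modulo the center, so
  that it carries over to isoclinic groups.\<close>

definition phi_relations :: "nat \<Rightarrow> ('a, 'b) monoid_scheme \<Rightarrow> 'a \<Rightarrow> 'a \<Rightarrow> 'a \<Rightarrow> 'a \<Rightarrow> bool" where
  "phi_relations p H x y c d \<longleftrightarrow>
    x \<in> carrier H \<and> y \<in> carrier H \<and> c \<in> carrier H \<and> d \<in> carrier H \<and>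
    comm H x y = c \<and> comm H c x = \<one>\<^bsub>H\<^esub> \<and> comm H c d = \<one>\<^bsub>H\<^esub> \<and> comm H d y = \<one>\<^bsub>H\<^esub> \<and>
    comm H c y \<in> center H \<and> comm H c y \<noteq> \<one>\<^bsub>H\<^esub> \<and> comm H d x \<in> center H \<and> comm H d x \<noteq> \<one>\<^bsub>H\<^esub> \<and>
    c [^]\<^bsub>H\<^esub> p \<in> center H \<and> d [^]\<^bsub>H\<^esub> p \<in> center H \<and>
    (\<exists>i::nat. x [^]\<^bsub>H\<^esub> p \<otimes>\<^bsub>H\<^esub> inv\<^bsub>H\<^esub> (c [^]\<^bsub>H\<^esub> i) \<in> center H) \<and>
    (\<exists>j::nat. y [^]\<^bsub>H\<^esub> p \<otimes>\<^bsub>H\<^esub> inv\<^bsub>H\<^esub> (d [^]\<^bsub>H\<^esub> j) \<in> center H) \<and>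
    (\<forall>S. subgroup S H \<longrightarrow> center H \<subseteq> S \<longrightarrow> x \<in> S \<longrightarrow> y \<in> S \<longrightarrow> d \<in> S \<longrightarrow> S = carrier H)"

context group
begin

lemma comm_closed [simp]: "x \<in> carrier G \<Longrightarrow> y \<in> carrier G \<Longrightarrow> comm G x y \<in> carrier G"
  by (simp add: comm_def)

lemma comm_commutation:
  assumes "x \<in> carrier G" "y \<in> carrier G" shows "x \<otimes> y = y \<otimes> x \<otimes> comm G x y"
proof -
  have "y \<otimes> x \<otimes> comm G x y = y \<otimes> ((x \<otimes> inv x) \<otimes> (inv y \<otimes> (x \<otimes> y)))"
    using assms unfolding comm_def by (simp only: m_assoc m_closed inv_closed)
  also have "\<dots> = y \<otimes> (inv y \<otimes> (x \<otimes> y))" using assms by simp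
  also have "\<dots> = (y \<otimes> inv y) \<otimes> (x \<otimes> y)" using assms by (simp only: m_assoc m_closed inv_closed)
  finally show ?thesis using assms by simp
qed

lemma comm_eqI:
  assumes "x \<in> carrier G" "y \<in> carrier G" "t \<in> carrier G" "x \<otimes> y = y \<otimes> x \<otimes> t" shows "comm G x y = t"
proof -
  have "(y \<otimes> x) \<otimes> comm G x y = (y \<otimes> x) \<otimes> t"
    using comm_commutation[OF assms(1,2)] assms(4) by simp
  then show ?thesis using assms by simp
qed

lemma comm_eq_one_iff:
  assumes "x \<in> carrier G" "y \<in> carrier G" shows "comm G x y = \<one> \<longleftrightarrow> x \<otimes> y = y \<otimes> x"
proof
  assume "comm G x y = \<one>"
  then show "x \<otimes> y = y \<otimes> x" using comm_commutation[OF assms] assms by simp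
next
  assume "x \<otimes> y = y \<otimes> x"
  then show "comm G x y = \<one>" using comm_eqI[OF assms one_closed] assms by simp
qed

lemma comm_swap:
  assumes "x \<in> carrier G" "y \<in> carrier G" shows "comm G y x = inv (comm G x y)"
  using assms unfolding comm_def by (simp add: inv_mult_group m_assoc)

lemma comm_in_derived:
  assumes "x \<in> carrier G" "y \<in> carrier G" shows "comm G x y \<in> derived G (carrier G)"
proof -
  have "inv x \<otimes> inv y \<otimes> inv (inv x) \<otimes> inv (inv y) \<in> derived G (carrier G)"
    unfolding derived_def
    by (rule generate.incl, rule UN_I[of "inv x"], simp add: assms, rule UN_I[of "inv y"]) (simp_all add: assms)
  then show ?thesis using assms by (simp add: comm_def)
qed

lemma center_normal: "center G \<lhd> G"
  using subgroup_center center_conj by (simp add: normal_inv_iff)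

lemma center_coset_iff: "g \<in> carrier G \<Longrightarrow> center G #> g = center G \<longleftrightarrow> g \<in> center G"
  using coset_join1[of "center G" g] coset_join2[of g "center G"] subgroup_center subgroup.subset by blast

lemma phi_group_of_relations:
  assumes fin: "finite (carrier G)" and "Factorial_Ring.prime p" "odd p" "card (carrier G) = p ^ 5"
    and rel: "phi_relations p G x y c d"
  shows "phi_group G p x y c d (comm G c y) (comm G d x)"
proof (intro phi_group.intro phi_group_axioms.intro)
  note r = rel[unfolded phi_relations_def]
  have car: "x \<in> carrier G" "y \<in> carrier G" "c \<in> carrier G" "d \<in> carrier G" using r by blast+
  then show "x \<in> carrier G" "y \<in> carrier G" "c \<in> carrier G" "d \<in> carrier G" by auto
  show "x \<otimes> y = y \<otimes> x \<otimes> c" using comm_commutation[OF car(1,2)] r by metis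
  show "c \<otimes> x = x \<otimes> c" "c \<otimes> d = d \<otimes> c" "d \<otimes> y = y \<otimes> d" using comm_eq_one_iff car r by metis+
  show "c \<otimes> y = y \<otimes> c \<otimes> comm G c y" "d \<otimes> x = x \<otimes> d \<otimes> comm G d x" using comm_commutation car by blast+
  show "comm G c y \<in> center G" "comm G c y \<noteq> \<one>" "comm G d x \<in> center G" "comm G d x \<noteq> \<one>"
    "c [^] p \<in> center G" "d [^] p \<in> center G" using r by blast+
  have adj_I: "u \<in> adj (center G) v" if uv: "u \<otimes> inv (v [^] (i::nat)) \<in> center G" "u \<in> carrier G" "v \<in> carrier G" for u v i
  proof -
    have "u = (u \<otimes> inv (v [^] i)) \<otimes> v [^] i" using uv by (simp add: m_assoc)
    then show ?thesis using adj_memI[OF uv(1), of v i] by simp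
  qed
  show "x [^] p \<in> adj (center G) c" using r adj_I car by blast
  show "y [^] p \<in> adj (center G) d" using r adj_I car by blast
  show "S = carrier G" if "subgroup S G" "center G \<subseteq> S" "x \<in> S" "y \<in> S" "d \<in> S" for S using that r by blast
qed (use assms is_group in auto)

end

text \<open>\<open>R\<close> relates elements whose central cosets correspond under \<phi>. It
  respects all operations and detects centrality, but equations only up to central factors; that a
  commutator equals 1 exactly is transported by \<psi> instead, in \<open>comm_one\<close>.\<close>

lemma isoclinic_phi_relations:
  fixes G :: "('a, 'b) monoid_scheme" and H :: "('c, 'd) monoid_scheme"
  assumes G: "group G" and H: "group H" and iso: "isoclinic G H" and rel: "phi_relations p H x' y' c' d'"
  shows "\<exists>x y c d. phi_relations p G x y c d"
proof -
  interpret G: group G by (rule G)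
  interpret H: group H by (rule H)
  let ?Z = "center G" and ?Z' = "center H"
  obtain \<phi> \<psi> where \<phi>: "\<phi> \<in> iso (G Mod ?Z) (H Mod ?Z')"
    and \<psi>: "\<psi> \<in> iso (G\<lparr>carrier := commutator_subgroup G\<rparr>) (H\<lparr>carrier := commutator_subgroup H\<rparr>)"
    and compat: "\<forall>x \<in> carrier G. \<forall>y \<in> carrier G. \<forall>x' \<in> carrier H. \<forall>y' \<in> carrier H.
        \<phi> (?Z #>\<^bsub>G\<^esub> x) = ?Z' #>\<^bsub>H\<^esub> x' \<longrightarrow> \<phi> (?Z #>\<^bsub>G\<^esub> y) = ?Z' #>\<^bsub>H\<^esub> y' \<longrightarrow>
        \<psi> (comm G x y) = comm H x' y'"
    using iso unfolding isoclinic_def by blast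
  interpret GZ: group "G Mod ?Z" by (rule normal.factorgroup_is_group[OF G.center_normal])
  interpret HZ: group "H Mod ?Z'" by (rule normal.factorgroup_is_group[OF H.center_normal])
  have \<phi>_hom: "\<phi> \<in> hom (G Mod ?Z) (H Mod ?Z')" and \<phi>_bij: "bij_betw \<phi> (carrier (G Mod ?Z)) (carrier (H Mod ?Z'))"
    using \<phi> by (auto simp: iso_def)
  define R where "R g h \<longleftrightarrow> g \<in> carrier G \<and> h \<in> carrier H \<and> \<phi> (?Z #>\<^bsub>G\<^esub> g) = ?Z' #>\<^bsub>H\<^esub> h" for g h
  have cosG: "?Z #>\<^bsub>G\<^esub> g \<in> carrier (G Mod ?Z)" if "g \<in> carrier G" for g using that by (auto simp: carrier_FactGroup)
  have cosH: "?Z' #>\<^bsub>H\<^esub> h \<in> carrier (H Mod ?Z')" if "h \<in> carrier H" for h using that by (auto simp: carrier_FactGroup)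
  have R_carrier: "g \<in> carrier G" "h \<in> carrier H" if "R g h" for g h using that by (auto simp: R_def)
  have R_left: "\<exists>h. R g h" if g: "g \<in> carrier G" for g
  proof -
    have "\<phi> (?Z #>\<^bsub>G\<^esub> g) \<in> carrier (H Mod ?Z')" using \<phi>_hom cosG[OF g] by (auto simp: hom_def)
    then show ?thesis using g by (auto simp: R_def carrier_FactGroup)
  qed
  have R_right: "\<exists>g. R g h" if h: "h \<in> carrier H" for h
  proof -
    have "?Z' #>\<^bsub>H\<^esub> h \<in> \<phi> ` carrier (G Mod ?Z)" using cosH[OF h] bij_betw_imp_surj_on[OF \<phi>_bij] by simp
    then show ?thesis using h by (auto simp: R_def carrier_FactGroup)
  qed
  have \<phi>_one: "\<phi> ?Z = ?Z'" using hom_one[OF \<phi>_hom GZ.is_group HZ.is_group] by simp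
  have R_mult: "R (g \<otimes>\<^bsub>G\<^esub> g') (h \<otimes>\<^bsub>H\<^esub> h')" if "R g h" "R g' h'" for g g' h h'
  proof -
    have c: "g \<in> carrier G" "g' \<in> carrier G" "h \<in> carrier H" "h' \<in> carrier H" using that R_carrier by auto
    have "\<phi> (?Z #>\<^bsub>G\<^esub> (g \<otimes>\<^bsub>G\<^esub> g')) = \<phi> ((?Z #>\<^bsub>G\<^esub> g) \<otimes>\<^bsub>G Mod ?Z\<^esub> (?Z #>\<^bsub>G\<^esub> g'))"
      using normal.rcos_sum[OF G.center_normal c(1,2)] by simp
    also have "\<dots> = \<phi> (?Z #>\<^bsub>G\<^esub> g) \<otimes>\<^bsub>H Mod ?Z'\<^esub> \<phi> (?Z #>\<^bsub>G\<^esub> g')"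
      by (rule hom_mult[OF \<phi>_hom cosG cosG]) (use c in auto)
    also have "\<dots> = ?Z' #>\<^bsub>H\<^esub> (h \<otimes>\<^bsub>H\<^esub> h')"
      using that normal.rcos_sum[OF H.center_normal c(3,4)] by (simp add: R_def)
    finally show ?thesis using c by (simp add: R_def)
  qed
  have R_center: "g \<in> ?Z \<longleftrightarrow> h \<in> ?Z'" if gh: "R g h" for g h
  proof -
    have c: "g \<in> carrier G" "h \<in> carrier H" using gh R_carrier by auto
    have "g \<in> ?Z \<longleftrightarrow> ?Z #>\<^bsub>G\<^esub> g = ?Z" using G.center_coset_iff[OF c(1)] by simp
    also have "\<dots> \<longleftrightarrow> \<phi> (?Z #>\<^bsub>G\<^esub> g) = \<phi> ?Z"
      using bij_betw_imp_inj_on[OF \<phi>_bij] cosG[OF c(1)] GZ.one_closed by (auto simp: inj_on_def)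
    also have "\<dots> \<longleftrightarrow> h \<in> ?Z'" using gh H.center_coset_iff[OF c(2)] by (simp add: R_def \<phi>_one)
    finally show ?thesis .
  qed
  have R_one: "R \<one>\<^bsub>G\<^esub> h" if "h \<in> ?Z'" for h
    using that H.center_carrier[OF that] H.center_coset_iff[of h] \<phi>_one
      G.coset_mult_one[OF subgroup.subset[OF G.subgroup_center]] by (simp add: R_def)
  have R_inv: "R (inv\<^bsub>G\<^esub> g) (inv\<^bsub>H\<^esub> h)" if gh: "R g h" for g h
  proof -
    have c: "g \<in> carrier G" "h \<in> carrier H" using gh R_carrier by auto
    obtain k where k: "R (inv\<^bsub>G\<^esub> g) k" using R_left c by blast
    then have kc: "k \<in> carrier H" by (rule R_carrier)
    have "R (g \<otimes>\<^bsub>G\<^esub> inv\<^bsub>G\<^esub> g) (h \<otimes>\<^bsub>H\<^esub> k)" by (rule R_mult[OF gh k])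
    then have "h \<otimes>\<^bsub>H\<^esub> k \<in> ?Z'"
      using R_center subgroup.one_closed[OF G.subgroup_center] c by auto
    then have "k \<otimes>\<^bsub>H\<^esub> inv\<^bsub>H\<^esub> (inv\<^bsub>H\<^esub> h) \<in> ?Z'"
      using H.center_conj[of "h \<otimes>\<^bsub>H\<^esub> k" "inv\<^bsub>H\<^esub> h"] c kc by (simp add: H.m_assoc[symmetric])
    then have "?Z' #>\<^bsub>H\<^esub> k = ?Z' #>\<^bsub>H\<^esub> inv\<^bsub>H\<^esub> h"
      using H.coset_eq_iff[OF H.subgroup_center kc] c by simp
    then show ?thesis using k c by (simp add: R_def)
  qed
  have R_pow: "R (g [^]\<^bsub>G\<^esub> (n::nat)) (h [^]\<^bsub>H\<^esub> n)" if "R g h" for g h n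
    using R_one[OF subgroup.one_closed[OF H.subgroup_center]] that by (induction n) (auto intro: R_mult)
  have R_comm: "R (comm G g g') (comm H h h')" if "R g h" "R g' h'" for g g' h h'
    unfolding comm_def using that by (intro R_mult R_inv)
  have \<psi>_comm: "\<psi> (comm G g g') = comm H h h'" if "R g h" "R g' h'" for g g' h h'
    using compat that by (simp add: R_def)
  have \<psi>_one: "\<psi> \<one>\<^bsub>G\<^esub> = \<one>\<^bsub>H\<^esub>"
  proof -
    have "R \<one>\<^bsub>G\<^esub> \<one>\<^bsub>H\<^esub>" by (rule R_one[OF subgroup.one_closed[OF H.subgroup_center]])
    from \<psi>_comm[OF this this] show ?thesis by (simp add: comm_def)
  qed
  have \<psi>_inj: "inj_on \<psi> (derived G (carrier G))" using \<psi> by (auto simp: iso_def bij_betw_def)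
  have comm_one: "comm G g g' = \<one>\<^bsub>G\<^esub> \<longleftrightarrow> comm H h h' = \<one>\<^bsub>H\<^esub>" if gh: "R g h" "R g' h'" for g g' h h'
  proof -
    have c: "g \<in> carrier G" "g' \<in> carrier G" using gh R_carrier by auto
    have "\<one>\<^bsub>G\<^esub> \<in> derived G (carrier G)"
      using subgroup.one_closed[OF G.derived_is_subgroup[of "carrier G"]] by simp
    then have "comm G g g' = \<one>\<^bsub>G\<^esub> \<longleftrightarrow> \<psi> (comm G g g') = \<psi> \<one>\<^bsub>G\<^esub>"
      using \<psi>_inj G.comm_in_derived[OF c] by (auto simp: inj_on_def)
    then show ?thesis using \<psi>_comm[OF gh] \<psi>_one by simp
  qed
  note r = rel[unfolded phi_relations_def]
  have car': "x' \<in> carrier H" "y' \<in> carrier H" "c' \<in> carrier H" "d' \<in> carrier H" using r by blast+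
  obtain x y d where x: "R x x'" and y: "R y y'" and d: "R d d'" using R_right car' by metis
  \<comment> \<open>Not an arbitrary element related to \<open>c'\<close>: the relation
    \<open>comm G x y = c\<close> must hold exactly, and \<open>R\<close> would give it only modulo
    the center.\<close>
  define c where "c = comm G x y"
  have c: "R c c'" unfolding c_def using R_comm[OF x y] r by simp
  obtain i :: nat where i: "x' [^]\<^bsub>H\<^esub> p \<otimes>\<^bsub>H\<^esub> inv\<^bsub>H\<^esub> (c' [^]\<^bsub>H\<^esub> i) \<in> ?Z'" using r by blast
  obtain j :: nat where j: "y' [^]\<^bsub>H\<^esub> p \<otimes>\<^bsub>H\<^esub> inv\<^bsub>H\<^esub> (d' [^]\<^bsub>H\<^esub> j) \<in> ?Z'" using r by blast
  \<comment> \<open>\<open>S\<close> is pushed to \<open>H\<close> along \<open>R\<close> and the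
    property of \<open>H\<close> is applied there. Coming back, an element of \<open>G\<close> and
    an element of \<open>S\<close> related to the same \<open>h\<close> differ by a central factor,
    which lies in \<open>S\<close>.\<close>
  have gen: "S = carrier G" if S: "subgroup S G" "?Z \<subseteq> S" "x \<in> S" "y \<in> S" "d \<in> S" for S
  proof -
    define S' where "S' = {h \<in> carrier H. \<exists>g\<in>S. R g h}"
    have "subgroup S' H"
    proof (rule H.subgroupI)
      show "S' \<noteq> {}" using x S car' by (auto simp: S'_def)
      show "inv\<^bsub>H\<^esub> h \<in> S'" if "h \<in> S'" for h
        using that R_inv subgroup.m_inv_closed[OF S(1)] by (auto simp: S'_def)
      show "h \<otimes>\<^bsub>H\<^esub> k \<in> S'" if "h \<in> S'" "k \<in> S'" for h k
        using that R_mult subgroup.m_closed[OF S(1)] unfolding S'_def by blast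
    qed (auto simp: S'_def)
    moreover have "?Z' \<subseteq> S'"
      using R_one H.center_carrier subgroup.one_closed[OF S(1)] by (auto simp: S'_def)
    moreover have "x' \<in> S'" "y' \<in> S'" "d' \<in> S'" using x y d S car' by (auto simp: S'_def)
    ultimately have S': "S' = carrier H" using r by blast
    have "g \<in> S" if g: "g \<in> carrier G" for g
    proof -
      obtain h where h: "R g h" using R_left g by blast
      then have "h \<in> S'" using S' R_carrier by blast
      then obtain k where k: "k \<in> S" "R k h" by (auto simp: S'_def)
      have kc: "k \<in> carrier G" using k R_carrier by blast
      have "R (g \<otimes>\<^bsub>G\<^esub> inv\<^bsub>G\<^esub> k) (h \<otimes>\<^bsub>H\<^esub> inv\<^bsub>H\<^esub> h)" by (intro R_mult R_inv h k)
      then have "g \<otimes>\<^bsub>G\<^esub> inv\<^bsub>G\<^esub> k \<in> ?Z"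
        using R_center R_carrier[OF h] subgroup.one_closed[OF H.subgroup_center] by auto
      then have "(g \<otimes>\<^bsub>G\<^esub> inv\<^bsub>G\<^esub> k) \<otimes>\<^bsub>G\<^esub> k \<in> S" using S k subgroup.m_closed[OF S(1)] by blast
      then show ?thesis using g kc by (simp add: G.m_assoc)
    qed
    then show ?thesis using subgroup.subset[OF S(1)] by blast
  qed
  have "phi_relations p G x y c d"
    unfolding phi_relations_def
  proof (intro conjI)
    show "x \<in> carrier G" "y \<in> carrier G" "c \<in> carrier G" "d \<in> carrier G" using x y c d R_carrier by blast+
    show "comm G x y = c" by (simp add: c_def)
    show "comm G c x = \<one>\<^bsub>G\<^esub>" using comm_one[OF c x] r by simp
    show "comm G c d = \<one>\<^bsub>G\<^esub>" using comm_one[OF c d] r by simp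
    show "comm G d y = \<one>\<^bsub>G\<^esub>" using comm_one[OF d y] r by simp
    show "comm G c y \<in> ?Z" using R_center[OF R_comm[OF c y]] r by simp
    show "comm G d x \<in> ?Z" using R_center[OF R_comm[OF d x]] r by simp
    show "comm G c y \<noteq> \<one>\<^bsub>G\<^esub>" using comm_one[OF c y] r by simp
    show "comm G d x \<noteq> \<one>\<^bsub>G\<^esub>" using comm_one[OF d x] r by simp
    show "c [^]\<^bsub>G\<^esub> p \<in> ?Z" using R_center[OF R_pow[OF c]] r by blast
    show "d [^]\<^bsub>G\<^esub> p \<in> ?Z" using R_center[OF R_pow[OF d]] r by blast
    show "\<exists>i::nat. x [^]\<^bsub>G\<^esub> p \<otimes>\<^bsub>G\<^esub> inv\<^bsub>G\<^esub> (c [^]\<^bsub>G\<^esub> i) \<in> ?Z"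
      using R_center[OF R_mult[OF R_pow[OF x] R_inv[OF R_pow[OF c]]]] i by blast
    show "\<exists>j::nat. y [^]\<^bsub>G\<^esub> p \<otimes>\<^bsub>G\<^esub> inv\<^bsub>G\<^esub> (d [^]\<^bsub>G\<^esub> j) \<in> ?Z"
      using R_center[OF R_mult[OF R_pow[OF y] R_inv[OF R_pow[OF d]]]] j by blast
    show "\<forall>S. subgroup S G \<longrightarrow> ?Z \<subseteq> S \<longrightarrow> x \<in> S \<longrightarrow> y \<in> S \<longrightarrow> d \<in> S \<longrightarrow> S = carrier G"
      using gen by blast
  qed
  then show ?thesis by blast
qed

text \<open>Elements of a presented group will be shown to be nontrivial by letting words act on points, the
  defining relations holding up to an equivalence relation \<open>E\<close> of points.\<close>

fun word_action :: "('g \<Rightarrow> bool \<Rightarrow> 'x \<Rightarrow> 'x) \<Rightarrow> 'g word \<Rightarrow> 'x \<Rightarrow> 'x" where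
  "word_action act [] v = v"
| "word_action act ((g, b) # w) v = act g b (word_action act w v)"

lemma word_action_append: "word_action act (u @ w) v = word_action act u (word_action act w v)"
  by (induction u) auto

lemma word_action_pow: "word_action act (word_pow w n) v = (word_action act w ^^ n) v"
  by (induction n) (simp_all add: word_pow_def word_action_append)

lemma word_eq_action:
  assumes "word_eq R u w" and refl: "\<And>v. E v v" and sym: "\<And>v v'. E v v' \<Longrightarrow> E v' v"
    and trans: "\<And>v v' v''. E v v' \<Longrightarrow> E v' v'' \<Longrightarrow> E v v''"
    and resp: "\<And>g b v v'. E v v' \<Longrightarrow> E (act g b v) (act g b v')"
    and inverse: "\<And>g b v. E (act g b (act g (\<not> b) v)) v"
    and rels: "\<And>l r v. (l, r) \<in> R \<Longrightarrow> E (word_action act l v) (word_action act r v)"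
  shows "E (word_action act u v) (word_action act w v)"
proof -
  have resp_word: "E (word_action act t v) (word_action act t v')" if "E v v'" for t v v'
    using that by (induction t) (auto intro: resp)
  from assms(1) show ?thesis
  proof (induction arbitrary: v)
    case (cancel u g b w)
    then show ?case using resp_word[OF inverse] by (simp add: word_action_append)
  next
    case (rel l r u w)
    then show ?case using resp_word[OF rels] by (simp add: word_action_append)
  qed (use refl sym trans in blast)+
qed

section \<open>Computing in presented groups\<close>

lemma presented_group_ops:
  "inv\<^bsub>presented_group R\<^esub> (word_class R u) = word_class R (word_inv u)"
  "word_class R u [^]\<^bsub>presented_group R\<^esub> (n::nat) = word_class R (word_pow u n)"
  "comm (presented_group R) (word_class R u) (word_class R v) = word_class R (word_comm u v)"
proof -
  interpret P: group "presented_group R" by (rule group_presented_group)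
  have car: "word_class R u \<in> carrier (presented_group R)" for u by (simp add: carrier_presented_group)
  show inv: "inv\<^bsub>presented_group R\<^esub> (word_class R u) = word_class R (word_inv u)" for u
    using P.inv_equality[of "word_class R (word_inv u)" "word_class R u"] car word_eq_inv_left[of R u]
    by (simp add: mult_presented_group one_presented_group word_class_eq_iff)
  show "word_class R u [^]\<^bsub>presented_group R\<^esub> n = word_class R (word_pow u n)"
  proof (induction n)
    case 0
    show ?case by (simp add: word_pow_def one_presented_group)
  next
    case (Suc n)
    have "word_pow u (Suc n) = word_pow u n @ u"
      unfolding word_pow_def by (induction n) simp_all
    then show ?case using Suc by (simp add: mult_presented_group)
  qed
  show "comm (presented_group R) (word_class R u) (word_class R v) = word_class R (word_comm u v)"
    by (simp add: comm_def inv mult_presented_group word_comm_def)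
qed

lemma presented_group_rel: "(l, r) \<in> R \<Longrightarrow> word_class R l = word_class R r"
  using word_eq.rel[of l r R "[]" "[]"] by (simp add: word_class_eq_iff)

lemma presented_group_generated:
  assumes S: "subgroup S (presented_group R)" and gens: "\<And>g. word_class R (gen g) \<in> S"
  shows "S = carrier (presented_group R)"
proof -
  interpret P: group "presented_group R" by (rule group_presented_group)
  have "word_class R w \<in> S" for w
  proof (induction w)
    case Nil
    then show ?case using subgroup.one_closed[OF S] by (simp add: one_presented_group)
  next
    case (Cons a w)
    obtain g b where a: "a = (g, b)" by force
    have "word_class R [(g, b)] \<in> S"
    proof (cases b)
      case True
      then show ?thesis using gens[of g] by (simp add: gen_def)
    next
      case False
      have "inv\<^bsub>presented_group R\<^esub> (word_class R (gen g)) = word_class R [(g, b)]"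
        using False by (simp add: presented_group_ops gen_def word_inv_def)
      then show ?thesis using subgroup.m_inv_closed[OF S gens[of g]] by simp
    qed
    then have "word_class R [(g, b)] \<otimes>\<^bsub>presented_group R\<^esub> word_class R w \<in> S"
      using Cons by (rule subgroup.m_closed[OF S])
    then show ?case by (simp add: a mult_presented_group)
  qed
  then show ?thesis using subgroup.subset[OF S] by (auto simp: carrier_presented_group)
qed

section \<open>The relations in the two families\<close>

lemma dvd_diff_trans: "(m::int) dvd a - b \<Longrightarrow> m dvd b - c \<Longrightarrow> m dvd a - c"
  using dvd_add[of m "a - b" "b - c"] by simp

text \<open>The model of \<open>\<Phi>\<^sub>7(1\<^sup>5)\<close>: it acts on \<open>\<int> \<times> \<int> \<times> \<int>\<close> by maps \<open>(i, j, k) \<mapsto> (i + a, j + b, k + q(i, j))\<close>,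
  the last coordinate being taken modulo \<open>p\<close> if \<open>p \<noteq> 3\<close> and modulo \<open>9\<close> if \<open>p = 3\<close>. Since
  \<open>2 [i(i - 1)/2 + j]\<close> has differences \<open>2i\<close> in \<open>i\<close> and \<open>2\<close> in \<open>j\<close>, no division by \<open>2\<close> is needed.\<close>

fun act7 :: "int \<Rightarrow> int \<Rightarrow> gens7 \<Rightarrow> bool \<Rightarrow> int \<times> int \<times> int \<Rightarrow> int \<times> int \<times> int" where
  "act7 s t Alpha e (i, j, k) = ((if e then i + 1 else i - 1), j, k)"
| "act7 s t Alpha1 e (i, j, k) = (i, j, (if e then k + (s * (i * (i - 1) + 2 * j) - t) else k - (s * (i * (i - 1) + 2 * j) - t)))"
| "act7 s t Alpha2 e (i, j, k) = (i, j, (if e then k + 2 * s * i else k - 2 * s * i))"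
| "act7 s t Alpha3 e (i, j, k) = (i, j, (if e then k + 2 * s else k - 2 * s))"
| "act7 s t Beta e (i, j, k) = (i, (if e then j + 1 else j - 1), k)"

definition E7 :: "int \<Rightarrow> int \<Rightarrow> int \<times> int \<times> int \<Rightarrow> int \<times> int \<times> int \<Rightarrow> bool" where
  "E7 s p v w \<longleftrightarrow> p dvd fst v - fst w \<and> p dvd fst (snd v) - fst (snd w) \<and> s * p dvd snd (snd v) - snd (snd w)"

lemma E7_refl: "E7 s p v v" by (simp add: E7_def)
lemma E7_sym: "E7 s p v w \<Longrightarrow> E7 s p w v" by (simp add: E7_def dvd_diff_commute)
lemma E7_trans: "E7 s p u v \<Longrightarrow> E7 s p v w \<Longrightarrow> E7 s p u w"
  unfolding E7_def by (blast intro: dvd_diff_trans)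

lemma E7_act:
  assumes "E7 s p v w" shows "E7 s p (act7 s t g e v) (act7 s t g e w)"
proof -
  obtain i j k where v: "v = (i, j, k)" by (metis surj_pair)
  obtain i' j' k' where w: "w = (i', j', k')" by (metis surj_pair)
  obtain a b q where a: "i = i' + p * a" "j = j' + p * b" "k = k' + s * p * q"
    using assms unfolding E7_def v w dvd_def by (auto simp: algebra_simps)
  show ?thesis
  proof (cases g)
    case Alpha1
    \<comment> \<open>\<open>p * D\<close> is the change of \<open>i * (i - 1) + 2 * j\<close> when
      \<open>i'\<close> and \<open>j'\<close> grow by multiples of \<open>p\<close>; after scaling
      by \<open>s\<close> it is a multiple of the modulus \<open>s * p\<close> of the last
      coordinate.\<close>
    define D where "D = a * (2 * i' + p * a - 1) + 2 * b"
    define A A' where "A = s * (i * (i - 1) + 2 * j)" and "A' = s * (i' * (i' - 1) + 2 * j')"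
    have "A = A' + s * p * D"
      unfolding A_def A'_def D_def a by (simp add: algebra_simps)
    then have "(k + (A - t)) - (k' + (A' - t)) = s * p * (q + D)" "(k - (A - t)) - (k' - (A' - t)) = s * p * (q - D)"
      unfolding a by (simp_all add: algebra_simps)
    then have "s * p dvd (k + (A - t)) - (k' + (A' - t))" "s * p dvd (k - (A - t)) - (k' - (A' - t))"
      by (metis dvd_triv_left)+
    moreover have "p dvd i - i'" "p dvd j - j'" using a by simp_all
    ultimately show ?thesis unfolding E7_def v w Alpha1 by (simp add: A_def A'_def)
  next
    case Alpha2
    have "(k + 2 * s * i) - (k' + 2 * s * i') = s * p * (q + 2 * a)" "(k - 2 * s * i) - (k' - 2 * s * i') = s * p * (q - 2 * a)"
      unfolding a by (simp_all add: algebra_simps)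
    then have "s * p dvd (k + 2 * s * i) - (k' + 2 * s * i')" "s * p dvd (k - 2 * s * i) - (k' - 2 * s * i')"
      by (metis dvd_triv_left)+
    moreover have "p dvd i - i'" "p dvd j - j'" using a by simp_all
    ultimately show ?thesis unfolding E7_def v w Alpha2 by simp
  qed (auto simp: E7_def v w a)
qed

lemma act7_inverse: "act7 s t g e (act7 s t g (\<not> e) v) = v"
  by (cases g; cases e; cases v rule: prod_cases3) auto

lemma act7_funpow:
  "(act7 s t Alpha True ^^ n) (i, j, k) = (i + int n, j, k)"
  "(act7 s t Alpha1 True ^^ n) (i, j, k) = (i, j, k + int n * (s * (i * (i - 1) + 2 * j) - t))"
  "(act7 s t Alpha2 True ^^ n) (i, j, k) = (i, j, k + int n * (2 * s * i))"
  "(act7 s t Alpha3 True ^^ n) (i, j, k) = (i, j, k + int n * (2 * s))"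
  "(act7 s t Beta True ^^ n) (i, j, k) = (i, j + int n, k)"
  by (induction n) (simp_all add: algebra_simps)

definition relations7 :: "nat \<Rightarrow> (gens7 word \<times> gens7 word) set" where
  "relations7 p =
    {(word_comm (gen Alpha1) (gen Alpha), gen Alpha2), (word_comm (gen Alpha2) (gen Alpha), gen Alpha3),
     (word_comm (gen Alpha1) (gen Beta), gen Alpha3), (word_pow (gen Alpha) p, []),
     (if p = 3 then word_pow (gen Alpha1) 3 @ word_pow (gen Alpha2) 3 @ gen Alpha3 else word_pow (gen Alpha1) p, []),
     (word_pow (gen Alpha2) p, []), (word_pow (gen Alpha3) p, []), (word_pow (gen Beta) p, [])} \<union>
    {(word_comm (gen Alpha3) (gen Alpha), []), (word_comm (gen Alpha) (gen Beta), []),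
     (word_comm (gen Alpha2) (gen Beta), []), (word_comm (gen Alpha3) (gen Beta), []),
     (word_comm (gen Alpha1) (gen Alpha2), []), (word_comm (gen Alpha1) (gen Alpha3), []),
     (word_comm (gen Alpha2) (gen Alpha3), [])}"

lemma Phi7_15_eq: "Phi7_15 p = presented_group (relations7 p)"
  by (simp add: Phi7_15_def relations7_def Let_def)

lemma word_action_gen: "word_action act (gen g) = act g True"
  by (rule ext) (simp add: gen_def)

lemma word_action_comm_gen:
  "word_action act (word_comm (gen g) (gen h)) v = act g False (act h False (act g True (act h True v)))"
  by (simp add: word_comm_def word_inv_def gen_def)

lemma Phi7_nontrivial:
  assumes p: "Factorial_Ring.prime p" "odd p"
  shows "word_class (relations7 p) (gen Alpha3) \<noteq> \<one>\<^bsub>Phi7_15 p\<^esub>"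
proof
  \<comment> \<open>For \<open>p = 3\<close> the last coordinate is taken modulo 9 while the others
    stay modulo 3, whence the scaling \<open>s = 3\<close>. The word \<alpha>1^3 \<alpha>2^3
    \<alpha>3 then adds \<open>6 - 3 * t\<close> up to multiples of 9, so \<open>t = 2\<close> makes
    it trivial.\<close>
  define s t :: int where "s = (if p = 3 then 3 else 1)" and "t = (if p = 3 then 2 else 0)"
  assume "word_class (relations7 p) (gen Alpha3) = \<one>\<^bsub>Phi7_15 p\<^esub>"
  then have eq: "word_eq (relations7 p) (gen Alpha3) []"
    by (simp add: Phi7_15_eq one_presented_group word_class_eq_iff)
  have rels: "E7 s (int p) (word_action (act7 s t) l v) (word_action (act7 s t) r v)"
    if "(l, r) \<in> relations7 p" for l r v
  proof -
    obtain i j k where v: "v = (i, j, k)" by (metis surj_pair)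
    have first: "E7 s (int p) (word_action (act7 s t) (if p = 3 then word_pow (gen Alpha1) 3 @ word_pow (gen Alpha2) 3 @ gen Alpha3 else word_pow (gen Alpha1) p) v) v"
    proof (cases "p = 3")
      case True
      have "3 * (3 * (i * (i - 1) + 2 * j) - 2) + (3 * (2 * 3 * i) + 2 * 3) = 9 * (i * (i - 1) + 2 * j + 2 * i)"
        by (simp add: algebra_simps)
      then have "(9::int) dvd 3 * (3 * (i * (i - 1) + 2 * j) - 2) + (3 * (2 * 3 * i) + 2 * 3)" by (metis dvd_triv_left)
      then show ?thesis
        using True by (simp add: v E7_def s_def t_def word_action_append word_action_pow word_action_gen act7_funpow del: funpow.simps)
    next
      case False
      then show ?thesis
        by (simp add: v E7_def s_def t_def word_action_pow word_action_gen act7_funpow)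
    qed
    have "s * int p dvd int p * (2 * s * i)" "s * int p dvd int p * (2 * s)" by (simp_all add: dvd_def mult_ac)
    with that first show ?thesis
      unfolding relations7_def
      by (elim UnE insertE emptyE)
        (auto simp: v E7_def word_action_comm_gen word_action_pow word_action_gen act7_funpow algebra_simps split: if_splits)
  qed
  have "E7 s (int p) (word_action (act7 s t) (gen Alpha3) (0, 0, 0)) (word_action (act7 s t) [] (0, 0, 0))"
    by (rule word_eq_action[OF eq, where E = "E7 s (int p)" and act = "act7 s t"])
      (simp_all only: act7_inverse E7_refl E7_act rels, erule E7_sym, erule (1) E7_trans)
  \<comment> \<open>\<open>Alpha3\<close> adds \<open>2 * s\<close> to a coordinate that is taken
    modulo \<open>s * p\<close>.\<close>
  then have "s * int p dvd s * 2" by (simp add: E7_def gen_def mult.commute)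
  then have "int p dvd 2" by (simp add: s_def split: if_splits)
  then have "p dvd 2" by presburger
  then show False using p by (metis primes_dvd_imp_eq two_is_prime_nat even_numeral)
qed

text \<open>In the notation of \<open>phi_group\<close>, \<open>z1\<close> is \<alpha>3 and
  \<open>z2\<close> its inverse; the presentation makes \<alpha>3 central, and the action above
  makes it nontrivial.\<close>

lemma Phi7_phi_relations:
  assumes p: "Factorial_Ring.prime p" "odd p"
  shows "\<exists>x y c d. phi_relations p (Phi7_15 p) x y c d"
proof -
  let ?H = "Phi7_15 p"
  interpret H: group ?H unfolding Phi7_15_eq by (rule group_presented_group)
  define g where "g k = word_class (relations7 p) (gen k)" for k
  have car [simp]: "g k \<in> carrier ?H" for k by (simp add: g_def Phi7_15_eq carrier_presented_group)
  have comm: "comm ?H (g k) (g l) = word_class (relations7 p) (word_comm (gen k) (gen l))" for k l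
    by (simp add: g_def Phi7_15_eq presented_group_ops)
  have pow: "g k [^]\<^bsub>?H\<^esub> (n::nat) = word_class (relations7 p) (word_pow (gen k) n)" for k n
    by (simp add: g_def Phi7_15_eq presented_group_ops)
  have one: "\<one>\<^bsub>?H\<^esub> = word_class (relations7 p) []" by (simp add: Phi7_15_eq one_presented_group)
  have rel1: "comm ?H (g Alpha1) (g Alpha) = g Alpha2" "comm ?H (g Alpha2) (g Alpha) = g Alpha3"
    "comm ?H (g Alpha1) (g Beta) = g Alpha3"
    unfolding comm unfolding g_def by (rule presented_group_rel, simp add: relations7_def)+
  have rel2: "comm ?H (g Alpha3) (g Alpha) = \<one>\<^bsub>?H\<^esub>" "comm ?H (g Alpha) (g Beta) = \<one>\<^bsub>?H\<^esub>"
    "comm ?H (g Alpha2) (g Beta) = \<one>\<^bsub>?H\<^esub>" "comm ?H (g Alpha3) (g Beta) = \<one>\<^bsub>?H\<^esub>"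
    "comm ?H (g Alpha1) (g Alpha2) = \<one>\<^bsub>?H\<^esub>" "comm ?H (g Alpha1) (g Alpha3) = \<one>\<^bsub>?H\<^esub>"
    "comm ?H (g Alpha2) (g Alpha3) = \<one>\<^bsub>?H\<^esub>"
    unfolding comm one by (rule presented_group_rel, simp add: relations7_def)+
  have rel3: "g Alpha [^]\<^bsub>?H\<^esub> p = \<one>\<^bsub>?H\<^esub>" "g Alpha2 [^]\<^bsub>?H\<^esub> p = \<one>\<^bsub>?H\<^esub>"
    "g Alpha3 [^]\<^bsub>?H\<^esub> p = \<one>\<^bsub>?H\<^esub>" "g Beta [^]\<^bsub>?H\<^esub> p = \<one>\<^bsub>?H\<^esub>"
    unfolding pow one by (rule presented_group_rel, simp add: relations7_def)+
  have a3_neq: "g Alpha3 \<noteq> \<one>\<^bsub>?H\<^esub>" using Phi7_nontrivial[OF p] by (simp add: g_def)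
  have commutes: "g k \<otimes>\<^bsub>?H\<^esub> g l = g l \<otimes>\<^bsub>?H\<^esub> g k" if "comm ?H (g k) (g l) = \<one>\<^bsub>?H\<^esub>" for k l
    using H.comm_eq_one_iff[OF car car] that by simp
  have a3_gen: "g Alpha3 \<otimes>\<^bsub>?H\<^esub> g k = g k \<otimes>\<^bsub>?H\<^esub> g Alpha3" for k
    using commutes rel2 by (cases k) metis+
  have a3: "g Alpha3 \<in> center ?H"
  proof -
    have "H.centralizer (g Alpha3) = carrier ?H"
      using H.subgroup_centralizer[OF car] a3_gen car unfolding Phi7_15_eq g_def
      by (intro presented_group_generated) (simp_all add: group.centralizer_def[OF group_presented_group])
    then show ?thesis by (auto simp: H.centralizer_def center_def)
  qed
  note Z = H.subgroup_center
  note one_Z = subgroup.one_closed[OF Z]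
  \<comment> \<open>For \<open>p = 3\<close> the special relation gives \<alpha>1^3 = \<alpha>3^-1,
    as \<alpha>2^3 = 1; this is nontrivial but still central.\<close>
  have a1p: "g Alpha1 [^]\<^bsub>?H\<^esub> p \<in> center ?H"
  proof (cases "p = 3")
    case True
    have "word_class (relations7 p) (word_pow (gen Alpha1) 3 @ word_pow (gen Alpha2) 3 @ gen Alpha3) = \<one>\<^bsub>?H\<^esub>"
      unfolding one by (rule presented_group_rel) (simp add: relations7_def True)
    moreover have "word_class (relations7 p) (word_pow (gen Alpha1) p) \<otimes>\<^bsub>?H\<^esub>
        (word_class (relations7 p) (word_pow (gen Alpha2) p) \<otimes>\<^bsub>?H\<^esub> word_class (relations7 p) (gen Alpha3)) =
        word_class (relations7 p) (word_pow (gen Alpha1) p @ word_pow (gen Alpha2) p @ gen Alpha3)"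
      unfolding Phi7_15_eq by (simp only: mult_presented_group)
    ultimately have "g Alpha1 [^]\<^bsub>?H\<^esub> p \<otimes>\<^bsub>?H\<^esub> (g Alpha2 [^]\<^bsub>?H\<^esub> p \<otimes>\<^bsub>?H\<^esub> g Alpha3) = \<one>\<^bsub>?H\<^esub>"
      unfolding pow using True by (simp add: g_def)
    then have "g Alpha1 [^]\<^bsub>?H\<^esub> p = inv\<^bsub>?H\<^esub> g Alpha3"
      using rel3 H.inv_equality[of "g Alpha1 [^]\<^bsub>?H\<^esub> p" "g Alpha3"] by simp
    then show ?thesis using subgroup.m_inv_closed[OF Z a3] by simp
  next
    case False
    have "g Alpha1 [^]\<^bsub>?H\<^esub> p = \<one>\<^bsub>?H\<^esub>"
      unfolding pow one by (rule presented_group_rel) (simp add: relations7_def False)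
    then show ?thesis using one_Z by simp
  qed
  have ba: "comm ?H (g Beta) (g Alpha1) = inv\<^bsub>?H\<^esub> g Alpha3"
    using H.comm_swap[of "g Alpha1" "g Beta"] rel1 by simp
  have "phi_relations p ?H (g Alpha1) (g Alpha) (g Alpha2) (g Beta)"
    unfolding phi_relations_def
  proof (intro conjI allI impI)
    show "comm ?H (g Alpha2) (g Alpha1) = \<one>\<^bsub>?H\<^esub>"
      using H.comm_swap[of "g Alpha1" "g Alpha2"] rel2 by simp
    show "comm ?H (g Beta) (g Alpha) = \<one>\<^bsub>?H\<^esub>"
      using H.comm_swap[of "g Alpha" "g Beta"] rel2 by simp
    show "comm ?H (g Beta) (g Alpha1) \<in> center ?H"
      unfolding ba by (rule subgroup.m_inv_closed[OF Z a3])
    show "comm ?H (g Beta) (g Alpha1) \<noteq> \<one>\<^bsub>?H\<^esub>"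
      unfolding ba using a3_neq by (simp add: H.inv_eq_1_iff)
    show "\<exists>i::nat. g Alpha1 [^]\<^bsub>?H\<^esub> p \<otimes>\<^bsub>?H\<^esub> inv\<^bsub>?H\<^esub> (g Alpha2 [^]\<^bsub>?H\<^esub> i) \<in> center ?H"
      using a1p by (intro exI[of _ 0]) simp
    show "\<exists>j::nat. g Alpha [^]\<^bsub>?H\<^esub> p \<otimes>\<^bsub>?H\<^esub> inv\<^bsub>?H\<^esub> (g Beta [^]\<^bsub>?H\<^esub> j) \<in> center ?H"
      using rel3 one_Z by (intro exI[of _ 0]) simp
    fix S assume S: "subgroup S ?H" "center ?H \<subseteq> S" "g Alpha1 \<in> S" "g Alpha \<in> S" "g Beta \<in> S"
    have "comm ?H (g Alpha1) (g Alpha) \<in> S"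
      unfolding comm_def using S by (simp add: subgroup.m_closed subgroup.m_inv_closed)
    then have "g k \<in> S" for k using S a3 rel1 by (cases k) auto
    then show "S = carrier ?H"
      using S(1) unfolding Phi7_15_eq g_def by (intro presented_group_generated)
  qed (use rel1 rel2 rel3 a3 a3_neq one_Z in simp_all)
  then show ?thesis by blast
qed

text \<open>The model of \<open>\<Phi>\<^sub>8(32)\<close>: affine maps modulo \<open>p\<^sup>3\<close>. As words act by composition from the right,
  \<open>\<alpha>\<^sub>2\<close> is multiplication by the inverse \<open>1 - p + p\<^sup>2\<close> of \<open>1 + p\<close>.\<close>

fun act8 :: "int \<Rightarrow> gens8 \<Rightarrow> bool \<Rightarrow> int \<Rightarrow> int" where
  "act8 p Alpha1' e v = (if e then v + 1 else v - 1)"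
| "act8 p Alpha2' e v = (if e then (1 - p + p\<^sup>2) * v else (1 + p) * v)"
| "act8 p Beta' e v = (if e then v + p else v - p)"

definition relations8 :: "nat \<Rightarrow> (gens8 word \<times> gens8 word) set" where
  "relations8 p =
    {(word_comm (gen Alpha1') (gen Alpha2'), gen Beta'), (gen Beta', word_pow (gen Alpha1') p),
     (word_pow (gen Beta') (p\<^sup>2), []), (word_pow (gen Alpha2') (p\<^sup>2), [])}"

lemma Phi8_32_eq: "Phi8_32 p = presented_group (relations8 p)"
  by (simp add: Phi8_32_def relations8_def Let_def)

section \<open>Powers of 1 + p modulo p^3\<close>

lemma one_plus_pow:
  "\<exists>k. (1 + p) ^ n = 1 + n * p + (n * (n - 1) div 2) * p\<^sup>2 + p ^ 3 * (k::nat)"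
proof (induction n)
  case 0
  show ?case by (intro exI[of _ 0]) simp
next
  case (Suc n)
  then obtain k where k: "(1 + p) ^ n = 1 + n * p + (n * (n - 1) div 2) * p\<^sup>2 + p ^ 3 * k" by blast
  have tri: "Suc n * (Suc n - 1) div 2 = n * (n - 1) div 2 + n"
    by (cases n) (simp_all add: algebra_simps)
  have "(1 + p) ^ Suc n = 1 + Suc n * p + (n * (n - 1) div 2 + n) * p\<^sup>2 + p ^ 3 * (n * (n - 1) div 2 + k + k * p)"
    unfolding power_Suc k by (simp add: algebra_simps power2_eq_square power3_eq_cube)
  then show ?case unfolding tri by blast
qed

text \<open>For odd \<open>p\<close> the binomial coefficient p(p - 1)/2 is a multiple of
  \<open>p\<close>, so the quadratic term is absorbed by p^3.\<close>

lemma one_plus_pow_p: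
  assumes "odd p"
  shows "\<exists>k::nat. (1 + p) ^ p = 1 + p\<^sup>2 + p ^ 3 * k"
proof -
  obtain k where k: "(1 + p) ^ p = 1 + p * p + (p * (p - 1) div 2) * p\<^sup>2 + p ^ 3 * k"
    using one_plus_pow[of p p] by blast
  obtain q where q: "p = 2 * q + 1" using assms by (rule oddE)
  have "p * (p - 1) = 2 * (p * q)" by (simp add: q)
  then have "p * (p - 1) div 2 = p * q" by (simp only: nonzero_mult_div_cancel_left[OF zero_neq_numeral[symmetric]])
  then have "(1 + p) ^ p = 1 + p\<^sup>2 + p ^ 3 * (q + k)"
    unfolding k by (simp add: algebra_simps power2_eq_square power3_eq_cube)
  then show ?thesis by blast
qed

lemma one_plus_pow_p2:
  assumes "odd p"
  shows "\<exists>k::nat. (1 + p) ^ (p\<^sup>2) = 1 + p ^ 3 * k"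
proof -
  obtain k where k: "(1 + p) ^ (p\<^sup>2) = 1 + p\<^sup>2 * p + (p\<^sup>2 * (p\<^sup>2 - 1) div 2) * p\<^sup>2 + p ^ 3 * k"
    using one_plus_pow[of p "p\<^sup>2"] by blast
  have "odd (p\<^sup>2)" using assms by simp
  then obtain q where q: "p\<^sup>2 = 2 * q + 1" by (rule oddE)
  have "p\<^sup>2 * (p\<^sup>2 - 1) = 2 * (p\<^sup>2 * q)" by (simp add: q)
  then have "p\<^sup>2 * (p\<^sup>2 - 1) div 2 = p\<^sup>2 * q" by (simp only: nonzero_mult_div_cancel_left[OF zero_neq_numeral[symmetric]])
  then have "(1 + p) ^ (p\<^sup>2) = 1 + p ^ 3 * (1 + p * q + k)"
    unfolding k by (simp add: algebra_simps power2_eq_square power3_eq_cube)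
  then show ?thesis by blast
qed

lemma act8_funpow:
  "(act8 p Alpha1' True ^^ n) v = v + int n"
  "(act8 p Alpha2' True ^^ n) v = (1 - p + p\<^sup>2) ^ n * v"
  "(act8 p Beta' True ^^ n) v = v + int n * p"
  by (induction n) (simp_all add: algebra_simps)

lemma Phi8_nontrivial:
  assumes p: "Factorial_Ring.prime p" "odd p"
  shows "word_class (relations8 p) (gen Alpha1') [^]\<^bsub>Phi8_32 p\<^esub> p\<^sup>2 \<noteq> \<one>\<^bsub>Phi8_32 p\<^esub>"
proof
  define E where "E v w \<longleftrightarrow> int p ^ 3 dvd v - w" for v w :: int
  have inv_p: "(1 - int p + (int p)\<^sup>2) * (1 + int p) = 1 + int p ^ 3"
    by (simp add: algebra_simps power2_eq_square power3_eq_cube)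
  assume "word_class (relations8 p) (gen Alpha1') [^]\<^bsub>Phi8_32 p\<^esub> p\<^sup>2 = \<one>\<^bsub>Phi8_32 p\<^esub>"
  then have eq: "word_eq (relations8 p) (word_pow (gen Alpha1') (p\<^sup>2)) []"
    by (simp add: Phi8_32_eq one_presented_group word_class_eq_iff presented_group_ops)
  \<comment> \<open>The relation for \<alpha>2. Its multiplier and 1 + p are inverse modulo p^3, and
    the power of 1 + p with exponent p^2 is 1 there, so the same power of the multiplier is 1 as
    well.\<close>
  have a2: "int p ^ 3 dvd (1 - int p + (int p)\<^sup>2) ^ (p\<^sup>2) * v - v" for v
  proof -
    obtain k :: nat where "(1 + p) ^ (p\<^sup>2) = 1 + p ^ 3 * k" using one_plus_pow_p2[OF p(2)] by blast
    then have "int ((1 + p) ^ (p\<^sup>2)) = int (1 + p ^ 3 * k)" by (rule arg_cong)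
    then have k: "(1 + int p) ^ (p\<^sup>2) = 1 + int p ^ 3 * int k" by simp
    let ?w = "(1 - int p + (int p)\<^sup>2) ^ (p\<^sup>2)"
    have "?w * (1 + int p) ^ (p\<^sup>2) = (1 + int p ^ 3) ^ (p\<^sup>2)"
      unfolding power_mult_distrib[symmetric] inv_p ..
    then have w: "?w * (1 + int p ^ 3 * int k) = (1 + int p ^ 3) ^ (p\<^sup>2)" unfolding k .
    have "int p ^ 3 dvd (1 + int p ^ 3) ^ m - 1" for m
    proof (induction m)
      case (Suc m)
      have "(1 + int p ^ 3) ^ Suc m - 1 = ((1 + int p ^ 3) ^ m - 1) + int p ^ 3 * (1 + int p ^ 3) ^ m"
        by (simp add: algebra_simps)
      then show ?case using Suc by (simp only: dvd_add dvd_triv_left)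
    qed simp
    then have "int p ^ 3 dvd ?w * (1 + int p ^ 3 * int k) - 1" unfolding w .
    then have "int p ^ 3 dvd (?w * (1 + int p ^ 3 * int k) - 1) - int p ^ 3 * (?w * int k)"
      by (rule dvd_diff) simp
    also have "(?w * (1 + int p ^ 3 * int k) - 1) - int p ^ 3 * (?w * int k) = ?w - 1"
      by (simp add: algebra_simps)
    finally have "int p ^ 3 dvd (?w - 1) * v" by simp
    then show ?thesis by (simp add: left_diff_distrib)
  qed
  have rels: "E (word_action (act8 (int p)) l v) (word_action (act8 (int p)) r v)" if "(l, r) \<in> relations8 p" for l r v
  proof -
    \<comment> \<open>The word [\<alpha>1, \<alpha>2] evaluated from its right end: multiply by 1 -
      p + p^2, add 1, multiply by 1 + p, subtract 1. Modulo p^3 this is translation by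
      \<open>p\<close>, the action of \<beta>.\<close>
    have "(1 + int p) * ((1 - int p + (int p)\<^sup>2) * v + 1) - 1 - (v + int p) = int p ^ 3 * v"
      by (simp add: algebra_simps power2_eq_square power3_eq_cube)
    moreover have "(1 + int p) * ((1 - int p + (int p)\<^sup>2) * v) - v = int p ^ 3 * v"
      by (simp add: algebra_simps power2_eq_square power3_eq_cube)
    moreover have "(1 + int p) * ((1 - int p + (int p)\<^sup>2) * v + 1) = (1 + int p) * ((1 - int p + (int p)\<^sup>2) * v) + (1 + int p)"
      by (simp add: algebra_simps)
    ultimately have c: "int p ^ 3 dvd (1 + int p) * ((1 - int p + (int p)\<^sup>2) * v + 1) - 1 - (v + int p)" by simp
    have "int (p\<^sup>2) * int p = int p ^ 3" by (simp add: power2_eq_square power3_eq_cube)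
    moreover have "word_action (act8 (int p)) (word_pow (gen Alpha1') n) v = v + int n"
      "word_action (act8 (int p)) (word_pow (gen Alpha2') n) v = (1 - int p + (int p)\<^sup>2) ^ n * v"
      "word_action (act8 (int p)) (word_pow (gen Beta') n) v = v + int n * int p" for n
      by (simp_all only: word_action_pow word_action_gen act8_funpow)
    ultimately show ?thesis
      using that c a2[of v] unfolding relations8_def
      by (elim insertE emptyE)
        (simp_all add: E_def word_action_comm_gen word_action_gen del: of_nat_power)
  qed
  have "E (word_action (act8 (int p)) (word_pow (gen Alpha1') (p\<^sup>2)) 0) (word_action (act8 (int p)) [] 0)"
  proof (rule word_eq_action[OF eq, where E = E and act = "act8 (int p)"])
    show "E v v" for v by (simp add: E_def)
    show "E w v" if "E v w" for v w using that by (simp add: E_def dvd_diff_commute)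
    show "E u w" if "E u v" "E v w" for u v w using that unfolding E_def by (rule dvd_diff_trans)
    show "E (act8 (int p) g b v) (act8 (int p) g b w)" if "E v w" for g b v w
      using that by (cases g) (simp_all add: E_def right_diff_distrib[symmetric])
    show "E (act8 (int p) g b (act8 (int p) g (\<not> b) v)) v" for g b v
    proof -
      have "(1 - int p + (int p)\<^sup>2) * ((1 + int p) * v) - v = int p ^ 3 * v"
        "(1 + int p) * ((1 - int p + (int p)\<^sup>2) * v) - v = int p ^ 3 * v"
        by (simp_all add: algebra_simps power2_eq_square power3_eq_cube)
      then show ?thesis by (cases g; cases b) (simp_all add: E_def)
    qed
  qed (rule rels)
  \<comment> \<open>The word in question translates by p^2, which is not 0 modulo p^3.\<close>
  then have "int p ^ 3 dvd int (p\<^sup>2)"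
    unfolding word_action_pow word_action_gen act8_funpow by (simp add: E_def)
  then have "p ^ 3 dvd p\<^sup>2" by (metis of_nat_dvd_iff of_nat_power)
  then have "p ^ 3 \<le> p ^ 2" using prime_gt_0_nat[OF p(1)] by (intro dvd_imp_le) auto
  then show False using prime_gt_1_nat[OF p(1)] by (simp add: power_increasing_iff)
qed

text \<open>The relations say that conjugation by \<open>y\<close> raises \<open>x\<close> to the
  power 1 + p and that \<open>x\<close> has order dividing p^3, so everything reduces to exponents
  of \<open>x\<close> modulo p^3. In the notation of \<open>phi_group\<close>, \<open>z1\<close> is
  \<open>x [^] p\<^sup>2\<close> and \<open>z2\<close> its inverse.\<close>

lemma Phi8_phi_relations:
  assumes p: "Factorial_Ring.prime p" "odd p"
  shows "\<exists>x y c d. phi_relations p (Phi8_32 p) x y c d"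
proof -
  let ?H = "Phi8_32 p"
  interpret H: group ?H unfolding Phi8_32_eq by (rule group_presented_group)
  define g where "g k = word_class (relations8 p) (gen k)" for k
  have car [simp]: "g k \<in> carrier ?H" for k by (simp add: g_def Phi8_32_eq carrier_presented_group)
  define x y where "x = g Alpha1'" and "y = g Alpha2'"
  have [simp]: "x \<in> carrier ?H" "y \<in> carrier ?H" by (simp_all add: x_def y_def)
  have comm: "comm ?H (g k) (g l) = word_class (relations8 p) (word_comm (gen k) (gen l))" for k l
    by (simp add: g_def Phi8_32_eq presented_group_ops)
  have pow: "g k [^]\<^bsub>?H\<^esub> (n::nat) = word_class (relations8 p) (word_pow (gen k) n)" for k n
    by (simp add: g_def Phi8_32_eq presented_group_ops)
  have one: "\<one>\<^bsub>?H\<^esub> = word_class (relations8 p) []" by (simp add: Phi8_32_eq one_presented_group)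
  have xy_b: "comm ?H x y = g Beta'"
    unfolding x_def y_def comm unfolding g_def by (rule presented_group_rel) (simp add: relations8_def)
  have b_xp: "g Beta' = x [^]\<^bsub>?H\<^esub> p"
    unfolding x_def pow unfolding g_def by (rule presented_group_rel) (simp add: relations8_def)
  have bp: "g Beta' [^]\<^bsub>?H\<^esub> p\<^sup>2 = \<one>\<^bsub>?H\<^esub>" and yp: "y [^]\<^bsub>?H\<^esub> p\<^sup>2 = \<one>\<^bsub>?H\<^esub>"
    unfolding y_def pow one by (rule presented_group_rel, simp add: relations8_def)+
  have xp3: "x [^]\<^bsub>?H\<^esub> (p ^ 3) = \<one>\<^bsub>?H\<^esub>"
  proof -
    have "x [^]\<^bsub>?H\<^esub> (p * p\<^sup>2) = \<one>\<^bsub>?H\<^esub>" using bp unfolding b_xp by (simp add: H.nat_pow_pow)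
    then show ?thesis by (simp add: power3_eq_cube power2_eq_square mult.assoc)
  qed
  have x_mod: "x [^]\<^bsub>?H\<^esub> (a + p ^ 3 * k) = x [^]\<^bsub>?H\<^esub> a" for a k :: nat
  proof -
    have "x [^]\<^bsub>?H\<^esub> (a + p ^ 3 * k) = x [^]\<^bsub>?H\<^esub> a \<otimes>\<^bsub>?H\<^esub> (x [^]\<^bsub>?H\<^esub> (p ^ 3)) [^]\<^bsub>?H\<^esub> k"
      by (simp add: H.nat_pow_mult H.nat_pow_pow)
    then show ?thesis unfolding xp3 by simp
  qed
  have xy: "x \<otimes>\<^bsub>?H\<^esub> y = y \<otimes>\<^bsub>?H\<^esub> x [^]\<^bsub>?H\<^esub> (1 + p)"
  proof -
    have "x \<otimes>\<^bsub>?H\<^esub> y = y \<otimes>\<^bsub>?H\<^esub> x \<otimes>\<^bsub>?H\<^esub> x [^]\<^bsub>?H\<^esub> p"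
      using H.comm_commutation[of x y] by (simp add: xy_b b_xp)
    then show ?thesis using H.nat_pow_Suc2[of x p] by (simp add: H.m_assoc del: H.nat_pow_Suc)
  qed
  have xny: "x [^]\<^bsub>?H\<^esub> (n::nat) \<otimes>\<^bsub>?H\<^esub> y = y \<otimes>\<^bsub>?H\<^esub> x [^]\<^bsub>?H\<^esub> (n * (1 + p))" for n
  proof (induction n)
    case (Suc n)
    have "x [^]\<^bsub>?H\<^esub> Suc n \<otimes>\<^bsub>?H\<^esub> y = x [^]\<^bsub>?H\<^esub> n \<otimes>\<^bsub>?H\<^esub> (x \<otimes>\<^bsub>?H\<^esub> y)" by (simp add: H.m_assoc)
    also have "\<dots> = (x [^]\<^bsub>?H\<^esub> n \<otimes>\<^bsub>?H\<^esub> y) \<otimes>\<^bsub>?H\<^esub> x [^]\<^bsub>?H\<^esub> (1 + p)" unfolding xy by (simp add: H.m_assoc del: H.nat_pow_Suc add_Suc plus_1_eq_Suc)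
    also have "\<dots> = y \<otimes>\<^bsub>?H\<^esub> x [^]\<^bsub>?H\<^esub> (n * (1 + p) + (1 + p))" unfolding Suc by (simp add: H.m_assoc H.nat_pow_mult del: H.nat_pow_Suc add_Suc plus_1_eq_Suc)
    finally show ?case by (simp add: algebra_simps)
  qed simp
  have xnym: "x [^]\<^bsub>?H\<^esub> (n::nat) \<otimes>\<^bsub>?H\<^esub> y [^]\<^bsub>?H\<^esub> (m::nat) = y [^]\<^bsub>?H\<^esub> m \<otimes>\<^bsub>?H\<^esub> x [^]\<^bsub>?H\<^esub> (n * (1 + p) ^ m)" for n m
  proof (induction m)
    case (Suc m)
    have "x [^]\<^bsub>?H\<^esub> n \<otimes>\<^bsub>?H\<^esub> y [^]\<^bsub>?H\<^esub> Suc m = (x [^]\<^bsub>?H\<^esub> n \<otimes>\<^bsub>?H\<^esub> y [^]\<^bsub>?H\<^esub> m) \<otimes>\<^bsub>?H\<^esub> y" by (simp add: H.m_assoc)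
    also have "\<dots> = y [^]\<^bsub>?H\<^esub> m \<otimes>\<^bsub>?H\<^esub> (x [^]\<^bsub>?H\<^esub> (n * (1 + p) ^ m) \<otimes>\<^bsub>?H\<^esub> y)" unfolding Suc by (simp add: H.m_assoc)
    also have "\<dots> = y [^]\<^bsub>?H\<^esub> Suc m \<otimes>\<^bsub>?H\<^esub> x [^]\<^bsub>?H\<^esub> (n * (1 + p) ^ m * (1 + p))" unfolding xny by (simp add: H.m_assoc)
    finally show ?case by (simp only: power_Suc2 mult.assoc)
  qed simp
  obtain k :: nat where k: "(1 + p) ^ p = 1 + p\<^sup>2 + p ^ 3 * k" using one_plus_pow_p[OF p(2)] by blast
  define z where "z = x [^]\<^bsub>?H\<^esub> (p\<^sup>2)"
  have zc [simp]: "z \<in> carrier ?H" by (simp add: z_def)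
  have z_neq: "z \<noteq> \<one>\<^bsub>?H\<^esub>" using Phi8_nontrivial[OF p] by (simp add: z_def x_def g_def)
  have zy: "z \<otimes>\<^bsub>?H\<^esub> y = y \<otimes>\<^bsub>?H\<^esub> z"
  proof -
    have "p\<^sup>2 * (1 + p) = p\<^sup>2 + p ^ 3 * 1" by (simp add: algebra_simps power2_eq_square power3_eq_cube)
    then show ?thesis unfolding z_def xny by (simp only: x_mod)
  qed
  have x_pow_comm: "x [^]\<^bsub>?H\<^esub> (a::nat) \<otimes>\<^bsub>?H\<^esub> x [^]\<^bsub>?H\<^esub> (b::nat) = x [^]\<^bsub>?H\<^esub> b \<otimes>\<^bsub>?H\<^esub> x [^]\<^bsub>?H\<^esub> a" for a b
    by (simp add: H.nat_pow_mult add.commute)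
  have zx: "z \<otimes>\<^bsub>?H\<^esub> x = x \<otimes>\<^bsub>?H\<^esub> z" using x_pow_comm[of "p\<^sup>2" 1] by (simp add: z_def)
  have gen_all: "S = carrier ?H" if S: "subgroup S ?H" "x \<in> S" "y \<in> S" for S
  proof -
    have "x [^]\<^bsub>?H\<^esub> p \<in> S" by (rule H.subgroup_nat_pow[OF S(1,2)])
    then have "g k \<in> S" for k using S b_xp by (cases k) (simp_all add: x_def y_def)
    then show ?thesis using S(1) unfolding Phi8_32_eq g_def by (intro presented_group_generated)
  qed
  have z_center: "z \<in> center ?H"
  proof -
    have "H.centralizer z = carrier ?H"
      by (rule gen_all[OF H.subgroup_centralizer[OF zc]]) (simp_all add: H.centralizer_def zx zy)
    then show ?thesis by (auto simp: H.centralizer_def center_def)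
  qed
  note one_Z = subgroup.one_closed[OF H.subgroup_center]
  let ?c = "x [^]\<^bsub>?H\<^esub> p" and ?d = "y [^]\<^bsub>?H\<^esub> p"
  have cy: "comm ?H ?c y = z"
  proof (rule H.comm_eqI)
    have "x [^]\<^bsub>?H\<^esub> (p * (1 + p)) = ?c \<otimes>\<^bsub>?H\<^esub> z"
      by (simp add: z_def H.nat_pow_mult power2_eq_square)
    then show "?c \<otimes>\<^bsub>?H\<^esub> y = y \<otimes>\<^bsub>?H\<^esub> ?c \<otimes>\<^bsub>?H\<^esub> z" unfolding xny by (simp add: H.m_assoc)
  qed simp_all
  have xd: "comm ?H x ?d = z"
  proof (rule H.comm_eqI)
    have "x [^]\<^bsub>?H\<^esub> (1 * (1 + p) ^ p) = x [^]\<^bsub>?H\<^esub> (1 + p\<^sup>2)" unfolding k by (simp only: x_mod mult_1)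
    also have "\<dots> = x \<otimes>\<^bsub>?H\<^esub> z" using H.nat_pow_mult[of x 1 "p\<^sup>2"] by (simp add: z_def)
    finally show "x \<otimes>\<^bsub>?H\<^esub> ?d = ?d \<otimes>\<^bsub>?H\<^esub> x \<otimes>\<^bsub>?H\<^esub> z"
      using xnym[of 1 p] by (simp add: H.m_assoc)
  qed simp_all
  have dx: "comm ?H ?d x = inv\<^bsub>?H\<^esub> z" using H.comm_swap[of x ?d] xd by simp
  have pp: "p * p = p\<^sup>2" by (simp add: power2_eq_square)
  have "phi_relations p ?H x y ?c ?d"
    unfolding phi_relations_def
  proof (intro conjI allI impI)
    show "comm ?H x y = ?c" using xy_b b_xp by simp
    show "comm ?H ?c x = \<one>\<^bsub>?H\<^esub>" using x_pow_comm[of p 1] by (simp add: H.comm_eq_one_iff)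
    \<comment> \<open>Modulo p^3 the exponent \<open>p\<close> is fixed by multiplication with (1 +
      p)^p, which means that \<open>x [^] p\<close> and \<open>y [^] p\<close> commute.\<close>
    have "p * (1 + p) ^ p = p + p ^ 3 * (1 + p * k)"
      unfolding k by (simp add: algebra_simps power2_eq_square power3_eq_cube)
    then have "x [^]\<^bsub>?H\<^esub> (p * (1 + p) ^ p) = ?c" by (simp only: x_mod)
    then have "?c \<otimes>\<^bsub>?H\<^esub> ?d = ?d \<otimes>\<^bsub>?H\<^esub> ?c" using xnym[of p p] by simp
    then show "comm ?H ?c ?d = \<one>\<^bsub>?H\<^esub>" by (simp add: H.comm_eq_one_iff)
    show "comm ?H ?d y = \<one>\<^bsub>?H\<^esub>"
      using H.nat_pow_Suc2[of y p] by (simp add: H.comm_eq_one_iff)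
    show "comm ?H ?c y \<in> center ?H" "comm ?H ?c y \<noteq> \<one>\<^bsub>?H\<^esub>" using z_center z_neq by (simp_all add: cy)
    show "comm ?H ?d x \<in> center ?H" unfolding dx by (rule subgroup.m_inv_closed[OF H.subgroup_center z_center])
    show "comm ?H ?d x \<noteq> \<one>\<^bsub>?H\<^esub>" unfolding dx using z_neq by (simp add: H.inv_eq_1_iff)
    show "?c [^]\<^bsub>?H\<^esub> p \<in> center ?H" using z_center by (simp add: H.nat_pow_pow pp z_def)
    show "?d [^]\<^bsub>?H\<^esub> p \<in> center ?H" using one_Z yp by (simp add: H.nat_pow_pow pp)
    show "\<exists>i::nat. ?c \<otimes>\<^bsub>?H\<^esub> inv\<^bsub>?H\<^esub> (?c [^]\<^bsub>?H\<^esub> i) \<in> center ?H"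
      using one_Z by (intro exI[of _ 1]) simp
    show "\<exists>j::nat. ?d \<otimes>\<^bsub>?H\<^esub> inv\<^bsub>?H\<^esub> (?d [^]\<^bsub>?H\<^esub> j) \<in> center ?H"
      using one_Z by (intro exI[of _ 1]) simp
    show "S = carrier ?H" if "subgroup S ?H" "center ?H \<subseteq> S" "x \<in> S" "y \<in> S" "?d \<in> S" for S
      using gen_all that by blast
  qed simp_all
  then show ?thesis by blast
qed

theorem theorem38:
  fixes p :: nat and G :: "('a, 'b) monoid_scheme" and \<zeta> :: complex
  assumes "Factorial_Ring.prime p" and "odd p"
    and "group G" and "Coset.order G = p ^ 5"
    and "in_Phi7 p G \<or> in_Phi8 p G"
    and "primitive_root_of_unity p \<zeta>"
  shows "rat_group_algebra G \<simeq>\<^sub>\<rat>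
           rat_group_algebra (G Mod commutator_subgroup G)
           \<oplus>\<^sub>\<rat> alg_copies p (matrix_algebra p (rat_adjoin \<zeta>))
           \<oplus>\<^sub>\<rat> matrix_algebra (p\<^sup>2) (rat_adjoin \<zeta>)"
proof -
  interpret group G by fact
  have card: "card (carrier G) = p ^ 5" using assms(4) by (simp add: Coset.order_def)
  then have fin: "finite (carrier G)"
    using prime_gt_0_nat[OF assms(1)] by (intro card_ge_0_finite) simp
  have "\<exists>x y c d. phi_relations p G x y c d"
    using assms(5)
  proof
    assume "in_Phi7 p G"
    then have iso: "isoclinic G (Phi7_15 p)" by (simp add: in_Phi7_def)
    obtain x y c d where "phi_relations p (Phi7_15 p) x y c d"
      using Phi7_phi_relations[OF assms(1,2)] by blast
    moreover have "group (Phi7_15 p)" unfolding Phi7_15_eq by (rule group_presented_group)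
    ultimately show ?thesis
      using isoclinic_phi_relations[OF assms(3) _ iso] by blast
  next
    assume "in_Phi8 p G"
    then have iso: "isoclinic G (Phi8_32 p)" by (simp add: in_Phi8_def)
    obtain x y c d where "phi_relations p (Phi8_32 p) x y c d"
      using Phi8_phi_relations[OF assms(1,2)] by blast
    moreover have "group (Phi8_32 p)" unfolding Phi8_32_eq by (rule group_presented_group)
    ultimately show ?thesis
      using isoclinic_phi_relations[OF assms(3) _ iso] by blast
  qed
  then obtain x y c d where "phi_relations p G x y c d" by blast
  then have "phi_group G p x y c d (comm G c y) (comm G d x)"
    by (rule phi_group_of_relations[OF fin assms(1,2) card])
  then show ?thesis by (rule phi_group.rat_group_algebra_iso[OF _ assms(6)])
qed

end
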